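(* Let $n,d\ge 1$ and $\sigma>0$, and suppose Assumptions A1--A4 of the context hold for the losses $f_1,\dots,f_n$ and the comparator space $\mathcal{W}$. Let $\boldsymbol p_1,\dots,\boldsymbol p_n$ be the predictions of the FLH-SIONS algorithm (defined in the context) with parameters $\epsilon=2$, $C=20$ and exp-concavity factor $\sigma$. Then for every comparator sequence $\boldsymbol w_1,\dots,\boldsymbol w_n\in\mathcal{W}$, $$\sum_{t=1}^n \big(f_t(\boldsymbol p_t)-f_t(\boldsymbol w_t)\big)=\tilde O\Big(\max\big\{d^2 n^{1/5}[\mathcal{TV}_1(\boldsymbol w_{1:n})]^{2/5},\ d^2\big\}\Big).$$
   Context: Online protocol: at each round $t=1,\dots,n$ the learner plays $\boldsymbol p_t\in\mathbb{R}^d$, then a loss $f_t:\mathbb{R}^d\to\mathbb{R}$ is revealed (possibly chosen adversarially). Assumptions. A1: all comparators $\boldsymbol w_t$ lie in a given set $\mathcal{W}\subseteq[-1,1]^d$. A2: each $f_t$ is $1$-Lipschitz in $\|\cdot\|_2$ on $[-20,20]^d$. A3: each $f_t$ is $1$-gradient Lipschitz on $[-20,20]^d$; in particular $f_t(\boldsymbol y)\le f_t(\boldsymbol x)+\nabla f_t(\boldsymbol x)^T(\boldsymbol y-\boldsymbol x)+\frac12\|\boldsymbol y-\boldsymbol x\|_2^2$ there. A4: each $f_t$ is $\sigma$ exp-concave on $[-20,20]^d$ (i.e. $e^{-\sigma f_t}$ is concave there), and $f_t(\boldsymbol y)\ge f_t(\boldsymbol x)+\nabla f_t(\boldsymbol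 x)^T(\boldsymbol y-\boldsymbol x)+\frac{\sigma}{2}(\nabla f_t(\boldsymbol x)^T(\boldsymbol y-\boldsymbol x))^2$ for $\boldsymbol x,\boldsymbol y\in[-20,20]^d$. Path length: for a sequence of vectors, $D$ is the first difference operator ($D\boldsymbol v_{1:\ell}=\boldsymbol v_2-\boldsymbol v_1,\dots,\boldsymbol v_\ell-\boldsymbol v_{\ell-1}$), $D^2=D\circ D$, the $\|\cdot\|_1$ norm of a sequence of vectors is the sum of the $\ell_1$ norms of its members (an empty sequence has norm $0$), and $\mathcal{TV}_1(\boldsymbol w_{1:n})=n\|D^2\boldsymbol w_{1:n}\|_1$. SIONS expert $E_j$ (one for each $j\in[n]$, starting at time $j$, parameters $\epsilon,\eta,C>0$). At time $t\ge j$ it receives the co-variate $\boldsymbol x_j^{(t)}=[1,t-j+1]^T\in\mathbb{R}^2$. Put $\mathcal{K}_t=\{\boldsymbol w\in\mathbb{R}^{2d}:|(\boldsymbol x_j^{(t)})^T\boldsymbol w[2k-1:2k]|\le C\ \forall k\in[d]\}$ and $\tilde f_t(\boldsymbol v)=f_t\big((\boldsymbol x_j^{(t)})^T\boldsymbol v[1:2],\dots,(\boldsymbol x_j^{(t)})^T\boldsymbol v[2d-1:2d]\big)$ for $\boldsymbol v\in\mathbb{R}^{2d}$, where $\boldsymbol v[2k-1:2k]\in\mathbb{R}^2$ are the entries $2k-1,2k$. Initialize $\boldsymbol v_j=\boldsymbol 0$. For $t\ge j$ let $\boldsymbol A_t=\epsilon \boldsymbol I_{2d}+\eta\sum_{s=j}^t\nabla\tilde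 f_s(\boldsymbol v_s)\nabla\tilde f_s(\boldsymbol v_s)^T$, $\boldsymbol u_{t+1}=\boldsymbol v_t-\boldsymbol A_t^{-1}\nabla\tilde f_t(\boldsymbol v_t)$, $\boldsymbol v_{t+1}=\arg\min_{\boldsymbol w\in\mathcal{K}_{t+1}}\|\boldsymbol w-\boldsymbol u_{t+1}\|_{\boldsymbol A_t}$. The prediction $E_j(t)\in\mathbb{R}^d$ has coordinates $E_j(t)[k]=(\boldsymbol x_j^{(t)})^T\boldsymbol v_t[2k-1:2k]$. FLH-SIONS with exp-concavity factor $\sigma$: use the experts $E_1,\dots,E_n$ with $\epsilon=2$, $\eta=\sigma$, $C=20$. Maintain probability vectors $v_t=(v_t^{(1)},\dots,v_t^{(t)})$, $v_1^{(1)}=1$. At round $t$ play $\boldsymbol p_t=\sum_{j=1}^t v_t^{(j)}E_j(t)$. After receiving $f_t$, for $1\le i\le t$ set $\hat v_{t+1}^{(i)}=v_t^{(i)}e^{-\sigma f_t(E_i(t))}/\sum_{j=1}^t v_t^{(j)}e^{-\sigma f_t(E_j(t))}$, then $v_{t+1}^{(t+1)}=1/(t+1)$ and $v_{t+1}^{(i)}=(1-\frac1{t+1})\hat v_{t+1}^{(i)}$ for $i\le t$. $\tilde O$ hides poly-logarithmic factors of $n$: $g=\tilde O(h)$ means $g\le K(1+\log n)^{K}h$ with $K$ depending only on $\sigma$. *)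

theory Defs
  imports Complex_Main "Jordan_Normal_Form.Gauss_Jordan_Elimination"
begin

text \<open>
  The dimension is quantified inside the main statement (the hidden constant must not depend on
  it), so Euclidean space of dimension \<open>d\<close> is \<open>carrier_vec d\<close> over the reals.  Vector coordinates
  are counted from 0, rounds and experts from 1.
\<close>

subsection \<open>Euclidean notions on \<open>carrier_vec d\<close>\<close>

definition l2_norm :: "real Matrix.vec \<Rightarrow> real" where
  "l2_norm v = sqrt (v \<bullet> v)"

definition l1_norm :: "real Matrix.vec \<Rightarrow> real" where
  "l1_norm v = (\<Sum>i<dim_vec v. \<bar>v $ i\<bar>)"

definition mahalanobis_norm :: "real mat \<Rightarrow> real Matrix.vec \<Rightarrow> real" where
  "mahalanobis_norm A v = sqrt (v \<bullet> (A *\<^sub>v v))"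

definition cube :: "nat \<Rightarrow> real \<Rightarrow> real Matrix.vec set" where
  "cube d r = {x \<in> carrier_vec d. \<forall>i<d. - r \<le> x $ i \<and> x $ i \<le> r}"

text \<open>
  Frechet differentiability in the full space, as in the library fact \<open>has_derivative_at_alt\<close>;
  the type of vectors of arbitrary dimension is not a normed space.
\<close>

definition has_gradient :: "nat \<Rightarrow> (real Matrix.vec \<Rightarrow> real) \<Rightarrow> real Matrix.vec \<Rightarrow> real Matrix.vec \<Rightarrow> bool" where
  "has_gradient m f x g \<longleftrightarrow> x \<in> carrier_vec m \<and> g \<in> carrier_vec m \<and>
     (\<forall>e>0. \<exists>\<delta>>0. \<forall>y\<in>carrier_vec m. l2_norm (y - x) < \<delta> \<longrightarrow>
        \<bar>f y - f x - g \<bullet> (y - x)\<bar> \<le> e * l2_norm (y - x))"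

definition gradient :: "nat \<Rightarrow> (real Matrix.vec \<Rightarrow> real) \<Rightarrow> real Matrix.vec \<Rightarrow> real Matrix.vec" where
  "gradient m f x = (THE g. has_gradient m f x g)"

subsection \<open>Assumptions on the losses\<close>

definition l2_lipschitz_on :: "real \<Rightarrow> real Matrix.vec set \<Rightarrow> (real Matrix.vec \<Rightarrow> real) \<Rightarrow> bool" where
  "l2_lipschitz_on L S f \<longleftrightarrow> (\<forall>x\<in>S. \<forall>y\<in>S. \<bar>f x - f y\<bar> \<le> L * l2_norm (x - y))"

definition gradient_lipschitz_on ::
    "nat \<Rightarrow> real \<Rightarrow> real Matrix.vec set \<Rightarrow> (real Matrix.vec \<Rightarrow> real) \<Rightarrow> bool" where
  "gradient_lipschitz_on d L S f \<longleftrightarrow>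
     (\<forall>x\<in>S. \<exists>g. has_gradient d f x g) \<and>
     (\<forall>x\<in>S. \<forall>y\<in>S. l2_norm (gradient d f x - gradient d f y) \<le> L * l2_norm (x - y))"

definition exp_concave_on :: "real \<Rightarrow> real Matrix.vec set \<Rightarrow> (real Matrix.vec \<Rightarrow> real) \<Rightarrow> bool" where
  "exp_concave_on \<sigma> S f \<longleftrightarrow>
     (\<forall>x\<in>S. \<forall>y\<in>S. \<forall>u\<in>{0..1}.
        (1 - u) * exp (- \<sigma> * f x) + u * exp (- \<sigma> * f y)
          \<le> exp (- \<sigma> * f ((1 - u) \<cdot>\<^sub>v x + u \<cdot>\<^sub>v y)))"

definition exp_concave_lower_bound_on ::
    "nat \<Rightarrow> real \<Rightarrow> real Matrix.vec set \<Rightarrow> (real Matrix.vec \<Rightarrow> real) \<Rightarrow> bool" where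
  "exp_concave_lower_bound_on d \<sigma> S f \<longleftrightarrow>
     (\<forall>x\<in>S. \<forall>y\<in>S.
        f y \<ge> f x + gradient d f x \<bullet> (y - x) + \<sigma> / 2 * (gradient d f x \<bullet> (y - x))\<^sup>2)"

definition admissible_loss :: "nat \<Rightarrow> real \<Rightarrow> (real Matrix.vec \<Rightarrow> real) \<Rightarrow> bool" where
  "admissible_loss d \<sigma> f \<longleftrightarrow>
     l2_lipschitz_on 1 (cube d 20) f \<and>
     gradient_lipschitz_on d 1 (cube d 20) f \<and>
     exp_concave_on \<sigma> (cube d 20) f \<and>
     exp_concave_lower_bound_on d \<sigma> (cube d 20) f"

subsection \<open>Second order path length\<close>

definition first_diff :: "real Matrix.vec list \<Rightarrow> real Matrix.vec list" where
  "first_diff vs = map2 (\<lambda>v' v. v' - v) (tl vs) vs"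

definition seq_l1_norm :: "real Matrix.vec list \<Rightarrow> real" where
  "seq_l1_norm vs = (\<Sum>v\<leftarrow>vs. l1_norm v)"

definition TV1 :: "real Matrix.vec list \<Rightarrow> real" where
  "TV1 ws = real (length ws) * seq_l1_norm (first_diff (first_diff ws))"

subsection \<open>SIONS experts\<close>

definition covariate :: "nat \<Rightarrow> nat \<Rightarrow> real Matrix.vec" where
  "covariate j t = vec_of_list [1, real t - real j + 1]"

definition block :: "real Matrix.vec \<Rightarrow> nat \<Rightarrow> real Matrix.vec" where
  "block v k = Matrix.vec 2 (\<lambda>i. v $ (2 * k + i))"

definition readout :: "nat \<Rightarrow> nat \<Rightarrow> nat \<Rightarrow> real Matrix.vec \<Rightarrow> real Matrix.vec" where
  "readout d j t v = Matrix.vec d (\<lambda>k. covariate j t \<bullet> block v k)"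

definition lifted_loss ::
    "nat \<Rightarrow> (nat \<Rightarrow> real Matrix.vec \<Rightarrow> real) \<Rightarrow> nat \<Rightarrow> nat \<Rightarrow> real Matrix.vec \<Rightarrow> real" where
  "lifted_loss d f j t v = f t (readout d j t v)"

definition sions_domain :: "nat \<Rightarrow> real \<Rightarrow> nat \<Rightarrow> nat \<Rightarrow> real Matrix.vec set" where
  "sions_domain d C j t =
     {w \<in> carrier_vec (2 * d). \<forall>k<d. \<bar>covariate j t \<bullet> block w k\<bar> \<le> C}"

text \<open>\<open>sions_iterate d \<epsilon> \<eta> C f j m\<close> is the iterate \<open>v\<^sub>t\<close> of the expert started at time \<open>j\<close>, for \<open>t = j + m\<close>.\<close>

fun sions_iterate ::
    "nat \<Rightarrow> real \<Rightarrow> real \<Rightarrow> real \<Rightarrow> (nat \<Rightarrow> real Matrix.vec \<Rightarrow> real) \<Rightarrow> nat \<Rightarrow> nat \<Rightarrow> real Matrix.vec" where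
  "sions_iterate d \<epsilon> \<eta> C f j 0 = 0\<^sub>v (2 * d)"
| "sions_iterate d \<epsilon> \<eta> C f j (Suc m) =
     (let A = \<epsilon> \<cdot>\<^sub>m 1\<^sub>m (2 * d) + \<eta> \<cdot>\<^sub>m mat (2 * d) (2 * d) (\<lambda>(a, b). \<Sum>s\<in>{..m}.
                gradient (2 * d) (lifted_loss d f j (j + s)) (sions_iterate d \<epsilon> \<eta> C f j s) $ a *
                gradient (2 * d) (lifted_loss d f j (j + s)) (sions_iterate d \<epsilon> \<eta> C f j s) $ b);
          v = sions_iterate d \<epsilon> \<eta> C f j m;
          u = v - the (mat_inverse A) *\<^sub>v gradient (2 * d) (lifted_loss d f j (j + m)) v
      in arg_min_on (\<lambda>w. mahalanobis_norm A (w - u)) (sions_domain d C j (j + Suc m)))"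

definition sions_prediction ::
    "nat \<Rightarrow> real \<Rightarrow> real \<Rightarrow> real \<Rightarrow> (nat \<Rightarrow> real Matrix.vec \<Rightarrow> real) \<Rightarrow> nat \<Rightarrow> nat \<Rightarrow> real Matrix.vec" where
  "sions_prediction d \<epsilon> \<eta> C f j t = readout d j t (sions_iterate d \<epsilon> \<eta> C f j (t - j))"

subsection \<open>FLH-SIONS\<close>

text \<open>
  \<open>flh_weight \<sigma> L t i\<close> is \<open>v\<^sub>t\<^sup>i\<close> when \<open>L t i\<close> is the loss of expert \<open>i\<close> at round \<open>t\<close>.
  Index \<open>t = 0\<close> is a dummy; the second equation then yields weight 1 for expert 1 at round 1.
\<close>

primrec flh_weight :: "real \<Rightarrow> (nat \<Rightarrow> nat \<Rightarrow> real) \<Rightarrow> nat \<Rightarrow> nat \<Rightarrow> real" where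
  "flh_weight \<sigma> L 0 = (\<lambda>i. 0)"
| "flh_weight \<sigma> L (Suc t) = (\<lambda>i.
     if i = Suc t then 1 / real (Suc t)
     else (1 - 1 / real (Suc t)) *
       (flh_weight \<sigma> L t i * exp (- \<sigma> * L t i) /
        (\<Sum>j=1..t. flh_weight \<sigma> L t j * exp (- \<sigma> * L t j))))"

definition flh_sions ::
    "nat \<Rightarrow> real \<Rightarrow> real \<Rightarrow> real \<Rightarrow> (nat \<Rightarrow> real Matrix.vec \<Rightarrow> real) \<Rightarrow> nat \<Rightarrow> real Matrix.vec" where
  "flh_sions d \<sigma> \<epsilon> C f t =
     (let E = sions_prediction d \<epsilon> \<sigma> C f
      in Matrix.vec d (\<lambda>k. \<Sum>j=1..t. flh_weight \<sigma> (\<lambda>s i. f s (E i s)) t j * E j t $ k))"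

end

theory Submission
  imports Defs "Jordan_Normal_Form.Determinant"
begin

text \<open>
  The expert started at \<open>j\<close> is an online Newton step in \<open>2 d\<close> dimensions, and the aggregation loses
  only a logarithm against it, so on every interval the regret against an affine sequence is at most
  \<open>R = O(d log n)\<close>.  It remains to replace an arbitrary comparator by a sequence with few affine pieces.

  Subtract from the comparator its end-to-end chord and minimise \<open>\<Sum> f\<^sub>t + \<mu> \<parallel>D\<^sup>2\<parallel>\<^sub>1\<close> over deviations extended
  by zero.  A squared distance to \<open>[-2, 2]\<close> is added to the losses; clipping increases neither it nor
  the variation, so a minimiser lies in the interior and is stationary.  Cut each coordinate of a
  minimiser into bins of width at most \<open>\<beta>\<close> and variation \<open>c\<close> at most \<open>\<beta> powr (-3/2) / 3\<close>.  In a bin whose kinks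
  all have the same sign, the chord between the first and the last kink has nonpositive first order
  cost by stationarity.  In any other bin two consecutive kinks have opposite signs.  Tilting the
  affine stretch of length \<open>L\<close> between them gains of order \<open>\<mu>\<^sup>2 / L\<^sup>3\<close>, which pays for the cost \<open>3 \<mu> c\<close> of using
  chords elsewhere.  Either way a bin costs \<open>O(1)\<close> and at most five pieces.  The bins exceeding
  \<open>1 + n / \<beta>\<close> are charged to the variation, which \<open>\<mu> \<sim> R \<beta> powr (3/2)\<close> absorbs, and \<open>\<beta>\<close> is then optimised.
\<close>

subsection \<open>Second differences of scalar sequences\<close>

text \<open>The gradients of the losses at a given comparator need not be small, so replacing it by
  chords has a first order cost that nothing controls. At a minimiser of the penalised problem this
  cost is at most \<open>\<mu>\<close> times a change of variation, which is why an offline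
  minimiser is put in between. A penalty rather than a constraint leaves \<open>\<mu>\<close> free:
  the number of bins depends on the variation of the minimiser, and the penalty pays for it before
  the objective is compared with that of the given comparator. The zero extension makes every
  supported sequence an admissible direction; without subtracting the chord it would create kinks of
  its own at both ends. Bins obey \<open>\<beta> ^ 3 * \<delta>\<^sup>2 \<le> 1/9\<close> because a
  chord misses the sequence by at most \<open>\<beta> * \<delta>\<close> at each of
  \<open>\<beta>\<close> times, so that the squared errors sum to O(1). Balancing
  \<open>d * n / \<beta>\<close> against \<open>\<beta> powr (3/2) * V\<close>, with
  \<open>V\<close> the unnormalised variation, produces the exponents 1/5 and 2/5. One factor
  \<open>d\<close> of the rate is the regret per piece, the other arises because every coordinate is
  cut separately.\<close>

text \<open>Truncated subtraction makes \<open>second_diff x 0 = x 1\<close> when \<open>x 0 = 0\<close>, so sequences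
  supported in \<open>{1..n}\<close> behave as if extended by zero to both sides.\<close>

definition second_diff :: "(nat \<Rightarrow> real) \<Rightarrow> nat \<Rightarrow> real" where
  "second_diff x t = x (Suc t) - 2 * x t + x (t - 1)"

definition supported :: "nat \<Rightarrow> (nat \<Rightarrow> real) \<Rightarrow> bool" where
  "supported n x \<longleftrightarrow> (\<forall>t. t = 0 \<or> n < t \<longrightarrow> x t = 0)"

definition second_var :: "nat \<Rightarrow> (nat \<Rightarrow> real) \<Rightarrow> real" where
  "second_var n x = (\<Sum>t\<le>Suc n. \<bar>second_diff x t\<bar>)"

text \<open>One-sided directional derivative of the absolute value at \<open>y\<close> in direction \<open>e\<close>.\<close>

definition abs_dir :: "real \<Rightarrow> real \<Rightarrow> real" where
  "abs_dir y e = (if y = 0 then \<bar>e\<bar> else sgn y * e)"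

lemma abs_dir_le_abs: "abs_dir y e \<le> \<bar>e\<bar>"
  by (auto simp: abs_dir_def sgn_if)

lemma abs_dir_0 [simp]: "abs_dir y 0 = 0"
  by (auto simp: abs_dir_def)

lemma abs_dir_self [simp]: "abs_dir y y = \<bar>y\<bar>"
  by (auto simp: abs_dir_def sgn_if)

lemma abs_dir_sgn: "\<sigma> = 1 \<or> \<sigma> = -1 \<Longrightarrow> \<sigma> * y > 0 \<Longrightarrow> abs_dir y e = \<sigma> * e"
  by (auto simp: abs_dir_def sgn_if)

lemma sum_second_diff:
  assumes "a < b"
  shows "(\<Sum>t\<in>{a<..<b}. second_diff x t) = (x b - x (b - 1)) - (x (Suc a) - x a)"
  using assms
proof (induction b)
  case (Suc b)
  show ?case
  proof (cases "a = b")
    case True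
    have "{a<..<Suc a} = {}" by auto
    then show ?thesis using True by simp
  next
    case False
    then have "a < b" using Suc by simp
    then have "{a<..<Suc b} = insert b {a<..<b}" by auto
    with Suc.IH[OF \<open>a < b\<close>] show ?thesis by (simp add: second_diff_def)
  qed
qed simp

text \<open>The slopes are 0 beyond both ends, so the kinks cancel; this cancellation is what makes
  clipping harmless to the variation.\<close>

lemma sum_second_diff_supported:
  assumes "supported n x"
  shows "(\<Sum>t\<le>Suc n. second_diff x t) = 0"
proof -
  have *: "(\<Sum>t\<le>m. second_diff x t) = x (Suc m) - x m" for m
    using assms by (induction m) (auto simp: second_diff_def supported_def)
  show ?thesis unfolding * using assms by (simp add: supported_def)
qed

lemma sum_ends:
  fixes z :: "nat \<Rightarrow> 'b::comm_monoid_add"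
  assumes "a < b" "b \<le> n" "\<And>t. t < a \<or> b < t \<Longrightarrow> z t = 0"
  shows "(\<Sum>t\<le>n. z t) = z a + (\<Sum>t\<in>{a<..<b}. z t) + z b"
proof -
  have "(\<Sum>t\<le>n. z t) = (\<Sum>t\<in>{a..b}. z t)"
    using assms by (intro sum.mono_neutral_right) (auto simp: not_le)
  also have "{a..b} = insert a (insert b {a<..<b})" using assms(1) by auto
  also have "sum z \<dots> = z a + (\<Sum>t\<in>{a<..<b}. z t) + z b"
    using assms(1) by (simp add: ac_simps)
  finally show ?thesis .
qed

text \<open>A slope exceeding the total variation of the slopes would force all slopes to have the
  same sign, contradicting equal end values.\<close>

lemma slope_le_variation:
  assumes h: "h a = 0" "h b = 0" and s: "a \<le> s" "s < b"
  shows "\<bar>h (Suc s) - h s\<bar> \<le> (\<Sum>t\<in>{a<..<b}. \<bar>second_diff h t\<bar>)"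
proof (rule ccontr)
  define c where "c = (\<Sum>t\<in>{a<..<b}. \<bar>second_diff h t\<bar>)"
  assume "\<not> ?thesis"
  then have neg: "c < \<bar>h (Suc s) - h s\<bar>" by (simp add: c_def)
  have diff: "\<bar>(h (Suc r) - h r) - (h (Suc q) - h q)\<bar> \<le> c" if "a \<le> q" "q \<le> r" "r < b" for q r
  proof -
    have "(h (Suc r) - h r) - (h (Suc q) - h q) = (\<Sum>t\<in>{q<..<Suc r}. second_diff h t)"
      using sum_second_diff[of q "Suc r" h] that by simp
    also have "\<bar>\<dots>\<bar> \<le> (\<Sum>t\<in>{q<..<Suc r}. \<bar>second_diff h t\<bar>)" by (rule sum_abs)
    also have "\<dots> \<le> c" unfolding c_def by (rule sum_mono2) (use that in auto)
    finally show ?thesis .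
  qed
  have close: "\<bar>(h (Suc r) - h r) - (h (Suc s) - h s)\<bar> \<le> c" if "r \<in> {a..<b}" for r
    using diff[of r s] diff[of s r] that s by (cases "r \<le> s") (auto simp: abs_minus_commute)
  have tel: "(\<Sum>r=a..<b. h (Suc r) - h r) = 0"
    using sum_Suc_diff'[of a b h] h s by simp
  have ne: "{a..<b} \<noteq> {}" using s by auto
  show False
  proof (cases "h (Suc s) - h s > 0")
    case True
    have "(\<Sum>r=a..<b. h (Suc r) - h r) > 0"
      by (rule sum_pos) (use ne close neg True in \<open>fastforce+\<close>)
    with tel show False by simp
  next
    case False
    have "(\<Sum>r=a..<b. - (h (Suc r) - h r)) > 0"
      by (rule sum_pos) (use ne close neg False in \<open>fastforce+\<close>)
    then have "- (\<Sum>r=a..<b. h (Suc r) - h r) > 0" by (simp only: sum_negf)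
    with tel show False by simp
  qed
qed

lemma dist_le_variation:
  assumes h: "h a = 0" "h b = 0" and s: "a \<le> s" "s \<le> b"
  shows "\<bar>h s\<bar> \<le> real (s - a) * (\<Sum>t\<in>{a<..<b}. \<bar>second_diff h t\<bar>)"
  using s
proof (induction s)
  case 0
  then show ?case using h by simp
next
  case (Suc s)
  show ?case
  proof (cases "Suc s = a")
    case False
    then have "a \<le> s" "s < b" using Suc by auto
    from slope_le_variation[OF h this] Suc.IH[OF this(1)] this
    show ?thesis by (simp add: Suc_diff_le algebra_simps)
  qed (use h in simp)
qed

section \<open>Chords and their gap to the sequence\<close>

definition chord :: "(nat \<Rightarrow> real) \<Rightarrow> nat \<Rightarrow> nat \<Rightarrow> nat \<Rightarrow> real" where
  "chord x a b t = x a + (x b - x a) / (real b - real a) * (real t - real a)"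

text \<open>The sign makes \<open>x\<close> plus the gap equal to the chord on \<open>{a..b}\<close>
  and to \<open>x\<close> elsewhere. For \<open>a = b\<close> division by zero yields a constant
  chord, so the gap vanishes.\<close>

definition chord_gap :: "(nat \<Rightarrow> real) \<Rightarrow> nat \<Rightarrow> nat \<Rightarrow> nat \<Rightarrow> real" where
  "chord_gap x a b t = (if a \<le> t \<and> t \<le> b then chord x a b t - x t else 0)"

lemma second_diff_affine:
  assumes "t \<ge> 1" "v (Suc t) = p + q * (real (Suc t) - c)" "v t = p + q * (real t - c)"
    "v (t - 1) = p + q * (real (t - 1) - c)"
  shows "second_diff v t = 0"
  using assms by (simp add: second_diff_def of_nat_diff algebra_simps)

lemma second_diff_chord: "t \<ge> 1 \<Longrightarrow> second_diff (chord x a b) t = 0"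
  by (rule second_diff_affine[where p = "x a" and q = "(x b - x a) / (real b - real a)" and c = "real a"])
    (auto simp: chord_def)

lemma chord_gap_ends [simp]: "chord_gap x a b a = 0" "chord_gap x a b b = 0"
  by (auto simp: chord_gap_def chord_def)

text \<open>Adding the gap to \<open>x\<close> erases the kinks strictly between \<open>a\<close>
  and \<open>b\<close>; in exchange new kinks arise at \<open>a\<close> and \<open>b\<close> only,
  each an end slope of the gap up to sign.\<close>

lemma second_diff_chord_gap:
  assumes "1 \<le> a" "a \<le> b"
  shows "a < t \<Longrightarrow> t < b \<Longrightarrow> second_diff (chord_gap x a b) t = - second_diff x t"
    and "t < a \<or> b < t \<Longrightarrow> second_diff (chord_gap x a b) t = 0"
    and "a < b \<Longrightarrow> second_diff (chord_gap x a b) a = chord_gap x a b (Suc a)"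
    and "a < b \<Longrightarrow> second_diff (chord_gap x a b) b = chord_gap x a b (b - 1)"
proof -
  show "second_diff (chord_gap x a b) t = - second_diff x t" if "a < t" "t < b"
    using second_diff_chord[of t x a b] that by (auto simp: second_diff_def chord_gap_def)
  have out: "chord_gap x a b s = 0" if "s \<le> a \<or> b \<le> s" for s
    by (cases "s = a \<or> s = b") (use that in \<open>auto simp: chord_gap_def chord_def\<close>)
  show "second_diff (chord_gap x a b) t = 0" if "t < a \<or> b < t"
    unfolding second_diff_def using that by (subst (1 2 3) out) auto
  show "second_diff (chord_gap x a b) a = chord_gap x a b (Suc a)"
    using out[of a] out[of "a - 1"] assms by (simp add: second_diff_def)
  show "second_diff (chord_gap x a b) b = chord_gap x a b (b - 1)"
    using out[of b] out[of "Suc b"] assms by (simp add: second_diff_def)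
qed

lemma supported_chord_gap: "1 \<le> a \<Longrightarrow> b \<le> n \<Longrightarrow> supported n (chord_gap x a b)"
  by (auto simp: supported_def chord_gap_def)

lemma sum_abs_second_diff_chord_gap:
  assumes "1 \<le> a" "a \<le> b"
  shows "(\<Sum>t\<in>{a<..<b}. \<bar>second_diff (chord_gap x a b) t\<bar>) = (\<Sum>t\<in>{a<..<b}. \<bar>second_diff x t\<bar>)"
  by (rule sum.cong) (auto simp: second_diff_chord_gap(1)[OF assms])

lemma chord_gap_le:
  assumes "1 \<le> a" "a \<le> b"
  shows "\<bar>chord_gap x a b t\<bar> \<le> real (b - a) * (\<Sum>t\<in>{a<..<b}. \<bar>second_diff x t\<bar>)"
proof (cases "a \<le> t \<and> t \<le> b")
  case True
  then have "\<bar>chord_gap x a b t\<bar> \<le> real (t - a) * (\<Sum>t\<in>{a<..<b}. \<bar>second_diff x t\<bar>)"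
    using dist_le_variation[of "chord_gap x a b" a b t] sum_abs_second_diff_chord_gap[OF assms]
    by simp
  also have "\<dots> \<le> real (b - a) * (\<Sum>t\<in>{a<..<b}. \<bar>second_diff x t\<bar>)"
    using True by (intro mult_right_mono sum_nonneg) auto
  finally show ?thesis .
qed (auto simp: chord_gap_def intro!: mult_nonneg_nonneg sum_nonneg)

text \<open>The 3 counts the interior kinks once and the two end kinks, each being an end slope of
  the gap and so at most the interior variation by \<open>slope_le_variation\<close>.\<close>

lemma second_var_chord_gap:
  assumes "1 \<le> a" "a \<le> b" "b \<le> n"
  shows "second_var n (chord_gap x a b) \<le> 3 * (\<Sum>t\<in>{a<..<b}. \<bar>second_diff x t\<bar>)"
proof (cases "a = b")
  case True
  then have "chord_gap x a b t = 0" for t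
    by (cases "t = a") (auto simp: chord_gap_def chord_def)
  then show ?thesis by (simp add: second_var_def second_diff_def True)
next
  case False
  with assms have "a < b" by simp
  define h where "h = chord_gap x a b"
  have h0: "h a = 0" "h b = 0" by (auto simp: h_def)
  note c = sum_abs_second_diff_chord_gap[OF assms(1,2), of x, folded h_def]
  have "second_var n h = \<bar>second_diff h a\<bar> + (\<Sum>t\<in>{a<..<b}. \<bar>second_diff h t\<bar>) + \<bar>second_diff h b\<bar>"
    unfolding second_var_def
    by (rule sum_ends) (use \<open>a < b\<close> assms in \<open>auto simp: h_def second_diff_chord_gap(2)\<close>)
  moreover have "\<bar>second_diff h a\<bar> \<le> (\<Sum>t\<in>{a<..<b}. \<bar>second_diff x t\<bar>)"
    using slope_le_variation[OF h0, of a] \<open>a < b\<close> c second_diff_chord_gap(3)[OF assms(1,2) \<open>a < b\<close>, of x] h0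
    by (simp add: h_def)
  moreover have "\<bar>second_diff h b\<bar> \<le> (\<Sum>t\<in>{a<..<b}. \<bar>second_diff x t\<bar>)"
    using slope_le_variation[OF h0, of "b - 1"] \<open>a < b\<close> c second_diff_chord_gap(4)[OF assms(1,2) \<open>a < b\<close>, of x] h0
    by (simp add: h_def)
  ultimately show ?thesis using c by (simp add: h_def)
qed

section \<open>Clipping and the second variation\<close>

lemma second_var_clip_above:
  assumes x: "supported n x" and "\<theta> > 0"
  shows "second_var n (\<lambda>t. min (x t) \<theta>) \<le> second_var n x"
proof -
  define q where "q t = x t - min (x t) \<theta>" for t
  have q: "supported n q" using assms by (auto simp: supported_def q_def)
  \<comment> \<open>Where \<open>x t > \<theta>\<close> the clipped sequence is at its maximum and
    has nonpositive second difference; elsewhere \<open>q t = 0\<close> and \<open>q\<close> has a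
    nonnegative one. Both cases give the bound, and the added terms sum to 0.\<close>
  have "\<bar>second_diff (\<lambda>t. min (x t) \<theta>) t\<bar> \<le> \<bar>second_diff x t\<bar> + second_diff q t" for t
    unfolding second_diff_def q_def by (auto simp: min_def)
  then have "second_var n (\<lambda>t. min (x t) \<theta>) \<le> (\<Sum>t\<le>Suc n. \<bar>second_diff x t\<bar> + second_diff q t)"
    unfolding second_var_def by (rule sum_mono)
  also have "\<dots> = second_var n x"
    using sum_second_diff_supported[OF q] by (simp add: sum.distrib second_var_def del: sum.atMost_Suc)
  finally show ?thesis .
qed

lemma second_var_uminus: "second_var n (\<lambda>t. - x t) = second_var n x"
  unfolding second_var_def
  by (rule sum.cong) (auto simp: second_diff_def)

lemma second_var_clip:
  assumes x: "supported n x" and "\<theta> > 0"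
  shows "second_var n (\<lambda>t. max (- \<theta>) (min (x t) \<theta>)) \<le> second_var n x"
proof -
  have "second_var n (\<lambda>t. max (- \<theta>) (min (x t) \<theta>)) = second_var n (\<lambda>t. - min (- min (x t) \<theta>) \<theta>)"
    by (rule arg_cong[of _ _ "second_var n"]) (auto simp: fun_eq_iff max_def min_def)
  also have "\<dots> = second_var n (\<lambda>t. min (- min (x t) \<theta>) \<theta>)" by (rule second_var_uminus)
  also have "\<dots> \<le> second_var n (\<lambda>t. - min (x t) \<theta>)"
    by (rule second_var_clip_above) (use assms in \<open>auto simp: supported_def\<close>)
  also have "\<dots> \<le> second_var n x"
    unfolding second_var_uminus using assms by (rule second_var_clip_above)
  finally show ?thesis .
qed

subsection \<open>Replacing a stationary sequence by a piecewise affine one\<close>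

text \<open>First order optimality of \<open>x\<close> for a loss with gradient \<open>g\<close> plus \<open>\<mu>\<close> times \<open>second_var\<close>;
  directions are written \<open>- h\<close> so that \<open>x + h\<close> is the sequence \<open>x\<close> is compared with.\<close>

definition stationary :: "nat \<Rightarrow> real \<Rightarrow> (nat \<Rightarrow> real) \<Rightarrow> (nat \<Rightarrow> real) \<Rightarrow> bool" where
  "stationary n \<mu> g x \<longleftrightarrow> (\<forall>h. supported n h \<longrightarrow>
     (\<Sum>t=1..n. g t * h t) \<le> \<mu> * (\<Sum>t\<le>Suc n. abs_dir (second_diff x t) (- second_diff h t)))"

lemma stationary_chord_gap:
  assumes "stationary n \<mu> g x" "\<mu> \<ge> 0" "1 \<le> a" "a \<le> b" "b \<le> n"
  shows "(\<Sum>t=1..n. g t * chord_gap x a b t) \<le> 3 * \<mu> * (\<Sum>t\<in>{a<..<b}. \<bar>second_diff x t\<bar>)"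
proof -
  have "(\<Sum>t=1..n. g t * chord_gap x a b t)
      \<le> \<mu> * (\<Sum>t\<le>Suc n. abs_dir (second_diff x t) (- second_diff (chord_gap x a b) t))"
    using assms(1) supported_chord_gap[OF assms(3,5)] unfolding stationary_def by blast
  also have "\<dots> \<le> \<mu> * second_var n (chord_gap x a b)"
    unfolding second_var_def
    by (intro mult_left_mono sum_mono \<open>\<mu> \<ge> 0\<close>) (metis abs_dir_le_abs abs_minus_cancel)
  also have "\<dots> \<le> \<mu> * (3 * (\<Sum>t\<in>{a<..<b}. \<bar>second_diff x t\<bar>))"
    by (intro mult_left_mono second_var_chord_gap assms)
  finally show ?thesis by simp
qed

text \<open>Here the decrease of the variation inside the interval exactly pays for the new kinks at its
  end points.\<close>

lemma stationary_chord_gap_same_sign: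
  assumes "stationary n \<mu> g x" "1 \<le> a" "a \<le> b" "b \<le> n" and \<sigma>: "\<sigma> = 1 \<or> \<sigma> = -1"
    and a: "\<sigma> * second_diff x a > 0" and b: "\<sigma> * second_diff x b > 0"
    and mid: "\<And>t. a < t \<Longrightarrow> t < b \<Longrightarrow> \<sigma> * second_diff x t \<ge> 0"
  shows "(\<Sum>t=1..n. g t * chord_gap x a b t) \<le> 0"
proof (cases "a = b")
  case True
  then have "chord_gap x a b t = 0" for t
    by (cases "t = a") (auto simp: chord_gap_def chord_def)
  then show ?thesis by simp
next
  case False
  with assms have "a < b" by simp
  define h where "h = chord_gap x a b"
  define y where "y = second_diff x"
  have [simp]: "h a = 0" "h b = 0" by (auto simp: h_def)
  note h = second_diff_chord_gap[OF assms(2,3), where x = x, folded h_def y_def]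
  have "(\<Sum>t\<in>{a<..<b}. second_diff h t) = - h (b - 1) - h (Suc a)"
    using sum_second_diff[OF \<open>a < b\<close>, of h] by simp
  moreover have "(\<Sum>t\<in>{a<..<b}. second_diff h t) = - (\<Sum>t\<in>{a<..<b}. y t)"
    unfolding sum_negf[symmetric] by (rule sum.cong) (auto simp: h)
  ultimately have tot: "h (b - 1) + h (Suc a) = (\<Sum>t\<in>{a<..<b}. y t)" by simp
  have "(\<Sum>t\<le>Suc n. abs_dir (y t) (- second_diff h t)) =
    abs_dir (y a) (- second_diff h a) + (\<Sum>t\<in>{a<..<b}. abs_dir (y t) (- second_diff h t))
     + abs_dir (y b) (- second_diff h b)"
    by (rule sum_ends) (use \<open>a < b\<close> assms in \<open>auto simp: h\<close>)
  also have "(\<Sum>t\<in>{a<..<b}. abs_dir (y t) (- second_diff h t)) = (\<Sum>t\<in>{a<..<b}. \<sigma> * y t)"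
  proof (rule sum.cong)
    fix t assume "t \<in> {a<..<b}"
    with mid[of t] \<sigma> show "abs_dir (y t) (- second_diff h t) = \<sigma> * y t"
      by (auto simp: h y_def)
  qed simp
  also have "\<dots> = \<sigma> * (\<Sum>t\<in>{a<..<b}. y t)" by (simp add: sum_distrib_left)
  also have "abs_dir (y a) (- second_diff h a) = - \<sigma> * h (Suc a)"
    using abs_dir_sgn[OF \<sigma> a] h(3)[OF \<open>a < b\<close>] by (simp add: y_def)
  also have "abs_dir (y b) (- second_diff h b) = - \<sigma> * h (b - 1)"
    using abs_dir_sgn[OF \<sigma> b] h(4)[OF \<open>a < b\<close>] by (simp add: y_def)
  finally have "(\<Sum>t\<le>Suc n. abs_dir (y t) (- second_diff h t)) = 0"
    using tot[symmetric] by (simp add: algebra_simps)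
  then show ?thesis
    using assms(1) supported_chord_gap[OF assms(2,4), of x]
    unfolding stationary_def h_def y_def by fastforce
qed

text \<open>After reaching its full height at \<open>b\<close> it returns to 0 in one step. The jump
  confines the direction to the stretch, at the price of kinks at both \<open>b\<close> and
  \<open>Suc b\<close>.\<close>

definition ramp :: "real \<Rightarrow> nat \<Rightarrow> nat \<Rightarrow> nat \<Rightarrow> real" where
  "ramp \<sigma> a b t = (if a \<le> t \<and> t \<le> b then \<sigma> * real (t - a) else 0)"

text \<open>Tilting an affine stretch between two kinks of opposite sign flattens both kinks.\<close>

lemma stationary_ramp:
  assumes "stationary n \<mu> g x" "\<mu> \<ge> 0" "1 \<le> a" "a < b" "b \<le> n" and \<sigma>: "\<sigma> = 1 \<or> \<sigma> = -1"
    and a: "\<sigma> * second_diff x a > 0" and b: "\<sigma> * second_diff x b < 0"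
  shows "(\<Sum>t=1..n. g t * ramp \<sigma> a b t) \<le> - 2 * \<mu>"
proof -
  define h where "h = ramp \<sigma> a b"
  have dd: "second_diff h t = (if t = a then \<sigma> else if t = b then - \<sigma> * (real (b - a) + 1)
      else if t = Suc b then \<sigma> * real (b - a) else 0)" for t
  proof -
    consider "t < a" | "t = a" | "a < t" "t < b" | "t = b" | "t = Suc b" | "t > Suc b"
      using \<open>a < b\<close> by linarith
    then show ?thesis
    proof cases
      case 3
      then show ?thesis using \<open>1 \<le> a\<close>
        by (auto simp: second_diff_def h_def ramp_def of_nat_diff algebra_simps)
    qed (use \<open>1 \<le> a\<close> \<open>a < b\<close> in \<open>auto simp: second_diff_def h_def ramp_def of_nat_diff algebra_simps\<close>)
  qed
  have s: "supported n h" using assms by (auto simp: supported_def h_def ramp_def)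
  have "(\<Sum>t\<le>Suc n. abs_dir (second_diff x t) (- second_diff h t)) =
     (\<Sum>t\<in>{a, b, Suc b}. abs_dir (second_diff x t) (- second_diff h t))"
    by (rule sum.mono_neutral_right) (use assms in \<open>auto simp: dd\<close>)
  also have "\<dots> = abs_dir (second_diff x a) (- \<sigma>) + abs_dir (second_diff x b) (\<sigma> * (real (b - a) + 1))
      + abs_dir (second_diff x (Suc b)) (- \<sigma> * real (b - a))"
    using \<open>a < b\<close> by (simp add: dd)
  also have "abs_dir (second_diff x a) (- \<sigma>) = - 1"
    using abs_dir_sgn[OF \<sigma> a, of "- \<sigma>"] \<sigma> by auto
  also have "abs_dir (second_diff x b) (\<sigma> * (real (b - a) + 1)) = - (real (b - a) + 1)"
    using abs_dir_sgn[of "- \<sigma>" "second_diff x b" "\<sigma> * (real (b - a) + 1)"] \<sigma> b by auto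
  \<comment> \<open>The sign of the kink of \<open>x\<close> at \<open>Suc b\<close> is unknown,
    which may cost \<open>b - a\<close>; the gain \<open>b - a + 1\<close> at \<open>b\<close>
    exceeds this by 1, and the gain 1 at \<open>a\<close> brings the total to -2.\<close>
  also have "abs_dir (second_diff x (Suc b)) (- \<sigma> * real (b - a)) \<le> real (b - a)"
    using abs_dir_le_abs[of "second_diff x (Suc b)" "- \<sigma> * real (b - a)"] \<sigma> by auto
  finally have "(\<Sum>t\<le>Suc n. abs_dir (second_diff x t) (- second_diff h t)) \<le> - 2" by simp
  then have "\<mu> * (\<Sum>t\<le>Suc n. abs_dir (second_diff x t) (- second_diff h t)) \<le> \<mu> * - 2"
    by (rule mult_left_mono) fact
  with assms(1) s show ?thesis unfolding stationary_def h_def by fastforce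
qed

lemma sum_ramp_sq_le:
  assumes "a < b" "\<sigma> = 1 \<or> \<sigma> = -1"
  shows "(\<Sum>t=1..n. (ramp \<sigma> a b t)\<^sup>2) \<le> real (b - a) ^ 3"
proof -
  have "(\<Sum>t=1..n. (ramp \<sigma> a b t)\<^sup>2) \<le> (\<Sum>t\<in>{a<..b}. (ramp \<sigma> a b t)\<^sup>2)"
  proof -
    have "(\<Sum>t=1..n. (ramp \<sigma> a b t)\<^sup>2) = (\<Sum>t\<in>{1..n} \<inter> {a<..b}. (ramp \<sigma> a b t)\<^sup>2)"
      by (rule sum.mono_neutral_right) (auto simp: ramp_def)
    also have "\<dots> \<le> (\<Sum>t\<in>{a<..b}. (ramp \<sigma> a b t)\<^sup>2)" by (rule sum_mono2) auto
    finally show ?thesis .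
  qed
  also have "\<dots> \<le> (\<Sum>t\<in>{a<..b}. (real (b - a))\<^sup>2)"
    by (rule sum_mono) (use assms in \<open>auto simp: ramp_def power_mult_distrib intro!: power_mono\<close>)
  also have "\<dots> = real (b - a) ^ 3" by (simp add: power3_eq_cube power2_eq_square del: of_nat_diff)
  finally show ?thesis .
qed

text \<open>The optimal tilt of size at most \<open>1/L\<close>; the bound on \<open>c\<close> makes its gain pay for \<open>3 \<mu> c\<close>.\<close>

lemma tilt_tradeoff:
  fixes \<mu> L M c :: real
  assumes "\<mu> > 0" "1 \<le> L" "L \<le> M" "0 \<le> c" "M ^ 3 * c\<^sup>2 \<le> 1/9"
  shows "\<exists>\<kappa>\<ge>0. \<kappa> * L \<le> 1 \<and> 3 * \<mu> * c - 2 * \<mu> * \<kappa> + 2 * \<kappa>\<^sup>2 * L ^ 3 \<le> 1/2"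
proof -
  have "L ^ 3 \<le> M ^ 3" using assms by (intro power_mono) auto
  then have "L ^ 3 * c\<^sup>2 \<le> M ^ 3 * c\<^sup>2" by (rule mult_right_mono) simp
  with assms have Lc: "L ^ 3 * c\<^sup>2 \<le> 1/9" by simp
  have L0: "L > 0" using assms by simp
  show ?thesis
  proof (cases "\<mu> \<le> 2 * L\<^sup>2")
    case True
    \<comment> \<open>The unconstrained minimiser of
      \<open>- 2 * \<mu> * \<kappa> + 2 * \<kappa>\<^sup>2 * L ^ 3\<close>; it satisfies
      \<open>\<kappa> * L \<le> 1\<close> exactly when
      \<open>\<mu> \<le> 2 * L\<^sup>2\<close>.\<close>
    define \<kappa> where "\<kappa> = \<mu> / (2 * L ^ 3)"
    have *: "\<mu> = 2 * L ^ 3 * \<kappa>" using L0 by (simp add: \<kappa>_def)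
    have "\<kappa> * L = \<mu> / (2 * L\<^sup>2)" using L0 by (simp add: \<kappa>_def power3_eq_cube power2_eq_square)
    also have "\<dots> \<le> 1" using True L0 by (simp add: divide_le_eq)
    finally have "\<kappa> * L \<le> 1" .
    moreover have "3 * \<mu> * c - 2 * \<mu> * \<kappa> + 2 * \<kappa>\<^sup>2 * L ^ 3 = L ^ 3 * (6 * \<kappa> * c - 2 * \<kappa>\<^sup>2)"
      unfolding * by (simp add: power2_eq_square algebra_simps)
    moreover have "6 * \<kappa> * c - 2 * \<kappa>\<^sup>2 \<le> (9/2) * c\<^sup>2"
      using zero_le_power2[of "2 * \<kappa> - 3 * c"] by (simp add: power2_eq_square algebra_simps)
    then have "L ^ 3 * (6 * \<kappa> * c - 2 * \<kappa>\<^sup>2) \<le> L ^ 3 * ((9/2) * c\<^sup>2)"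
      using L0 by (intro mult_left_mono) auto
    ultimately have "3 * \<mu> * c - 2 * \<mu> * \<kappa> + 2 * \<kappa>\<^sup>2 * L ^ 3 \<le> 1/2" using Lc by linarith
    with \<open>\<kappa> * L \<le> 1\<close> show ?thesis using assms by (intro exI[of _ \<kappa>]) (auto simp: \<kappa>_def)
  next
    case False
    \<comment> \<open>Now the largest admissible tilt \<open>1/L\<close> is used: its gain
      \<open>2 * \<mu> / L\<close> covers \<open>3 * \<mu> * c\<close> and the quadratic term, each
      at most \<open>\<mu> / L\<close>.\<close>
    have "(L * c)\<^sup>2 \<le> L ^ 3 * c\<^sup>2"
      using assms by (simp add: power_mult_distrib power_increasing mult_right_mono)
    also have "\<dots> \<le> (1/3)\<^sup>2" using Lc by (simp add: power2_eq_square)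
    finally have "L * c \<le> 1/3" by (rule power2_le_imp_le) simp
    then have "\<mu> * (3 * (L * c)) \<le> \<mu> * 1" using assms by (intro mult_left_mono) auto
    then have "L * (3 * \<mu> * c) \<le> \<mu>" by (simp add: algebra_simps)
    then have 1: "3 * \<mu> * c \<le> \<mu> / L" using L0 by (simp add: pos_le_divide_eq algebra_simps)
    have "2 * (1/L)\<^sup>2 * L ^ 3 = 2 * L" using L0 by (simp add: power2_eq_square power3_eq_cube)
    also have "\<dots> \<le> \<mu> / L" using False L0 by (simp add: pos_le_divide_eq power2_eq_square)
    finally have 2: "2 * (1/L)\<^sup>2 * L ^ 3 \<le> \<mu> / L" .
    have "3 * \<mu> * c - 2 * \<mu> * (1/L) + 2 * (1/L)\<^sup>2 * L ^ 3 \<le> 1/2"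
      using 1 2 by simp
    then show ?thesis using L0 by (intro exI[of _ "1/L"]) auto
  qed
qed

text \<open>\<open>P\<close> marks the first indices of the pieces. Nothing ties
  \<open>p - 1\<close> to \<open>p\<close>, and the second difference at \<open>t\<close> involves
  \<open>t - 1\<close> and \<open>t + 1\<close>, so a break at \<open>p\<close> releases the kinks
  at both \<open>p - 1\<close> and \<open>p\<close>.\<close>

definition affine_off :: "nat set \<Rightarrow> nat \<Rightarrow> nat \<Rightarrow> (nat \<Rightarrow> real) \<Rightarrow> bool" where
  "affine_off P A B v \<longleftrightarrow> (\<forall>t. A < t \<and> t < B \<and> t \<notin> P \<and> Suc t \<notin> P \<longrightarrow> second_diff v t = 0)"

lemma second_diff_local_eq:
  "v (Suc t) = w (Suc t) \<Longrightarrow> v t = w t \<Longrightarrow> v (t - 1) = w (t - 1) \<Longrightarrow> second_diff v t = second_diff w t"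
  by (simp add: second_diff_def)

lemma second_diff_add: "second_diff (\<lambda>t. x t + y t) t = second_diff x t + second_diff y t"
  by (simp add: second_diff_def algebra_simps)

lemma second_diff_cmult: "second_diff (\<lambda>t. c * x t) t = c * second_diff x t"
  by (simp add: second_diff_def algebra_simps)

lemma second_diff_ramp:
  assumes "1 \<le> a" "t \<noteq> a" "t \<noteq> b" "t \<noteq> Suc b"
  shows "second_diff (ramp \<sigma> a b) t = 0"
  using assms by (cases "t < a \<or> t > b") (auto simp: second_diff_def ramp_def of_nat_diff algebra_simps)

text \<open>Gaps are at most length times variation, so \<open>short\<close> bounds their squares in
  total and only the first order terms need care. The coefficient 2 of the squares anticipates the
  smoothness of the penalised losses. Five breaks are the start \<open>A\<close>, the outer kinks
  \<open>a\<close> and \<open>b\<close>, and in the mixed case \<open>a'\<close> and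
  \<open>Suc b'\<close>.\<close>

lemma short_bin_affine:
  assumes st: "stationary n \<mu> g x" and \<mu>: "\<mu> > 0" and AB: "1 \<le> A" "A \<le> B" "B \<le> n"
    and short: "real (B - A) ^ 3 * (\<Sum>t\<in>{A<..<B}. \<bar>second_diff x t\<bar>)\<^sup>2 \<le> 1/9"
  shows "\<exists>v P. P \<subseteq> {A..B} \<and> A \<in> P \<and> card P \<le> 5 \<and> affine_off P A B v \<and>
    (\<forall>t\<in>{A..B}. \<bar>v t - x t\<bar> \<le> 1) \<and> (\<Sum>t=A..B. g t * (v t - x t) + 2 * (v t - x t)\<^sup>2) \<le> 1"
proof -
  define y where "y = second_diff x"
  define c where "c = (\<Sum>t\<in>{A<..<B}. \<bar>y t\<bar>)"
  have c0: "c \<ge> 0" by (auto simp: c_def intro: sum_nonneg)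
  have short': "real (B - A) ^ 3 * c\<^sup>2 \<le> 1/9" using short by (simp add: c_def y_def)
  have Lc: "real (B - A) * (real (B - A) * c)\<^sup>2 \<le> 1/9"
    using short' by (simp add: power2_eq_square power3_eq_cube algebra_simps)
  have Lc1: "real (B - A) * c \<le> 1"
  proof (cases "B = A")
    case False
    then have "1 * (real (B - A) * c)\<^sup>2 \<le> real (B - A) * (real (B - A) * c)\<^sup>2"
      using AB by (intro mult_right_mono) auto
    then have "(real (B - A) * c)\<^sup>2 \<le> 1\<^sup>2" using Lc by simp
    then show ?thesis by (rule power2_le_imp_le) simp
  qed simp
  have sumout: "(\<Sum>t=A..B. z t) = (\<Sum>t=1..n. z t)"
    if "\<And>t. t < A \<or> B < t \<Longrightarrow> z t = 0" for z :: "nat \<Rightarrow> real"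
    by (rule sum.mono_neutral_left) (use AB that in \<open>auto simp: not_le\<close>)
  \<comment> \<open>\<open>e A = 0\<close> leaves \<open>B - A\<close> terms rather than
    \<open>B - A + 1\<close>, which matches the exponent in \<open>short\<close>.\<close>
  have sq: "(\<Sum>t=A..B. (e t)\<^sup>2) \<le> 1/9"
    if "\<And>t. \<bar>e t\<bar> \<le> real (B - A) * c" "e A = 0" for e :: "nat \<Rightarrow> real"
  proof -
    have "(\<Sum>t=A..B. (e t)\<^sup>2) = (\<Sum>t\<in>{A<..B}. (e t)\<^sup>2)"
      by (rule sum.mono_neutral_right) (use AB that in auto)
    also have "\<dots> \<le> (\<Sum>t\<in>{A<..B}. (real (B - A) * c)\<^sup>2)"
      by (rule sum_mono) (use that c0 in \<open>auto simp: abs_le_square_iff[symmetric] abs_mult\<close>)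
    also have "\<dots> \<le> 1/9" using Lc AB by simp
    finally show ?thesis .
  qed
  define S where "S = {t \<in> {A<..<B}. y t \<noteq> 0}"
  have "finite S" by (auto simp: S_def)
  show ?thesis
  proof (cases "S = {}")
    case True
    then have "affine_off {A} A B x" by (auto simp: affine_off_def S_def y_def)
    then show ?thesis using AB by (intro exI[of _ x] exI[of _ "{A}"]) auto
  next
    case False
    define a where "a = Min S"
    define b where "b = Max S"
    have "a \<in> S" "b \<in> S" using False \<open>finite S\<close> by (auto simp: a_def b_def)
    have ab: "A < a" "a \<le> b" "b < B" "1 \<le> a" "b \<le> n"
      using \<open>a \<in> S\<close> \<open>b \<in> S\<close> AB \<open>finite S\<close> by (auto simp: S_def a_def)
    have out: "y t = 0" if "A < t" "t < B" "t < a \<or> b < t" for t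
    proof (rule ccontr)
      assume "y t \<noteq> 0"
      then have "t \<in> S" using that by (auto simp: S_def)
      then have "a \<le> t" "t \<le> b" using \<open>finite S\<close> by (auto simp: a_def b_def)
      with that show False by auto
    qed
    define \<sigma> where "\<sigma> = sgn (y a)"
    have \<sigma>: "\<sigma> = 1 \<or> \<sigma> = -1" and \<sigma>a: "\<sigma> * y a > 0"
      using \<open>a \<in> S\<close> by (auto simp: \<sigma>_def S_def sgn_if)
    have csub: "(\<Sum>t\<in>{p<..<q}. \<bar>y t\<bar>) \<le> c" if "A \<le> p" "q \<le> B" for p q
      unfolding c_def by (rule sum_mono2) (use that in auto)
    have gap: "\<bar>chord_gap x p q t\<bar> \<le> real (B - A) * c" if "A \<le> p" "p \<le> q" "q \<le> B" for p q t
    proof -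
      have "\<bar>chord_gap x p q t\<bar> \<le> real (q - p) * (\<Sum>t\<in>{p<..<q}. \<bar>y t\<bar>)"
        unfolding y_def by (rule chord_gap_le) (use that AB in auto)
      also have "\<dots> \<le> real (B - A) * c"
        by (rule mult_mono) (use that csub[of p q] in \<open>auto intro: sum_nonneg\<close>)
      finally show ?thesis .
    qed
    show ?thesis
    proof (cases "\<forall>t\<in>S. \<sigma> * y t > 0")
      case True
      define h where "h = chord_gap x a b"
      have "affine_off {A, a, b} A B (\<lambda>t. x t + h t)"
        unfolding affine_off_def second_diff_add
      proof (intro allI impI)
        fix t assume t: "A < t \<and> t < B \<and> t \<notin> {A, a, b} \<and> Suc t \<notin> {A, a, b}"
        then consider "t < a \<or> b < t" | "a < t" "t < b" by force
        then show "second_diff x t + second_diff h t = 0"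
        proof cases
          case 1
          then show ?thesis
            using out[of t] t second_diff_chord_gap(2)[OF \<open>1 \<le> a\<close> \<open>a \<le> b\<close>, of t x]
            by (auto simp: h_def y_def)
        qed (use second_diff_chord_gap(1)[OF \<open>1 \<le> a\<close> \<open>a \<le> b\<close>] in \<open>simp add: h_def\<close>)
      qed
      moreover have "(\<Sum>t=A..B. g t * h t) \<le> 0"
      proof -
        have "(\<Sum>t=A..B. g t * h t) = (\<Sum>t=1..n. g t * h t)"
          by (rule sumout) (use ab in \<open>auto simp: h_def chord_gap_def\<close>)
        also have "\<dots> \<le> 0" unfolding h_def
        proof (rule stationary_chord_gap_same_sign[OF st \<open>1 \<le> a\<close> \<open>a \<le> b\<close> \<open>b \<le> n\<close> \<sigma>])
          show "0 \<le> \<sigma> * second_diff x t" if "a < t" "t < b" for t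
            using True that ab by (cases "y t = 0") (auto simp: S_def y_def intro: less_imp_le)
        qed (use \<sigma>a True \<open>b \<in> S\<close> in \<open>auto simp: y_def\<close>)
        finally show ?thesis .
      qed
      moreover have "(\<Sum>t=A..B. (h t)\<^sup>2) \<le> 1/9"
        by (rule sq) (use gap[of a b] ab in \<open>auto simp: h_def chord_gap_def\<close>)
      ultimately show ?thesis
        using ab order_trans[OF gap[of a b] Lc1] AB
        by (intro exI[of _ "\<lambda>t. x t + h t"] exI[of _ "{A, a, b}"])
          (auto simp: sum.distrib card_insert_if simp flip: sum_distrib_left, auto simp: h_def)
    next
      case False
      \<comment> \<open>\<open>b'\<close> is the first kink whose sign differs from that at
        \<open>a\<close>, and \<open>a'\<close> is the kink just before it, so \<open>x\<close> is
        affine from \<open>a'\<close> to \<open>b'\<close> and the tilt applies there.\<close>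
      define b' where "b' = Min {t \<in> S. \<sigma> * y t \<le> 0}"
      have "b' \<in> {t \<in> S. \<sigma> * y t \<le> 0}"
        unfolding b'_def by (rule Min_in) (use False \<open>finite S\<close> in \<open>auto simp: not_less\<close>)
      then have b'S: "b' \<in> S" and "\<sigma> * y b' \<le> 0" by auto
      then have \<sigma>b': "\<sigma> * y b' < 0" using \<sigma> by (auto simp: S_def)
      have b'min: "\<sigma> * y t > 0" if "t \<in> S" "t < b'" for t
      proof (rule ccontr)
        assume "\<not> \<sigma> * y t > 0"
        then have "b' \<le> t" unfolding b'_def using that \<open>finite S\<close> by (intro Min_le) auto
        with that show False by simp
      qed
      have "a \<le> b'" using b'S \<open>finite S\<close> by (auto simp: a_def)
      with \<sigma>a \<sigma>b' have "a < b'" by (cases "a = b'") auto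
      define a' where "a' = Max {t \<in> S. t < b'}"
      have "a' \<in> {t \<in> S. t < b'}"
        unfolding a'_def by (rule Max_in) (use \<open>a \<in> S\<close> \<open>a < b'\<close> \<open>finite S\<close> in auto)
      then have a'S: "a' \<in> S" and "a' < b'" by auto
      have \<sigma>a': "\<sigma> * y a' > 0" using b'min a'S \<open>a' < b'\<close> by auto
      have mid: "y t = 0" if "a' < t" "t < b'" for t
      proof (rule ccontr)
        assume "y t \<noteq> 0"
        then have "t \<in> {t \<in> S. t < b'}" using that a'S b'S by (auto simp: S_def)
        then have "t \<le> a'" using \<open>finite S\<close> unfolding a'_def by (intro Max_ge) auto
        with that show False by simp
      qed
      have ord: "A < a" "a \<le> a'" "a' < b'" "b' \<le> b" "b < B" "1 \<le> a'" "b' \<le> n" "1 \<le> b'"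
      proof -
        have "a \<le> a'" "b' \<le> b" using a'S b'S \<open>finite S\<close> by (auto simp: a_def b_def)
        then show "A < a" "a \<le> a'" "a' < b'" "b' \<le> b" "b < B" "1 \<le> a'" "b' \<le> n" "1 \<le> b'"
          using ab \<open>a' < b'\<close> by auto
      qed
      have "real (B - A) ^ 3 * c\<^sup>2 \<le> 1 / 9" by (fact short')
      from tilt_tradeoff[OF \<mu> _ _ c0 this, of "real (b' - a')"] ord
      obtain \<kappa> where \<kappa>: "\<kappa> \<ge> 0" "\<kappa> * real (b' - a') \<le> 1"
        "3 * \<mu> * c - 2 * \<mu> * \<kappa> + 2 * \<kappa>\<^sup>2 * real (b' - a') ^ 3 \<le> 1/2" by auto
      define h1 where "h1 = chord_gap x a a'"
      define h2 where "h2 = chord_gap x b' b"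
      define r where "r = ramp \<sigma> a' b'"
      define h where "h t = h1 t + h2 t" for t
      define v where "v t = x t + (h t + \<kappa> * r t)" for t
      have z1: "h1 t = 0" if "t \<le> a \<or> a' \<le> t" for t
        using that ord by (cases "t = a \<or> t = a'") (auto simp: h1_def chord_gap_def chord_def)
      have z2: "h2 t = 0" if "t \<le> b' \<or> b \<le> t" for t
        using that ord by (cases "t = b' \<or> t = b") (auto simp: h2_def chord_gap_def chord_def)
      have zr: "r t = 0" if "t \<le> a' \<or> b' < t" for t
        using that by (auto simp: r_def ramp_def)
      \<comment> \<open>Gaps and ramp have disjoint supports, so squaring the total displacement
        leaves no cross term between them.\<close>
      have ortho: "h t * r t = 0" for t
        using z1[of t] z2[of t] zr[of t] by (cases "t \<le> a' \<or> b' < t") (auto simp: h_def)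
      have hbd: "\<bar>h t\<bar> \<le> real (B - A) * c" for t
      proof (cases "t \<le> b'")
        case True
        then show ?thesis using z2[of t] gap[of a a' t] ord by (auto simp: h_def h1_def)
      next
        case False
        then show ?thesis using z1[of t] gap[of b' b t] ord by (auto simp: h_def h2_def)
      qed
      \<comment> \<open>The ramp ends with a jump after \<open>b'\<close>, so the break is put at
        \<open>Suc b'\<close>; this also releases the kink at \<open>b'\<close>.\<close>
      have "affine_off {A, a, a', Suc b', b} A B v"
        unfolding affine_off_def
      proof (intro allI impI)
        fix t assume t: "A < t \<and> t < B \<and> t \<notin> {A, a, a', Suc b', b} \<and> Suc t \<notin> {A, a, a', Suc b', b}"
        then have ne: "t \<noteq> a" "t \<noteq> a'" "t \<noteq> b'" "t \<noteq> Suc b'" "t \<noteq> b" by auto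
        have "second_diff v t = y t + (second_diff h1 t + second_diff h2 t + \<kappa> * second_diff r t)"
          by (simp add: v_def[abs_def] h_def second_diff_add second_diff_cmult y_def)
        also have "second_diff r t = 0"
          unfolding r_def by (rule second_diff_ramp) (use ord ne in auto)
        also have "second_diff h1 t = (if a < t \<and> t < a' then - y t else 0)"
          using second_diff_chord_gap(1,2)[OF \<open>1 \<le> a\<close> \<open>a \<le> a'\<close>, of t x] ne
          unfolding h1_def y_def by force
        also have "second_diff h2 t = (if b' < t \<and> t < b then - y t else 0)"
          using second_diff_chord_gap(1,2)[OF \<open>1 \<le> b'\<close> \<open>b' \<le> b\<close>, of t x] ne
          unfolding h2_def y_def by force
        finally show "second_diff v t = 0"
          using out[of t] mid[of t] t ne ord by (auto split: if_splits)
      qed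
      moreover have "\<bar>v t - x t\<bar> \<le> 1" for t
      proof (cases "t \<le> a' \<or> b' < t")
        case True
        then show ?thesis using zr[of t] hbd[of t] Lc1 by (simp add: v_def)
      next
        case False
        then have "h t = 0" using z1 z2 by (simp add: h_def)
        moreover have "\<kappa> * \<bar>r t\<bar> \<le> \<kappa> * real (b' - a')"
          using \<kappa> \<sigma> False by (intro mult_left_mono) (auto simp: r_def ramp_def abs_mult)
        ultimately show ?thesis using \<kappa> by (simp add: v_def abs_mult)
      qed
      moreover have "(\<Sum>t=A..B. g t * (v t - x t) + 2 * (v t - x t)\<^sup>2) \<le> 1"
      proof -
        have "(\<Sum>t=A..B. g t * (v t - x t) + 2 * (v t - x t)\<^sup>2) =
          (\<Sum>t=A..B. g t * h1 t) + (\<Sum>t=A..B. g t * h2 t) + \<kappa> * (\<Sum>t=A..B. g t * r t)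
            + (2 * (\<Sum>t=A..B. (h t)\<^sup>2) + 2 * \<kappa>\<^sup>2 * (\<Sum>t=A..B. (r t)\<^sup>2))"
        proof -
          have "g t * (v t - x t) + 2 * (v t - x t)\<^sup>2 = g t * h1 t + g t * h2 t + \<kappa> * (g t * r t)
            + (2 * (h t)\<^sup>2 + 2 * \<kappa>\<^sup>2 * (r t)\<^sup>2)" for t
          proof -
            have "(v t - x t)\<^sup>2 = (h t)\<^sup>2 + \<kappa>\<^sup>2 * (r t)\<^sup>2 + 2 * \<kappa> * (h t * r t)"
              by (simp add: v_def power2_eq_square algebra_simps)
            then show ?thesis unfolding ortho by (simp add: v_def h_def algebra_simps)
          qed
          then show ?thesis by (simp add: sum.distrib sum_distrib_left)
        qed
        also have "(\<Sum>t=A..B. g t * h1 t) = (\<Sum>t=1..n. g t * h1 t)"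
          by (rule sumout) (use z1 ord in auto)
        also have "(\<Sum>t=A..B. g t * h2 t) = (\<Sum>t=1..n. g t * h2 t)"
          by (rule sumout) (use z2 ord in auto)
        also have "(\<Sum>t=A..B. g t * r t) = (\<Sum>t=1..n. g t * r t)"
          by (rule sumout) (use zr ord in auto)
        also have "(\<Sum>t=A..B. (r t)\<^sup>2) = (\<Sum>t=1..n. (r t)\<^sup>2)"
          by (rule sumout) (use zr ord in auto)
        finally have eq: "(\<Sum>t=A..B. g t * (v t - x t) + 2 * (v t - x t)\<^sup>2) =
          (\<Sum>t=1..n. g t * h1 t) + (\<Sum>t=1..n. g t * h2 t) + \<kappa> * (\<Sum>t=1..n. g t * r t)
            + (2 * (\<Sum>t=A..B. (h t)\<^sup>2) + 2 * \<kappa>\<^sup>2 * (\<Sum>t=1..n. (r t)\<^sup>2))" .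
        \<comment> \<open>Kinks inside the two outer chords may have any sign, so only the crude
          factor 3 is available; this is the cost that the tilt has to pay.\<close>
        have "(\<Sum>t=1..n. g t * h1 t) \<le> 3 * \<mu> * (\<Sum>t\<in>{a<..<a'}. \<bar>y t\<bar>)"
          unfolding h1_def y_def by (rule stationary_chord_gap[OF st]) (use \<mu> ord ab in auto)
        moreover have "(\<Sum>t=1..n. g t * h2 t) \<le> 3 * \<mu> * (\<Sum>t\<in>{b'<..<b}. \<bar>y t\<bar>)"
          unfolding h2_def y_def by (rule stationary_chord_gap[OF st]) (use \<mu> ord ab in auto)
        moreover have "3 * \<mu> * (\<Sum>t\<in>{a<..<a'}. \<bar>y t\<bar>) + 3 * \<mu> * (\<Sum>t\<in>{b'<..<b}. \<bar>y t\<bar>) \<le> 3 * \<mu> * c"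
        proof -
          have "(\<Sum>t\<in>{a<..<a'}. \<bar>y t\<bar>) + (\<Sum>t\<in>{b'<..<b}. \<bar>y t\<bar>)
              = (\<Sum>t\<in>{a<..<a'} \<union> {b'<..<b}. \<bar>y t\<bar>)"
            by (rule sum.union_disjoint[symmetric]) (use ord in auto)
          also have "\<dots> \<le> c" unfolding c_def by (rule sum_mono2) (use ord in auto)
          finally have "3 * \<mu> * ((\<Sum>t\<in>{a<..<a'}. \<bar>y t\<bar>) + (\<Sum>t\<in>{b'<..<b}. \<bar>y t\<bar>)) \<le> 3 * \<mu> * c"
            using \<mu> by (intro mult_left_mono) auto
          then show ?thesis by (simp add: distrib_left)
        qed
        moreover have "\<kappa> * (\<Sum>t=1..n. g t * r t) \<le> \<kappa> * (- 2 * \<mu>)"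
          unfolding r_def
          by (intro mult_left_mono stationary_ramp[OF st]) (use \<mu> \<kappa> \<sigma> ord \<sigma>a' \<sigma>b' in \<open>auto simp: y_def\<close>)
        moreover have "(\<Sum>t=A..B. (h t)\<^sup>2) \<le> 1/9"
          by (rule sq[OF hbd]) (use z1 z2 ord in \<open>auto simp: h_def\<close>)
        moreover have "2 * \<kappa>\<^sup>2 * (\<Sum>t=1..n. (r t)\<^sup>2) \<le> 2 * \<kappa>\<^sup>2 * real (b' - a') ^ 3"
          unfolding r_def by (intro mult_left_mono sum_ramp_sq_le) (use ord \<sigma> in auto)
        \<comment> \<open>The budget of 1 is met by 1/2 from \<open>tilt_tradeoff\<close> and 2/9
          from the squares of the gaps.\<close>
        ultimately show ?thesis using \<kappa>(3) unfolding eq by (simp add: mult.commute mult.left_commute)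
      qed
      ultimately show ?thesis using ord AB
        by (intro exI[of _ v] exI[of _ "{A, a, a', Suc b', b}"]) (auto simp: card_insert_if)
    qed
  qed
qed

text \<open>Bins are peeled off from the right, each extended to the left as far as length and
  variation allow. Failure to include one more index uses up a unit of \<open>m / \<beta>\<close>
  plus the variation over \<open>\<delta>\<close>; the initial 1 is for the leftmost bin. The
  variation of a bin is taken over an open interval, so that the charges of different bins are
  disjoint.\<close>

lemma piecewise_affine_comparison:
  assumes st: "stationary n \<mu> g x" and "\<mu> > 0" "\<beta> > 0" "\<delta> > 0" and \<beta>\<delta>: "\<beta> ^ 3 * \<delta>\<^sup>2 \<le> 1/9"
    and "m \<le> n"
  shows "\<exists>v P N. P \<subseteq> {1..m} \<and> (m \<ge> 1 \<longrightarrow> 1 \<in> P) \<and> card P \<le> 5 * N \<and> affine_off P 1 m v \<and>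
    real N \<le> 1 + real m / \<beta> + (\<Sum>t<m. \<bar>second_diff x t\<bar>) / \<delta> \<and>
    (\<forall>t\<in>{1..m}. \<bar>v t - x t\<bar> \<le> 1) \<and> (\<Sum>t=1..m. g t * (v t - x t) + 2 * (v t - x t)\<^sup>2) \<le> real N"
  using \<open>m \<le> n\<close>
proof (induction m rule: less_induct)
  case (less m)
  define c where "c a = (\<Sum>t\<in>{a<..<m}. \<bar>second_diff x t\<bar>)" for a
  have c0: "c a \<ge> 0" for a by (auto simp: c_def intro: sum_nonneg)
  define good where "good a \<longleftrightarrow> 1 \<le> a \<and> a \<le> m \<and> real (m - a) \<le> \<beta> \<and> c a \<le> \<delta>" for a
  show ?case
  proof (cases "m = 0")
    case True
    then show ?thesis
      by (intro exI[of _ x] exI[of _ "{}"] exI[of _ 0]) (auto simp: affine_off_def)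
  next
    case False
    have "{m<..<m} = {}" by auto
    then have "good m" using False assms by (auto simp: good_def c_def)
    define A where "A = (LEAST a. good a)"
    have "good A" unfolding A_def by (rule LeastI) fact
    then have A: "1 \<le> A" "A \<le> m" "real (m - A) \<le> \<beta>" "c A \<le> \<delta>" by (auto simp: good_def)
    have "real (m - A) ^ 3 * (c A)\<^sup>2 \<le> \<beta> ^ 3 * \<delta>\<^sup>2"
      using A c0 assms by (intro mult_mono power_mono) auto
    with \<beta>\<delta> have "real (m - A) ^ 3 * (c A)\<^sup>2 \<le> 1/9" by linarith
    from short_bin_affine[OF st \<open>\<mu> > 0\<close> A(1,2) less.prems this[unfolded c_def]]
    obtain v2 P2 where v2: "P2 \<subseteq> {A..m}" "A \<in> P2" "card P2 \<le> 5" "affine_off P2 A m v2"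
      "\<forall>t\<in>{A..m}. \<bar>v2 t - x t\<bar> \<le> 1"
      "(\<Sum>t=A..m. g t * (v2 t - x t) + 2 * (v2 t - x t)\<^sup>2) \<le> 1"
      by auto
    show ?thesis
    proof (cases "A = 1")
      case True
      then show ?thesis using v2 assms
        by (intro exI[of _ v2] exI[of _ P2] exI[of _ 1]) (auto intro!: add_nonneg_nonneg sum_nonneg)
    next
      case neq: False
      define k where "k = A - 1"
      have k: "A = Suc k" "1 \<le> k" "k < m" "k \<le> n" using A neq less.prems by (auto simp: k_def)
      have "\<not> good k" using not_less_Least[of k good] k unfolding A_def by auto
      then have "real (m - k) > \<beta> \<or> c k > \<delta>" using k by (auto simp: good_def)
      then have one: "1 \<le> real (m - k) / \<beta> + c k / \<delta>"
      proof
        assume "real (m - k) > \<beta>"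
        then have "1 \<le> real (m - k) / \<beta>" using assms by simp
        then show ?thesis using c0[of k] assms by (simp add: add_increasing2)
      next
        assume "c k > \<delta>"
        then have "1 \<le> c k / \<delta>" using assms by simp
        then show ?thesis using assms by (simp add: add_increasing)
      qed
      obtain v1 P1 N where v1: "P1 \<subseteq> {1..k}" "1 \<in> P1" "card P1 \<le> 5 * N" "affine_off P1 1 k v1"
        "real N \<le> 1 + real k / \<beta> + (\<Sum>t<k. \<bar>second_diff x t\<bar>) / \<delta>"
        "\<forall>t\<in>{1..k}. \<bar>v1 t - x t\<bar> \<le> 1"
        "(\<Sum>t=1..k. g t * (v1 t - x t) + 2 * (v1 t - x t)\<^sup>2) \<le> real N"
        using less.IH[OF k(3,4)] k(2) by auto
      define v where "v t = (if t \<le> k then v1 t else v2 t)" for t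
      have "card (P1 \<union> P2) \<le> 5 * Suc N" using card_Un_le[of P1 P2] v1 v2 by simp
      moreover have "real (Suc N) \<le> 1 + real m / \<beta> + (\<Sum>t<m. \<bar>second_diff x t\<bar>) / \<delta>"
      proof -
        have "{..<k} \<union> {k<..<m} \<subseteq> {..<m}" using k by auto
        then have "(\<Sum>t\<in>{..<k} \<union> {k<..<m}. \<bar>second_diff x t\<bar>) \<le> (\<Sum>t<m. \<bar>second_diff x t\<bar>)"
          by (intro sum_mono2) auto
        then have "(\<Sum>t<k. \<bar>second_diff x t\<bar>) + c k \<le> (\<Sum>t<m. \<bar>second_diff x t\<bar>)"
          unfolding c_def by (subst sum.union_disjoint[symmetric]) auto
        then have "(\<Sum>t<k. \<bar>second_diff x t\<bar>) / \<delta> + c k / \<delta> \<le> (\<Sum>t<m. \<bar>second_diff x t\<bar>) / \<delta>"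
          using assms by (simp add: divide_right_mono flip: add_divide_distrib)
        moreover have "real k / \<beta> + real (m - k) / \<beta> = real m / \<beta>"
          using k by (simp add: of_nat_diff flip: add_divide_distrib)
        ultimately show ?thesis using one v1(5) by simp
      qed
      moreover have "affine_off (P1 \<union> P2) 1 m v"
        unfolding affine_off_def
      proof (intro allI impI)
        fix t assume t: "1 < t \<and> t < m \<and> t \<notin> P1 \<union> P2 \<and> Suc t \<notin> P1 \<union> P2"
        \<comment> \<open>Since \<open>A = Suc k\<close> is a break, \<open>t = k\<close> and
          \<open>t = A\<close> are excluded; every other second difference lies within one of the
          two parts.\<close>
        then have "t \<noteq> k" "t \<noteq> A" using v2(2) k by auto
        then consider "t < k" | "A < t" using k by linarith
        then show "second_diff v t = 0"
        proof cases
          case 1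
          then have "second_diff v t = second_diff v1 t"
            by (intro second_diff_local_eq) (auto simp: v_def)
          then show ?thesis using v1(4) t 1 by (auto simp: affine_off_def)
        next
          case 2
          then have "second_diff v t = second_diff v2 t"
            using k by (intro second_diff_local_eq) (auto simp: v_def)
          then show ?thesis using v2(4) t 2 by (auto simp: affine_off_def)
        qed
      qed
      moreover have "(\<Sum>t=1..m. g t * (v t - x t) + 2 * (v t - x t)\<^sup>2) \<le> real (Suc N)"
      proof -
        have "{1..m} = {1..k} \<union> {A..m}" using k by auto
        then have "(\<Sum>t=1..m. g t * (v t - x t) + 2 * (v t - x t)\<^sup>2) =
          (\<Sum>t=1..k. g t * (v t - x t) + 2 * (v t - x t)\<^sup>2) + (\<Sum>t=A..m. g t * (v t - x t) + 2 * (v t - x t)\<^sup>2)"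
          using k by (simp only:) (rule sum.union_disjoint, auto)
        also have "(\<Sum>t=1..k. g t * (v t - x t) + 2 * (v t - x t)\<^sup>2) =
          (\<Sum>t=1..k. g t * (v1 t - x t) + 2 * (v1 t - x t)\<^sup>2)"
          by (rule sum.cong) (auto simp: v_def)
        also have "(\<Sum>t=A..m. g t * (v t - x t) + 2 * (v t - x t)\<^sup>2) =
          (\<Sum>t=A..m. g t * (v2 t - x t) + 2 * (v2 t - x t)\<^sup>2)"
          by (rule sum.cong) (auto simp: v_def k)
        finally show ?thesis using v1(7) v2(6) by simp
      qed
      moreover have "\<bar>v t - x t\<bar> \<le> 1" if "t \<in> {1..m}" for t
        using v1(6) v2(5) that k by (auto simp: v_def)
      ultimately show ?thesis using v1(1,2) v2(1) k
        by (intro exI[of _ v] exI[of _ "P1 \<union> P2"] exI[of _ "Suc N"]) auto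
    qed
  qed
qed

subsection \<open>Attainment of minima in finitely many coordinates\<close>

text \<open>Bolzano-Weierstrass, refining the subsequence once per coordinate by a monotone
  one.\<close>

lemma convergent_subsequence_finite:
  fixes X :: "nat \<Rightarrow> 'i \<Rightarrow> real"
  assumes "finite I" "\<And>n i. i \<in> I \<Longrightarrow> \<bar>X n i\<bar> \<le> M i"
  shows "\<exists>r l. strict_mono r \<and> (\<forall>i\<in>I. (\<lambda>n. X (r n) i) \<longlonglongrightarrow> l i)"
  using assms
proof (induction I)
  case empty
  then show ?case using strict_mono_id by fastforce
next
  case (insert j I)
  then obtain r l where r: "strict_mono r" "\<forall>i\<in>I. (\<lambda>n. X (r n) i) \<longlonglongrightarrow> l i" by auto
  obtain s where s: "strict_mono s" "monoseq (\<lambda>n. X (r (s n)) j)"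
    using seq_monosub[of "\<lambda>n. X (r n) j"] by (auto simp: o_def)
  have "Bseq (\<lambda>n. X (r (s n)) j)"
    using insert.prems[of j] by (intro BseqI'[of _ "M j"]) auto
  then have "convergent (\<lambda>n. X (r (s n)) j)" using s by (intro Bseq_monoseq_convergent)
  then obtain L where L: "(\<lambda>n. X (r (s n)) j) \<longlonglongrightarrow> L" by (auto simp: convergent_def)
  have "(\<lambda>n. X (r (s n)) i) \<longlonglongrightarrow> (l(j := L)) i" if "i \<in> insert j I" for i
  proof (cases "i = j")
    case False
    with that r(2) have "(\<lambda>n. X (r n) i) \<longlonglongrightarrow> l i" by auto
    from LIMSEQ_subseq_LIMSEQ[OF this s(1)] show ?thesis using False by (simp add: o_def)
  qed (use L in simp)
  moreover have "strict_mono (\<lambda>n. r (s n))" using strict_mono_o[OF r(1) s(1)] by (simp add: o_def)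
  ultimately show ?case by (intro exI[of _ "\<lambda>n. r (s n)"] exI[of _ "l(j := L)"]) auto
qed

text \<open>With an arbitrary index type and the values outside the finite set \<open>I\<close>
  frozen, this serves both the projections of vectors and the offline problem on arrays indexed by
  coordinate and time.\<close>

lemma attains_min_finite:
  fixes \<phi> :: "('i \<Rightarrow> real) \<Rightarrow> real"
  assumes "finite I" "S \<noteq> {}" and bd: "\<And>x i. x \<in> S \<Longrightarrow> i \<in> I \<Longrightarrow> \<bar>x i\<bar> \<le> M i"
    and out: "\<And>x i. x \<in> S \<Longrightarrow> i \<notin> I \<Longrightarrow> x i = z i"
    and closed: "\<And>X l. (\<And>n. X n \<in> S) \<Longrightarrow> (\<And>i. (\<lambda>n. X n i) \<longlonglongrightarrow> l i) \<Longrightarrow> l \<in> S"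
    and cont: "\<And>X l. (\<And>n. X n \<in> S) \<Longrightarrow> l \<in> S \<Longrightarrow> (\<And>i. (\<lambda>n. X n i) \<longlonglongrightarrow> l i) \<Longrightarrow>
      (\<lambda>n. \<phi> (X n)) \<longlonglongrightarrow> \<phi> l"
    and below: "\<And>x. x \<in> S \<Longrightarrow> b \<le> \<phi> x"
  shows "\<exists>x\<in>S. \<forall>y\<in>S. \<phi> x \<le> \<phi> y"
proof -
  define m where "m = Inf (\<phi> ` S)"
  have bdd: "bdd_below (\<phi> ` S)" using below by (auto intro!: bdd_belowI[of _ b])
  have "\<exists>x\<in>S. \<phi> x < m + 1 / real (Suc n)" for n
    using cInf_lessD[of "\<phi> ` S" "m + 1 / real (Suc n)"] \<open>S \<noteq> {}\<close> unfolding m_def by auto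
  then obtain X where X: "\<And>n. X n \<in> S" "\<And>n. \<phi> (X n) < m + 1 / real (Suc n)" by metis
  obtain r l where r: "strict_mono r" "\<forall>i\<in>I. (\<lambda>n. X (r n) i) \<longlonglongrightarrow> l i"
    using convergent_subsequence_finite[OF \<open>finite I\<close>, of X M] bd X by auto
  define l' where "l' i = (if i \<in> I then l i else z i)" for i
  have lim: "(\<lambda>n. X (r n) i) \<longlonglongrightarrow> l' i" for i
    using r out[OF X(1)] by (cases "i \<in> I") (auto simp: l'_def)
  have "l' \<in> S" by (rule closed[of "\<lambda>n. X (r n)"]) (use X lim in auto)
  have "(\<lambda>n. \<phi> (X (r n))) \<longlonglongrightarrow> \<phi> l'"
    by (rule cont) (use X lim \<open>l' \<in> S\<close> in auto)
  moreover have "(\<lambda>n. m + 1 / real (Suc (r n))) \<longlonglongrightarrow> m + 0"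
    using LIMSEQ_subseq_LIMSEQ[OF LIMSEQ_inverse_real_of_nat r(1)]
    by (intro tendsto_add tendsto_const) (simp add: o_def inverse_eq_divide)
  ultimately have "\<phi> l' \<le> m + 0"
    by (rule LIMSEQ_le) (use X(2) in \<open>auto intro: less_imp_le\<close>)
  then have "\<phi> l' \<le> \<phi> y" if "y \<in> S" for y
    using cInf_lower[OF _ bdd, of "\<phi> y"] that by (simp add: m_def)
  with \<open>l' \<in> S\<close> show ?thesis by auto
qed

subsection \<open>Determinants of rank one updates\<close>

definition outer :: "real Matrix.vec \<Rightarrow> real Matrix.vec \<Rightarrow> real mat" where
  "outer x y = mat (dim_vec x) (dim_vec y) (\<lambda>(i, j). x $ i * y $ j)"

text \<open>Matrix determinant lemma: \<open>P * Q = R * P\<close> with \<open>det P = 1\<close>,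
  while \<open>Q\<close> and \<open>R\<close> are block triangular and have the two sides as
  determinants.\<close>

lemma det_one_plus_outer:
  assumes [simp]: "x \<in> carrier_vec m" "y \<in> carrier_vec m"
  shows "det (1\<^sub>m m + outer x y) = 1 + y \<bullet> x"
proof -
  define X where "X = mat m 1 (\<lambda>(i, j). x $ i)"
  define Y where "Y = mat 1 m (\<lambda>(i, j). y $ j)"
  have [simp]: "X \<in> carrier_mat m 1" "Y \<in> carrier_mat 1 m" "dim_row X = m" "dim_col X = 1"
    "dim_row Y = 1" "dim_col Y = m" by (auto simp: X_def Y_def)
  have [simp]: "dim_vec x = m" "dim_vec y = m" using assms by auto
  have XY: "X * Y = outer x y"
    by (rule eq_matI) (auto simp: X_def Y_def outer_def scalar_prod_def times_mat_def)
  have YX: "Y * X = mat 1 1 (\<lambda>_. y \<bullet> x)"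
    by (rule eq_matI) (auto simp: X_def Y_def scalar_prod_def)
  have co: "outer x y \<in> carrier_mat m m" by (auto simp: outer_def)
  define P where "P = four_block_mat (1\<^sub>m m) (0\<^sub>m m 1) Y (1\<^sub>m 1)"
  define Q where "Q = four_block_mat (1\<^sub>m m + outer x y) X (0\<^sub>m 1 m) (1\<^sub>m 1)"
  define R where "R = four_block_mat (1\<^sub>m m) X (0\<^sub>m 1 m) (1\<^sub>m 1 + Y * X)"
  have cP: "P \<in> carrier_mat (m + 1) (m + 1)" and cQ: "Q \<in> carrier_mat (m + 1) (m + 1)"
    and cR: "R \<in> carrier_mat (m + 1) (m + 1)"
    unfolding P_def Q_def R_def using co by (auto intro!: four_block_carrier_mat)
  have "P * Q = four_block_mat (1\<^sub>m m + outer x y) X (Y * (1\<^sub>m m + outer x y)) (Y * X + 1\<^sub>m 1)"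
    unfolding P_def Q_def
    by (subst mult_four_block_mat[where ?nr1.0 = m and ?n1.0 = m and ?n2.0 = 1 and ?nr2.0 = 1 and ?nc1.0 = m and ?nc2.0 = 1])
      (use co in \<open>auto simp: left_mult_zero_mat[of _ 1 m] right_mult_zero_mat[of _ _ 1]\<close>)
  also have "Y * (1\<^sub>m m + outer x y) = Y + Y * X * Y"
    using co mult_add_distrib_mat[OF \<open>Y \<in> _\<close> one_carrier_mat co] assoc_mult_mat[OF \<open>Y \<in> _\<close> \<open>X \<in> _\<close> \<open>Y \<in> _\<close>]
    by (simp add: XY right_mult_one_mat[OF \<open>Y \<in> _\<close>])
  also have YXY: "Y + Y * X * Y = (1\<^sub>m 1 + Y * X) * Y"
    using add_mult_distrib_mat[OF one_carrier_mat mult_carrier_mat[OF \<open>Y \<in> _\<close> \<open>X \<in> _\<close>] \<open>Y \<in> _\<close>]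
    by (simp add: left_mult_one_mat[OF \<open>Y \<in> _\<close>])
  also have YX1: "Y * X + 1\<^sub>m 1 = 1\<^sub>m 1 + Y * X"
    by (rule comm_add_mat[of _ 1 1]) auto
  also have "four_block_mat (1\<^sub>m m + outer x y) X ((1\<^sub>m 1 + Y * X) * Y) (1\<^sub>m 1 + Y * X) = R * P"
    unfolding P_def R_def
    by (subst mult_four_block_mat[where ?nr1.0 = m and ?n1.0 = m and ?n2.0 = 1 and ?nr2.0 = 1 and ?nc1.0 = m and ?nc2.0 = 1])
      (use co YXY YX1 in \<open>auto simp: XY left_add_zero_mat[of _ m 1] left_add_zero_mat[of _ 1 m] left_add_zero_mat[of _ 1 1]\<close>)
  finally have "det (P * Q) = det (R * P)" by simp
  then have "det P * det Q = det R * det P" using cP cQ cR by (simp add: det_mult)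
  moreover have "det P = 1"
    unfolding P_def by (subst det_four_block_mat_upper_right_zero[of _ m _ 1]) auto
  moreover have "det Q = det (1\<^sub>m m + outer x y)"
    unfolding Q_def using co by (subst det_four_block_mat_lower_left_zero[of _ m _ 1]) auto
  moreover have "det R = det (1\<^sub>m 1 + Y * X)"
    unfolding R_def by (subst det_four_block_mat_lower_left_zero[of _ m _ 1]) auto
  moreover have "det (1\<^sub>m 1 + Y * X) = 1 + y \<bullet> x"
    unfolding YX by (subst det_single) auto
  ultimately show ?thesis by simp
qed

text \<open>Bounding the Leibniz formula termwise is crude, but only the logarithm enters the
  regret, where it adds merely a term of order \<open>m * ln m\<close>.\<close>

lemma abs_det_le:
  fixes A :: "real mat"
  assumes A: "A \<in> carrier_mat m m" and M: "\<And>i j. i < m \<Longrightarrow> j < m \<Longrightarrow> \<bar>A $$ (i, j)\<bar> \<le> M"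
  shows "\<bar>det A\<bar> \<le> fact m * M ^ m"
proof -
  have "\<bar>det A\<bar> \<le> (\<Sum>p\<in>{p. p permutes {0..<m}}. \<bar>signof p * (\<Prod>i = 0..<m. A $$ (i, p i))\<bar>)"
    unfolding det_def'[OF A] by (rule sum_abs)
  also have "\<dots> \<le> (\<Sum>p\<in>{p. p permutes {0..<m}}. M ^ m)"
  proof (rule sum_mono)
    fix p assume p: "p \<in> {p. p permutes {0..<m}}"
    have "\<bar>signof p * (\<Prod>i = 0..<m. A $$ (i, p i))\<bar> = (\<Prod>i = 0..<m. \<bar>A $$ (i, p i)\<bar>)"
      by (auto simp: sign_def abs_mult abs_prod)
    also have "\<dots> \<le> (\<Prod>i = 0..<m. M)"
      by (rule prod_mono) (use p M permutes_in_image[of p "{0..<m}"] in auto)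
    finally show "\<bar>signof p * (\<Prod>i = 0..<m. A $$ (i, p i))\<bar> \<le> M ^ m" by simp
  qed
  also have "\<dots> = fact m * M ^ m"
    using card_permutations[of "{0..<m}" m] by simp
  finally show ?thesis .
qed

subsection \<open>The online Newton step\<close>

text \<open>\<open>k\<close> counts the gradients already absorbed, so the update out of iterate
  \<open>s\<close> uses the matrix with index \<open>Suc s\<close>.\<close>

definition ons_mat :: "nat \<Rightarrow> real \<Rightarrow> real \<Rightarrow> (nat \<Rightarrow> real Matrix.vec) \<Rightarrow> nat \<Rightarrow> real mat" where
  "ons_mat m \<epsilon> \<eta> G k = \<epsilon> \<cdot>\<^sub>m 1\<^sub>m m + \<eta> \<cdot>\<^sub>m mat m m (\<lambda>(a, b). \<Sum>s<k. G s $ a * G s $ b)"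

lemma ons_mat_carrier [simp]: "ons_mat m \<epsilon> \<eta> G k \<in> carrier_mat m m"
  by (simp add: ons_mat_def)

lemma ons_mat_dim [simp]: "dim_row (ons_mat m \<epsilon> \<eta> G k) = m" "dim_col (ons_mat m \<epsilon> \<eta> G k) = m"
  by (simp_all add: ons_mat_def)

lemma ons_mat_index:
  "i < m \<Longrightarrow> j < m \<Longrightarrow> ons_mat m \<epsilon> \<eta> G k $$ (i, j) =
    (if i = j then \<epsilon> else 0) + \<eta> * (\<Sum>s<k. G s $ i * G s $ j)"
  by (simp add: ons_mat_def)

lemma ons_form:
  assumes x: "x \<in> carrier_vec m" and y: "y \<in> carrier_vec m" and G: "\<And>s. s < k \<Longrightarrow> G s \<in> carrier_vec m"
  shows "x \<bullet> (ons_mat m \<epsilon> \<eta> G k *\<^sub>v y) = \<epsilon> * (x \<bullet> y) + \<eta> * (\<Sum>s<k. (G s \<bullet> x) * (G s \<bullet> y))"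
proof -
  have "x \<bullet> (ons_mat m \<epsilon> \<eta> G k *\<^sub>v y) = (\<Sum>i<m. \<Sum>j<m. x $ i * (ons_mat m \<epsilon> \<eta> G k $$ (i, j) * y $ j))"
    using x y by (simp add: scalar_prod_def sum_distrib_left atLeast0LessThan)
  also have "\<dots> = (\<Sum>i<m. \<Sum>j<m. \<epsilon> * ((if i = j then x $ i * y $ j else 0))
      + \<eta> * (\<Sum>s<k. (G s $ i * x $ i) * (G s $ j * y $ j)))"
    by (intro sum.cong refl) (simp add: ons_mat_index algebra_simps sum_distrib_left sum_distrib_right)
  also have "\<dots> = \<epsilon> * (\<Sum>i<m. \<Sum>j<m. (if i = j then x $ i * y $ j else 0))
      + \<eta> * (\<Sum>i<m. \<Sum>j<m. \<Sum>s<k. (G s $ i * x $ i) * (G s $ j * y $ j))"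
    by (simp only: sum.distrib sum_distrib_left)
  also have "(\<Sum>i<m. \<Sum>j<m. (if i = j then x $ i * y $ j else 0)) = x \<bullet> y"
    using y by (simp add: scalar_prod_def atLeast0LessThan)
  also have "(\<Sum>i<m. \<Sum>j<m. \<Sum>s<k. (G s $ i * x $ i) * (G s $ j * y $ j))
    = (\<Sum>i<m. \<Sum>s<k. \<Sum>j<m. (G s $ i * x $ i) * (G s $ j * y $ j))"
    by (intro sum.cong refl sum.swap)
  also have "\<dots> = (\<Sum>s<k. \<Sum>i<m. \<Sum>j<m. (G s $ i * x $ i) * (G s $ j * y $ j))"
    by (rule sum.swap)
  also have "\<dots> = (\<Sum>s<k. (G s \<bullet> x) * (G s \<bullet> y))"
    by (intro sum.cong refl) (use x y in \<open>simp add: scalar_prod_def atLeast0LessThan sum_product\<close>)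
  finally show ?thesis .
qed

locale ons =
  fixes m :: nat and \<epsilon> \<eta> :: real and G :: "nat \<Rightarrow> real Matrix.vec"
  assumes \<epsilon>: "\<epsilon> \<ge> 1" and \<eta>: "\<eta> > 0" and G [simp]: "\<And>s. G s \<in> carrier_vec m"
begin

abbreviation "A k \<equiv> ons_mat m \<epsilon> \<eta> G k"

definition B :: "nat \<Rightarrow> real mat" where "B k = the (mat_inverse (A k))"

definition form :: "nat \<Rightarrow> real Matrix.vec \<Rightarrow> real Matrix.vec \<Rightarrow> real" where
  "form k x y = x \<bullet> (A k *\<^sub>v y)"

lemma form_eq:
  assumes "x \<in> carrier_vec m" "y \<in> carrier_vec m"
  shows "form k x y = \<epsilon> * (x \<bullet> y) + \<eta> * (\<Sum>s<k. (G s \<bullet> x) * (G s \<bullet> y))"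
  unfolding form_def by (rule ons_form[OF assms G])

lemma A_carrier [simp]: "x \<in> carrier_vec m \<Longrightarrow> A k *\<^sub>v x \<in> carrier_vec m"
  by (rule mult_mat_vec_carrier[OF ons_mat_carrier])

lemma sq_nonneg: "x \<bullet> x \<ge> (0::real)"
  unfolding scalar_prod_def by (auto intro: sum_nonneg)

lemma form_ge: "x \<in> carrier_vec m \<Longrightarrow> form k x x \<ge> \<epsilon> * (x \<bullet> x)"
  using \<eta> by (simp add: form_eq sum_nonneg)

lemma form_nonneg: "x \<in> carrier_vec m \<Longrightarrow> form k x x \<ge> 0"
  using form_ge[of x k] sq_nonneg[of x] \<epsilon> by (smt (verit) mult_nonneg_nonneg)

lemma det_nonzero: "det (A k) \<noteq> 0"
proof
  assume "det (A k) = 0"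
  then obtain v where v: "v \<in> carrier_vec m" "v \<noteq> 0\<^sub>v m" "A k *\<^sub>v v = 0\<^sub>v m"
    using det_0_iff_vec_prod_zero[of "A k" m] by auto
  then have "form k v v = 0" by (simp add: form_def)
  then have "\<epsilon> * (v \<bullet> v) \<le> 0" using form_ge[OF v(1), of k] by simp
  then have "v \<bullet> v = 0" using sq_nonneg[of v] \<epsilon> by (simp add: mult_le_0_iff)
  then have "\<forall>i<m. v $ i = 0"
    using v(1) by (simp add: scalar_prod_def sum_nonneg_eq_0_iff atLeast0LessThan)
  with v show False by auto
qed

text \<open>The form dominates \<open>\<epsilon>\<close> times the Euclidean one, hence the matrix
  is invertible and \<open>the (mat_inverse _)\<close> in the algorithm is a genuine
  inverse.\<close>

lemma B_inverse: "A k * B k = 1\<^sub>m m" "B k \<in> carrier_mat m m"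
proof -
  have "A k \<in> Units (ring_mat TYPE(real) m ())"
    by (rule det_non_zero_imp_unit) (use det_nonzero in auto)
  then obtain C where "mat_inverse (A k) = Some C"
    using mat_inverse(1)[of "A k" m "()"] by (cases "mat_inverse (A k)") auto
  with mat_inverse(2)[of "A k" m C] show "A k * B k = 1\<^sub>m m" "B k \<in> carrier_mat m m"
    by (auto simp: B_def)
qed

lemma A_B: "x \<in> carrier_vec m \<Longrightarrow> A k *\<^sub>v (B k *\<^sub>v x) = x"
  using B_inverse[of k] assoc_mult_mat_vec[of "A k" m m "B k" m x] by simp

lemma B_carrier [simp]: "x \<in> carrier_vec m \<Longrightarrow> B k *\<^sub>v x \<in> carrier_vec m"
  using B_inverse(2)[of k] by simp

text \<open>Removing the newest gradient is a rank one change; pulling out \<open>A (Suc k)\<close>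
  as left factor brings it into the shape whose determinant is known.\<close>

lemma A_Suc_outer: "A k = A (Suc k) * (1\<^sub>m m + outer ((- \<eta>) \<cdot>\<^sub>v (B (Suc k) *\<^sub>v G k)) (G k))"
proof -
  define x where "x = B (Suc k) *\<^sub>v G k"
  have [simp]: "x \<in> carrier_vec m" by (simp add: x_def)
  then have [simp]: "dim_vec x = m" by auto
  have [simp]: "dim_vec (G k) = m" using G[of k] by auto
  have [simp]: "dim_row (A (Suc k)) = m" "dim_col (A (Suc k)) = m"
    using ons_mat_carrier by blast+
  have Ax: "A (Suc k) *\<^sub>v x = G k" unfolding x_def by (rule A_B) simp
  have co: "outer ((- \<eta>) \<cdot>\<^sub>v x) (G k) \<in> carrier_mat m m"
    by (auto simp: outer_def)
  have "A (Suc k) * outer ((- \<eta>) \<cdot>\<^sub>v x) (G k) = mat m m (\<lambda>(i, j). - \<eta> * (G k $ i * G k $ j))"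
  proof (rule eq_matI)
    fix i j assume "i < dim_row (mat m m (\<lambda>(i, j). - \<eta> * (G k $ i * G k $ j)))"
      "j < dim_col (mat m m (\<lambda>(i, j). - \<eta> * (G k $ i * G k $ j)))"
    then have ij: "i < m" "j < m" by auto
    have "(A (Suc k) * outer ((- \<eta>) \<cdot>\<^sub>v x) (G k)) $$ (i, j) =
      (\<Sum>l<m. A (Suc k) $$ (i, l) * (- \<eta> * x $ l * G k $ j))"
      using ij co by (simp add: scalar_prod_def outer_def atLeast0LessThan)
    also have "\<dots> = - \<eta> * G k $ j * (\<Sum>l<m. A (Suc k) $$ (i, l) * x $ l)"
      by (simp add: sum_distrib_left algebra_simps)
    also have "(\<Sum>l<m. A (Suc k) $$ (i, l) * x $ l) = (A (Suc k) *\<^sub>v x) $ i"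
      using ij by (simp add: scalar_prod_def atLeast0LessThan)
    finally show "(A (Suc k) * outer ((- \<eta>) \<cdot>\<^sub>v x) (G k)) $$ (i, j) =
        mat m m (\<lambda>(i, j). - \<eta> * (G k $ i * G k $ j)) $$ (i, j)"
      using ij by (simp add: Ax)
  qed (auto simp: outer_def)
  moreover have "A (Suc k) * (1\<^sub>m m + outer ((- \<eta>) \<cdot>\<^sub>v x) (G k)) =
      A (Suc k) + A (Suc k) * outer ((- \<eta>) \<cdot>\<^sub>v x) (G k)"
    using co mult_add_distrib_mat[of "A (Suc k)" m m "1\<^sub>m m" m] by (simp add: right_mult_one_mat[of _ m m])
  moreover have "A k = A (Suc k) + mat m m (\<lambda>(i, j). - \<eta> * (G k $ i * G k $ j))"
    by (rule eq_matI) (auto simp: ons_mat_index distrib_left distrib_right)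
  ultimately show ?thesis by (simp add: x_def)
qed

text \<open>With \<open>s\<close> the left side without \<open>\<eta>\<close>, the determinants have
  ratio \<open>1 - \<eta> * s\<close>, and \<open>ln (1 - z) \<le> - z\<close>. The ratio is
  positive because \<open>s\<close> is the form evaluated at \<open>B (Suc k) *\<^sub>v G k\<close>,
  hence at least \<open>\<eta> * s * s\<close>, and no determinant vanishes. Absolute values take
  the place of a proof that the determinants are positive.\<close>

lemma increment_le_log_det:
  "\<eta> * (G k \<bullet> (B (Suc k) *\<^sub>v G k)) \<le> ln \<bar>det (A (Suc k))\<bar> - ln \<bar>det (A k)\<bar>"
proof -
  define x where "x = B (Suc k) *\<^sub>v G k"
  define s where "s = G k \<bullet> x"
  have [simp]: "x \<in> carrier_vec m" by (simp add: x_def)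
  then have "dim_vec x = m" "dim_vec (G k) = m" using carrier_vecD G by blast+
  then have co: "outer ((- \<eta>) \<cdot>\<^sub>v x) (G k) \<in> carrier_mat m m"
    unfolding outer_def index_smult_vec(2) by (simp only: mat_carrier)
  have s: "s = form (Suc k) x x"
    using A_B[OF G[of k], of "Suc k"] by (simp add: s_def form_def x_def comm_scalar_prod[of _ m])
  have "det (A k) = det (A (Suc k)) * det (1\<^sub>m m + outer ((- \<eta>) \<cdot>\<^sub>v x) (G k))"
    using co det_mult[of "A (Suc k)" m "1\<^sub>m m + outer ((- \<eta>) \<cdot>\<^sub>v x) (G k)"]
    by (simp flip: A_Suc_outer[of k, folded x_def])
  also have "det (1\<^sub>m m + outer ((- \<eta>) \<cdot>\<^sub>v x) (G k)) = 1 - \<eta> * s"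
    by (subst det_one_plus_outer) (auto simp: s_def scalar_prod_smult_distrib[of _ m])
  finally have det: "det (A k) = det (A (Suc k)) * (1 - \<eta> * s)" .
  have "form (Suc k) x x = \<epsilon> * (x \<bullet> x) + \<eta> * (\<Sum>s<k. (G s \<bullet> x) * (G s \<bullet> x)) + \<eta> * (s * s)"
    by (subst form_eq) (auto simp: s_def algebra_simps)
  also have "\<dots> \<ge> \<eta> * (s * s)"
    using \<eta> \<epsilon> sq_nonneg[of x] by (simp add: sum_nonneg)
  finally have "\<eta> * s * s \<le> 1 * s" using s by (simp add: mult.assoc)
  moreover have "s \<ge> 0" using s form_nonneg by simp
  ultimately have "\<eta> * s \<le> 1" by (cases "s = 0") (auto simp: mult_le_cancel_right)
  moreover have "1 - \<eta> * s \<noteq> 0" using det det_nonzero[of k] by auto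
  ultimately have pos: "1 - \<eta> * s > 0" by simp
  then have "ln \<bar>det (A k)\<bar> = ln \<bar>det (A (Suc k))\<bar> + ln (1 - \<eta> * s)"
    unfolding det by (simp add: abs_mult ln_mult det_nonzero)
  moreover have "ln (1 - \<eta> * s) \<le> - (\<eta> * s)" using ln_le_minus_one[OF pos] by simp
  ultimately show ?thesis by (simp add: s_def x_def)
qed

lemma log_det_0: "ln \<bar>det (A 0)\<bar> \<ge> 0"
proof -
  have "A 0 = \<epsilon> \<cdot>\<^sub>m (1\<^sub>m m :: real mat)" by (rule eq_matI) (auto simp: ons_mat_def)
  then have "det (A 0) = \<epsilon> ^ m" by simp
  then show ?thesis using \<epsilon> by (simp add: one_le_power ln_ge_zero)
qed

lemma log_det_le:
  assumes M: "\<And>s i. s < k \<Longrightarrow> i < m \<Longrightarrow> \<bar>G s $ i\<bar> \<le> M"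
  shows "ln \<bar>det (A k)\<bar> \<le> real m * (ln (real m) + ln (\<epsilon> + \<eta> * real k * M\<^sup>2))"
proof (cases "m = 0")
  case True
  then have "A k \<in> carrier_mat 0 0" using ons_mat_carrier[of 0] by simp
  then show ?thesis using True by (simp add: det_dim_zero)
next
  case False
  define N where "N = \<epsilon> + \<eta> * real k * M\<^sup>2"
  have N: "N \<ge> 1" using \<epsilon> \<eta> by (simp add: N_def add_increasing2)
  have "\<bar>A k $$ (i, j)\<bar> \<le> N" if "i < m" "j < m" for i j
  proof -
    have "\<bar>\<Sum>s<k. G s $ i * G s $ j\<bar> \<le> (\<Sum>s<k. \<bar>G s $ i * G s $ j\<bar>)" by (rule sum_abs)
    also have "\<dots> \<le> (\<Sum>s<k. M\<^sup>2)"
    proof (rule sum_mono)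
      fix s assume "s \<in> {..<k}"
      then show "\<bar>G s $ i * G s $ j\<bar> \<le> M\<^sup>2"
        using abs_ge_zero[of "G s $ i"] mult_mono[OF M[of s i] M[of s j]] M[of s i] that
          by (auto simp: abs_mult power2_eq_square)
    qed
    finally have "\<eta> * \<bar>\<Sum>s<k. G s $ i * G s $ j\<bar> \<le> \<eta> * (real k * M\<^sup>2)"
      using \<eta> by (intro mult_left_mono) auto
    moreover have "\<bar>A k $$ (i, j)\<bar> \<le> \<epsilon> + \<eta> * \<bar>\<Sum>s<k. G s $ i * G s $ j\<bar>"
      unfolding ons_mat_index[OF that] using \<epsilon> \<eta>
      by (intro order_trans[OF abs_triangle_ineq]) (auto simp: abs_mult)
    ultimately show ?thesis by (simp add: N_def mult.assoc)
  qed
  then have "\<bar>det (A k)\<bar> \<le> fact m * N ^ m" by (intro abs_det_le) auto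
  also have "\<dots> \<le> real m ^ m * N ^ m"
    using N fact_le_power[of m, where 'a = real] by (intro mult_right_mono) auto
  finally have "ln \<bar>det (A k)\<bar> \<le> ln (real m ^ m * N ^ m)"
    using det_nonzero[of k] by (intro ln_mono) auto
  also have "\<dots> = real m * (ln (real m) + ln N)"
    using False N by (simp add: ln_mult ln_realpow algebra_simps)
  finally show ?thesis by (simp add: N_def)
qed

section \<open>The form as inner product: projection and regret\<close>

lemma form_add_right:
  assumes "x \<in> carrier_vec m" "y \<in> carrier_vec m" "z \<in> carrier_vec m"
  shows "form k x (y + z) = form k x y + form k x z"
  using assms unfolding form_def
  by (simp add: mult_add_distrib_mat_vec[of _ m m] scalar_prod_add_distrib[of _ m "A k *\<^sub>v y"])

lemma form_sym:
  assumes "x \<in> carrier_vec m" "y \<in> carrier_vec m"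
  shows "form k x y = form k y x"
  using assms by (simp add: form_eq comm_scalar_prod[of x m y] mult.commute)

lemma form_add_left:
  assumes "x \<in> carrier_vec m" "y \<in> carrier_vec m" "z \<in> carrier_vec m"
  shows "form k (y + z) x = form k y x + form k z x"
  using assms form_add_right[OF assms] by (simp add: form_sym[of _ x])

lemma form_smult:
  assumes "x \<in> carrier_vec m" "y \<in> carrier_vec m"
  shows "form k x (c \<cdot>\<^sub>v y) = c * form k x y"
  using assms unfolding form_def by (simp add: mult_mat_vec[of _ m m] scalar_prod_smult_distrib[of _ m "A k *\<^sub>v y"])

lemma form_smult_left:
  assumes "x \<in> carrier_vec m" "y \<in> carrier_vec m"
  shows "form k (c \<cdot>\<^sub>v y) x = c * form k y x"
  using assms form_smult[OF assms] by (simp add: form_sym[of _ x])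

lemma form_sq_add:
  assumes "x \<in> carrier_vec m" "y \<in> carrier_vec m"
  shows "form k (x + y) (x + y) = form k x x + 2 * form k x y + form k y y"
  using assms by (simp add: form_add_right form_add_left form_sym[of y x])

lemma mahalanobis: "mahalanobis_norm (A k) x = sqrt (form k x x)"
  by (simp add: mahalanobis_norm_def form_def)

text \<open>Minimality of \<open>v\<close> along the segment to \<open>w\<close>, divided by the
  step length and for small steps, excludes an acute angle at \<open>v\<close>; expanding the square
  around \<open>v\<close> then yields the bound.\<close>

lemma projection_contracts:
  assumes K: "K \<subseteq> carrier_vec m" and convex: "\<And>x y s. x \<in> K \<Longrightarrow> y \<in> K \<Longrightarrow> 0 < s \<Longrightarrow> s < 1 \<Longrightarrow> x + s \<cdot>\<^sub>v (y - x) \<in> K"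
    and v: "v \<in> K" "\<And>w. w \<in> K \<Longrightarrow> mahalanobis_norm (A k) (v - u) \<le> mahalanobis_norm (A k) (w - u)"
    and w: "w \<in> K" and u: "u \<in> carrier_vec m"
  shows "form k (v - w) (v - w) \<le> form k (u - w) (u - w)"
proof -
  have [simp]: "v \<in> carrier_vec m" "w \<in> carrier_vec m" "u \<in> carrier_vec m" using assms by auto
  then have [simp]: "dim_vec v = m" "dim_vec w = m" "dim_vec u = m" by (simp_all add: carrier_vecD)
  define a where "a = v - u"
  define b where "b = w - v"
  have [simp]: "a \<in> carrier_vec m" "b \<in> carrier_vec m" by (auto simp: a_def b_def)
  have ge: "- 2 * form k a b \<le> s * form k b b" if "0 < s" "s < 1" for s
  proof -
    have "v + s \<cdot>\<^sub>v (w - v) \<in> K" by (rule convex) (use assms that in auto)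
    then have "form k a a \<le> form k (v + s \<cdot>\<^sub>v (w - v) - u) (v + s \<cdot>\<^sub>v (w - v) - u)"
      using v(2) by (auto simp: mahalanobis a_def)
    also have "v + s \<cdot>\<^sub>v (w - v) - u = a + s \<cdot>\<^sub>v b"
      by (rule eq_vecI) (auto simp: a_def b_def)
    also have "form k (a + s \<cdot>\<^sub>v b) (a + s \<cdot>\<^sub>v b) = form k a a + 2 * s * form k a b + s * (s * form k b b)"
      by (simp add: form_sq_add form_smult form_smult_left)
    finally have "s * (- 2 * form k a b) \<le> s * (s * form k b b)" by simp
    with that show ?thesis by (simp only: mult_le_cancel_left_pos)
  qed
  have "form k a b \<ge> 0"
  proof (rule ccontr)
    assume neg: "\<not> ?thesis"
    have "form k b b \<ge> 0" by (rule form_nonneg) simp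
    define s where "s = min (1/2) (- form k a b / (form k b b + 1))"
    have s: "0 < s" "s < 1" "s \<le> - form k a b / (form k b b + 1)"
      using neg \<open>form k b b \<ge> 0\<close> by (simp_all add: s_def divide_less_0_iff)
    have "s * form k b b \<le> s * (form k b b + 1)" using s(1) by simp
    also have "\<dots> \<le> - form k a b / (form k b b + 1) * (form k b b + 1)"
      using s(3) \<open>form k b b \<ge> 0\<close> by (intro mult_right_mono) auto
    also have "\<dots> = - form k a b" using \<open>form k b b \<ge> 0\<close> by simp
    also have "\<dots> < - 2 * form k a b" using neg by simp
    finally show False using ge[OF s(1,2)] by simp
  qed
  moreover have "u - w = (-1) \<cdot>\<^sub>v a + (-1) \<cdot>\<^sub>v b"
    by (rule eq_vecI) (auto simp: a_def b_def)
  then have "form k (u - w) (u - w) = form k a a + 2 * form k a b + form k b b"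
    by (simp add: form_sq_add form_smult form_smult_left)
  moreover have "v - w = (-1) \<cdot>\<^sub>v b" by (rule eq_vecI) (auto simp: b_def)
  then have "form k (v - w) (v - w) = form k b b"
    by (simp add: form_smult form_smult_left)
  moreover have "form k a a \<ge> 0" by (rule form_nonneg) simp
  ultimately show ?thesis by simp
qed

text \<open>\<open>K\<close> may be unbounded, as the slabs of the experts are. The search is
  restricted to the sublevel set of one point of \<open>K\<close>, which is bounded because the form
  dominates the Euclidean one.\<close>

lemma projection_exists:
  assumes K: "K \<subseteq> carrier_vec m" "K \<noteq> {}" and u: "u \<in> carrier_vec m"
    and closed: "\<And>X l. (\<And>n. X n \<in> K) \<Longrightarrow> l \<in> carrier_vec m \<Longrightarrow>
      (\<And>i. i < m \<Longrightarrow> (\<lambda>n. X n $ i) \<longlonglongrightarrow> l $ i) \<Longrightarrow> l \<in> K"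
  shows "\<exists>v\<in>K. \<forall>w\<in>K. mahalanobis_norm (A k) (v - u) \<le> mahalanobis_norm (A k) (w - u)"
proof -
  define q where "q x = form k (Matrix.vec m x - u) (Matrix.vec m x - u)" for x :: "nat \<Rightarrow> real"
  obtain v0 where v0: "v0 \<in> K" using K by auto
  define c where "c = form k (v0 - u) (v0 - u)"
  define S where "S = {x. Matrix.vec m x \<in> K \<and> q x \<le> c \<and> (\<forall>i\<ge>m. x i = 0)}"
  have cont: "(\<lambda>n. q (X n)) \<longlonglongrightarrow> q l" if "\<And>i. (\<lambda>n. X n i) \<longlonglongrightarrow> l i" for X l
  proof -
    have q: "q x = \<epsilon> * (\<Sum>i<m. (x i - u $ i) * (x i - u $ i))
        + \<eta> * (\<Sum>s<k. (\<Sum>i<m. G s $ i * (x i - u $ i)) * (\<Sum>i<m. G s $ i * (x i - u $ i)))" for x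
      using u by (simp add: q_def form_eq) (simp add: scalar_prod_def atLeast0LessThan)
    show ?thesis unfolding q by (intro tendsto_intros that)
  qed
  have lift: "(\<lambda>i. if i < m then w $ i else 0) \<in> S \<and> Matrix.vec m (\<lambda>i. if i < m then w $ i else 0) = w"
    if "w \<in> K" "form k (w - u) (w - u) \<le> c" for w
  proof -
    have "w \<in> carrier_vec m" using K that by auto
    then have "Matrix.vec m (\<lambda>i. if i < m then w $ i else 0) = w" by (intro eq_vecI) auto
    then show ?thesis using that by (auto simp: S_def q_def)
  qed
  have "\<exists>x\<in>S. \<forall>y\<in>S. q x \<le> q y"
  proof (rule attains_min_finite[where I = "{..<m}" and z = "\<lambda>_. 0" and b = 0 and M = "\<lambda>i. \<bar>u $ i\<bar> + sqrt c"])
    show "S \<noteq> {}" using lift[OF v0] by (auto simp: c_def)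
    show "\<bar>x i\<bar> \<le> \<bar>u $ i\<bar> + sqrt c" if "x \<in> S" "i \<in> {..<m}" for x i
    proof -
      have "(x i - u $ i)\<^sup>2 \<le> (\<Sum>i<m. (x i - u $ i)\<^sup>2)"
        using that by (intro member_le_sum) auto
      also have "\<dots> = (Matrix.vec m x - u) \<bullet> (Matrix.vec m x - u)"
        using u by (simp add: scalar_prod_def atLeast0LessThan power2_eq_square)
      also have "\<dots> \<le> \<epsilon> * ((Matrix.vec m x - u) \<bullet> (Matrix.vec m x - u))"
        using \<epsilon> sq_nonneg mult_right_mono[of 1 \<epsilon>] by fastforce
      also have "\<dots> \<le> q x" unfolding q_def by (rule form_ge) (use u in auto)
      also have "\<dots> \<le> c" using that by (simp add: S_def)
      finally have "\<bar>x i - u $ i\<bar> \<le> sqrt c" by (rule real_le_rsqrt[of "\<bar>x i - u $ i\<bar>", simplified])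
      then show ?thesis by linarith
    qed
    show "l \<in> S" if X: "\<And>n. X n \<in> S" and l: "\<And>i. (\<lambda>n. X n i) \<longlonglongrightarrow> l i" for X l
    proof -
      have "Matrix.vec m l \<in> K"
        by (rule closed[of "\<lambda>n. Matrix.vec m (X n)"]) (use X l in \<open>auto simp: S_def\<close>)
      moreover have "q l \<le> c"
        by (rule LIMSEQ_le_const2[OF cont[OF l]]) (use X in \<open>auto simp: S_def\<close>)
      moreover have "l i = 0" if "i \<ge> m" for i
        using l[of i] X that by (auto simp: S_def LIMSEQ_const_iff)
      ultimately show ?thesis by (simp add: S_def)
    qed
    show "0 \<le> q x" for x unfolding q_def by (rule form_nonneg) (use u in auto)
  qed (use cont in \<open>auto simp: S_def\<close>)
  then obtain x where x: "x \<in> S" "\<And>y. y \<in> S \<Longrightarrow> q x \<le> q y" by blast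
  have "form k (Matrix.vec m x - u) (Matrix.vec m x - u) \<le> form k (w - u) (w - u)" if "w \<in> K" for w
  proof (cases "form k (w - u) (w - u) \<le> c")
    case True
    from lift[OF that this] x(2) show ?thesis by (fastforce simp: q_def)
  qed (use x(1) in \<open>simp add: S_def q_def\<close>)
  then show ?thesis using x(1)
    by (intro bexI[of _ "Matrix.vec m x"]) (auto simp: S_def mahalanobis)
qed

text \<open>When the square after the Newton step is expanded, \<open>A (Suc k)\<close> cancels its
  inverse and the cross term becomes \<open>G k \<bullet> (v - w)\<close>; the rank one difference
  of consecutive forms supplies the quadratic term.\<close>

lemma ons_step:
  assumes [simp]: "v \<in> carrier_vec m" "w \<in> carrier_vec m"
    and v': "form (Suc k) (v' - w) (v' - w) \<le> form (Suc k) (u - w) (u - w)"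
    and u: "u = v - B (Suc k) *\<^sub>v G k"
  shows "2 * (G k \<bullet> (v - w)) - \<eta> * (G k \<bullet> (v - w))\<^sup>2 \<le>
    form k (v - w) (v - w) - form (Suc k) (v' - w) (v' - w) + G k \<bullet> (B (Suc k) *\<^sub>v G k)"
proof -
  define x where "x = B (Suc k) *\<^sub>v G k"
  define z where "z = v - w"
  have [simp]: "x \<in> carrier_vec m" "z \<in> carrier_vec m" by (auto simp: x_def z_def)
  have Ax: "A (Suc k) *\<^sub>v x = G k" unfolding x_def by (rule A_B) simp
  have [simp]: "dim_vec v = m" "dim_vec w = m" "dim_vec x = m" using assms(1,2) \<open>x \<in> _\<close> by (simp_all add: carrier_vecD)
  have "u - w = z + (-1) \<cdot>\<^sub>v x"
    unfolding u x_def[symmetric] by (intro eq_vecI) (auto simp: z_def)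
  then have "form (Suc k) (u - w) (u - w) = form (Suc k) z z - 2 * form (Suc k) z x + form (Suc k) x x"
    by (simp add: form_sq_add form_smult form_smult_left)
  also have "form (Suc k) z x = G k \<bullet> z"
    using comm_scalar_prod[of z m "G k"] by (simp add: form_def Ax)
  also have "form (Suc k) x x = G k \<bullet> x"
    using comm_scalar_prod[of x m "G k"] by (simp add: form_def Ax)
  also have "form (Suc k) z z = form k z z + \<eta> * (G k \<bullet> z)\<^sup>2"
    by (simp add: form_eq power2_eq_square algebra_simps)
  finally show ?thesis using v' by (simp add: z_def x_def)
qed

lemma ons_regret:
  assumes v: "\<And>s. s < M \<Longrightarrow> v s \<in> carrier_vec m" and w: "w \<in> carrier_vec m" and v0: "v 0 = 0\<^sub>v m"
    and proj: "\<And>s. Suc s < M \<Longrightarrow> form (Suc s) (v (Suc s) - w) (v (Suc s) - w) \<le>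
      form (Suc s) (v s - B (Suc s) *\<^sub>v G s - w) (v s - B (Suc s) *\<^sub>v G s - w)"
  shows "(\<Sum>s<M. 2 * (G s \<bullet> (v s - w)) - \<eta> * (G s \<bullet> (v s - w))\<^sup>2) \<le>
    \<epsilon> * (w \<bullet> w) + ln \<bar>det (A M)\<bar> / \<eta>"
proof -
  \<comment> \<open>The telescoping potential is taken before projection, so that nothing is asked
    about a projection after the last round.\<close>
  define U where "U s = (case s of 0 \<Rightarrow> v 0 | Suc s \<Rightarrow> v s - B (Suc s) *\<^sub>v G s)" for s
  have *: "(\<Sum>s<k. 2 * (G s \<bullet> (v s - w)) - \<eta> * (G s \<bullet> (v s - w))\<^sup>2) \<le>
    form 0 (v 0 - w) (v 0 - w) - form k (U k - w) (U k - w)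
    + (ln \<bar>det (A k)\<bar> - ln \<bar>det (A 0)\<bar>) / \<eta>" if "k \<le> M" for k
    using that
  proof (induction k)
    case 0
    then show ?case by (simp add: U_def)
  next
    case (Suc k)
    have "form k (v k - w) (v k - w) \<le> form k (U k - w) (U k - w)"
      using proj[of "k - 1"] Suc.prems by (cases k) (auto simp: U_def)
    moreover have "2 * (G k \<bullet> (v k - w)) - \<eta> * (G k \<bullet> (v k - w))\<^sup>2 \<le>
      form k (v k - w) (v k - w) - form (Suc k) (U (Suc k) - w) (U (Suc k) - w) + G k \<bullet> (B (Suc k) *\<^sub>v G k)"
      by (rule ons_step) (use v w Suc.prems in \<open>auto simp: U_def\<close>)
    moreover have "G k \<bullet> (B (Suc k) *\<^sub>v G k) \<le> (ln \<bar>det (A (Suc k))\<bar> - ln \<bar>det (A k)\<bar>) / \<eta>"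
      using increment_le_log_det[of k] \<eta> by (simp add: pos_le_divide_eq mult.commute)
    ultimately show ?case using Suc by (simp add: diff_divide_distrib)
  qed
  have "v 0 - w = (-1) \<cdot>\<^sub>v w" using w by (intro eq_vecI) (auto simp: v0)
  then have "form 0 (v 0 - w) (v 0 - w) = \<epsilon> * (w \<bullet> w)"
    using w by (simp add: form_smult form_smult_left) (simp add: form_eq)
  moreover have "form M (U M - w) (U M - w) \<ge> 0"
  proof (cases M)
    case 0
    then show ?thesis using w by (intro form_nonneg) (auto simp: U_def v0)
  next
    case (Suc k)
    then show ?thesis using v[of k] w by (intro form_nonneg) (auto simp: U_def)
  qed
  moreover have "(ln \<bar>det (A M)\<bar> - ln \<bar>det (A 0)\<bar>) / \<eta> \<le> ln \<bar>det (A M)\<bar> / \<eta>"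
    using log_det_0 \<eta> by (simp add: divide_right_mono)
  ultimately show ?thesis using *[of M] by simp
qed

end

subsection \<open>Gradients\<close>

lemma l2_norm_nonneg [simp]: "l2_norm v \<ge> 0"
  unfolding l2_norm_def scalar_prod_def by (auto intro!: sum_nonneg)

lemma l2_norm_sq: "(l2_norm v)\<^sup>2 = v \<bullet> v"
  unfolding l2_norm_def scalar_prod_def by (auto intro!: real_sqrt_pow2 sum_nonneg)

lemma l2_norm_smult: "l2_norm (s \<cdot>\<^sub>v v) = \<bar>s\<bar> * l2_norm v"
proof -
  have "(s \<cdot>\<^sub>v v) \<bullet> (s \<cdot>\<^sub>v v) = s\<^sup>2 * (v \<bullet> v)"
    by (simp add: scalar_prod_def sum_distrib_left power2_eq_square algebra_simps)
  then show ?thesis by (simp add: l2_norm_def real_sqrt_mult)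
qed

lemma l2_norm_le_l1: "l2_norm v \<le> l1_norm v"
proof -
  have "v \<bullet> v = (\<Sum>i<dim_vec v. \<bar>v $ i\<bar>\<^sup>2)"
    by (simp add: scalar_prod_def atLeast0LessThan power2_eq_square)
  also have "(\<Sum>i\<in>I. \<bar>v $ i\<bar>\<^sup>2) \<le> (\<Sum>i\<in>I. \<bar>v $ i\<bar>)\<^sup>2" if "finite I" for I
    using that
  proof induction
    case (insert j I)
    have "0 \<le> 2 * \<bar>v $ j\<bar> * (\<Sum>i\<in>I. \<bar>v $ i\<bar>)" by (auto intro!: sum_nonneg mult_nonneg_nonneg)
    moreover have "(\<Sum>i\<in>insert j I. \<bar>v $ i\<bar>)\<^sup>2 = \<bar>v $ j\<bar>\<^sup>2 + (\<Sum>i\<in>I. \<bar>v $ i\<bar>)\<^sup>2 + 2 * \<bar>v $ j\<bar> * (\<Sum>i\<in>I. \<bar>v $ i\<bar>)"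
      using insert by (simp add: power2_sum)
    ultimately show ?case using insert.IH unfolding sum.insert[OF insert.hyps] by linarith
  qed simp
  finally show ?thesis unfolding l2_norm_def l1_norm_def
    by (intro real_le_lsqrt) (auto intro: sum_nonneg)
qed

lemma scalar_prod_eq_sum: "dim_vec y = m \<Longrightarrow> x \<bullet> y = (\<Sum>i<m. x $ i * y $ i)"
  by (simp add: scalar_prod_def atLeast0LessThan)

lemma scalar_prod_le_l2_norm:
  assumes "x \<in> carrier_vec m" "y \<in> carrier_vec m"
  shows "x \<bullet> y \<le> l2_norm x * l2_norm y"
proof -
  have dims: "dim_vec x = m" "dim_vec y = m" using assms by auto
  have "(x \<bullet> y)\<^sup>2 \<le> (x \<bullet> x) * (y \<bullet> y)"
  proof -
    have q: "0 \<le> (x \<bullet> x) - 2 * s * (x \<bullet> y) + s\<^sup>2 * (y \<bullet> y)" for s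
    proof -
      have "(x \<bullet> x) - 2 * s * (x \<bullet> y) + s\<^sup>2 * (y \<bullet> y) = (\<Sum>i<m. (x $ i - s * y $ i)\<^sup>2)"
        by (simp add: scalar_prod_eq_sum[OF dims(1)] scalar_prod_eq_sum[OF dims(2)] sum_distrib_left
            power2_eq_square algebra_simps sum.distrib sum_subtractf)
      also have "\<dots> \<ge> 0" by (auto intro: sum_nonneg)
      finally show ?thesis .
    qed
    show ?thesis
    proof (cases "y \<bullet> y = 0")
      case True
      then have "\<forall>i<m. y $ i = 0"
        by (simp add: scalar_prod_eq_sum[OF dims(2)] sum_nonneg_eq_0_iff)
      then have "x \<bullet> y = 0" by (simp add: scalar_prod_eq_sum[OF dims(2)])
      then show ?thesis by (simp add: True)
    next
      case False
      moreover have "y \<bullet> y \<ge> 0" using l2_norm_sq[of y] by (metis zero_le_power2)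
      ultimately have "y \<bullet> y > 0" by simp
      with q[of "(x \<bullet> y) / (y \<bullet> y)"] show ?thesis
        by (simp add: power2_eq_square field_simps)
    qed
  qed
  then have "\<bar>x \<bullet> y\<bar> \<le> sqrt ((x \<bullet> x) * (y \<bullet> y))" by (intro real_le_rsqrt) simp
  then show ?thesis by (simp add: l2_norm_def real_sqrt_mult)
qed

lemma has_gradient_direction:
  assumes g: "has_gradient m f x g" and z: "z \<in> carrier_vec m" and "e > 0"
  shows "\<exists>s0>0. \<forall>s. 0 < s \<and> s < s0 \<longrightarrow> \<bar>f (x + s \<cdot>\<^sub>v z) - f x - s * (g \<bullet> z)\<bar> \<le> e * s"
proof -
  define c where "c = l2_norm z + 1"
  have c: "c > 0" "l2_norm z \<le> c" unfolding c_def by (smt (verit) l2_norm_nonneg)+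
  have x: "x \<in> carrier_vec m" "g \<in> carrier_vec m" using g by (auto simp: has_gradient_def)
  obtain \<delta> where \<delta>: "\<delta> > 0" "\<And>y. y \<in> carrier_vec m \<Longrightarrow> l2_norm (y - x) < \<delta> \<Longrightarrow>
      \<bar>f y - f x - g \<bullet> (y - x)\<bar> \<le> e / c * l2_norm (y - x)"
    using g \<open>e > 0\<close> c unfolding has_gradient_def by (metis divide_pos_pos)
  show ?thesis
  proof (intro exI[of _ "\<delta> / c"] conjI allI impI)
    show "0 < \<delta> / c" using \<delta> c by simp
    fix s assume s: "0 < s \<and> s < \<delta> / c"
    have yx: "x + s \<cdot>\<^sub>v z - x = s \<cdot>\<^sub>v z" using x z by (intro eq_vecI) auto
    have n: "l2_norm (s \<cdot>\<^sub>v z) \<le> s * c" using s c by (simp add: l2_norm_smult)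
    moreover have "s * c < \<delta>" using s c by (simp add: pos_less_divide_eq)
    ultimately have "\<bar>f (x + s \<cdot>\<^sub>v z) - f x - g \<bullet> (s \<cdot>\<^sub>v z)\<bar> \<le> e / c * l2_norm (s \<cdot>\<^sub>v z)"
      using \<delta>(2)[of "x + s \<cdot>\<^sub>v z"] x z by (simp add: yx)
    also have "\<dots> \<le> e / c * (s * c)" using n \<open>e > 0\<close> c by (intro mult_left_mono) auto
    finally show "\<bar>f (x + s \<cdot>\<^sub>v z) - f x - s * (g \<bullet> z)\<bar> \<le> e * s"
      using c x z by (simp add: scalar_prod_smult_distrib[of g m])
  qed
qed

text \<open>Only steps \<open>s > 0\<close> occur, so the estimate applies at boundary points of the
  cube along inward directions.\<close>

lemma has_gradient_direction_le:
  assumes g: "has_gradient m f x g" and z: "z \<in> carrier_vec m" and "s1 > 0"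
    and le: "\<And>s. 0 < s \<Longrightarrow> s < s1 \<Longrightarrow> \<bar>f (x + s \<cdot>\<^sub>v z) - f x - s * a\<bar> \<le> L * s"
  shows "\<bar>g \<bullet> z - a\<bar> \<le> L"
proof (rule field_le_epsilon)
  fix e :: real assume "e > 0"
  from has_gradient_direction[OF g z this] obtain s0 where s0: "s0 > 0"
    "\<And>s. 0 < s \<Longrightarrow> s < s0 \<Longrightarrow> \<bar>f (x + s \<cdot>\<^sub>v z) - f x - s * (g \<bullet> z)\<bar> \<le> e * s" by blast
  define s where "s = min s0 s1 / 2"
  have s: "0 < s" "s < s0" "s < s1" using s0 \<open>s1 > 0\<close> by (auto simp: s_def)
  have "s * \<bar>g \<bullet> z - a\<bar> = \<bar>s * (g \<bullet> z) - s * a\<bar>"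
    using s(1) by (simp flip: right_diff_distrib add: abs_mult)
  also have "\<dots> \<le> e * s + L * s"
    using s0(2)[OF s(1,2)] le[OF s(1,3)] by linarith
  finally have "s * \<bar>g \<bullet> z - a\<bar> \<le> s * (L + e)" by (simp add: algebra_simps)
  then show "\<bar>g \<bullet> z - a\<bar> \<le> L + e" using s(1) by simp
qed

lemma has_gradient_unique:
  assumes g: "has_gradient m f x g" and g': "has_gradient m f x g'"
  shows "g = g'"
proof -
  have "g \<bullet> z = g' \<bullet> z" if z: "z \<in> carrier_vec m" for z
  proof -
    have "\<bar>g \<bullet> z - g' \<bullet> z\<bar> \<le> 0 + e" if "e > 0" for e
    proof -
      from has_gradient_direction[OF g' z that] obtain s1 where "s1 > 0"
        "\<And>s. 0 < s \<Longrightarrow> s < s1 \<Longrightarrow> \<bar>f (x + s \<cdot>\<^sub>v z) - f x - s * (g' \<bullet> z)\<bar> \<le> e * s" by blast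
      from has_gradient_direction_le[OF g z this] show ?thesis by simp
    qed
    then have "\<bar>g \<bullet> z - g' \<bullet> z\<bar> \<le> 0" by (rule field_le_epsilon)
    then show ?thesis by simp
  qed
  moreover have "g \<in> carrier_vec m" "g' \<in> carrier_vec m" using g g' by (auto simp: has_gradient_def)
  ultimately show ?thesis
    by (intro eq_vecI) (metis carrier_vecD scalar_prod_right_unit unit_vec_carrier, auto)
qed

lemma gradient_eqI: "has_gradient m f x g \<Longrightarrow> gradient m f x = g"
  unfolding gradient_def by (rule the_equality) (auto intro: has_gradient_unique)

lemma gradient_coord_le_1:
  assumes g: "has_gradient d f x g" and x: "x \<in> cube d r" and "r > 0"
    and lip: "l2_lipschitz_on 1 (cube d r) f" and k: "k < d"
  shows "\<bar>g $ k\<bar> \<le> 1"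
proof -
  \<comment> \<open>Moving towards 0 in coordinate \<open>k\<close> stays in the cube for steps
    below \<open>r\<close>, and only there is the Lipschitz bound available.\<close>
  define \<sigma> :: real where "\<sigma> = (if x $ k \<ge> 0 then -1 else 1)"
  define z where "z = \<sigma> \<cdot>\<^sub>v unit_vec d k"
  have xc: "x \<in> carrier_vec d" "g \<in> carrier_vec d" using x g by (auto simp: cube_def has_gradient_def)
  have zc: "z \<in> carrier_vec d" by (simp add: z_def)
  have "\<bar>g \<bullet> z - 0\<bar> \<le> 1"
  proof (rule has_gradient_direction_le[OF g zc \<open>r > 0\<close>])
    fix s assume s: "0 < s" "s < r"
    have "x + s \<cdot>\<^sub>v z \<in> cube d r"
      using x s k by (auto simp: cube_def z_def \<sigma>_def)
    moreover have "x + s \<cdot>\<^sub>v z - x = s \<cdot>\<^sub>v z" using xc zc by (intro eq_vecI) auto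
    ultimately have "\<bar>f (x + s \<cdot>\<^sub>v z) - f x\<bar> \<le> 1 * l2_norm (s \<cdot>\<^sub>v z)"
      using lip x unfolding l2_lipschitz_on_def by metis
    also have "l2_norm z = 1"
      using k by (simp add: z_def l2_norm_smult \<sigma>_def) (simp add: l2_norm_def)
    then have "1 * l2_norm (s \<cdot>\<^sub>v z) = 1 * s" using s by (simp add: l2_norm_smult)
    finally show "\<bar>f (x + s \<cdot>\<^sub>v z) - f x - s * 0\<bar> \<le> 1 * s" by simp
  qed
  moreover have "g \<bullet> z = \<sigma> * g $ k"
    using xc k by (simp add: z_def scalar_prod_smult_distrib[of g d])
  ultimately show ?thesis by (auto simp: \<sigma>_def split: if_splits)
qed

lemma admissible_has_gradient:
  assumes "admissible_loss d \<sigma> f" "x \<in> cube d 20"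
  shows "has_gradient d f x (gradient d f x)"
  using assms gradient_eqI unfolding admissible_loss_def gradient_lipschitz_on_def by metis

text \<open>Convexity, in the form of the lower bound at \<open>y\<close>, replaces integration along the segment.\<close>

lemma admissible_smooth:
  assumes f: "admissible_loss d \<sigma> f" and "\<sigma> > 0" and x: "x \<in> cube d 20" and y: "y \<in> cube d 20"
  shows "f y \<le> f x + gradient d f x \<bullet> (y - x) + (l2_norm (y - x))\<^sup>2"
proof -
  have c: "x \<in> carrier_vec d" "y \<in> carrier_vec d" using x y by (auto simp: cube_def)
  have gx: "gradient d f x \<in> carrier_vec d" and gy: "gradient d f y \<in> carrier_vec d"
    using admissible_has_gradient[OF f] x y by (auto simp: has_gradient_def)
  have "f x \<ge> f y + gradient d f y \<bullet> (x - y) + \<sigma> / 2 * (gradient d f y \<bullet> (x - y))\<^sup>2"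
    using f x y by (auto simp: admissible_loss_def exp_concave_lower_bound_on_def)
  moreover have "\<sigma> / 2 * (gradient d f y \<bullet> (x - y))\<^sup>2 \<ge> 0" using \<open>\<sigma> > 0\<close> by simp
  moreover have "gradient d f y \<bullet> (x - y) = - (gradient d f y \<bullet> (y - x))"
    using c gy by (simp add: scalar_prod_minus_distrib[of _ d])
  moreover have "(gradient d f y - gradient d f x) \<bullet> (y - x) \<le>
      l2_norm (gradient d f y - gradient d f x) * l2_norm (y - x)"
    by (rule scalar_prod_le_l2_norm[of _ d]) (use c gx gy in auto)
  moreover have "l2_norm (gradient d f y - gradient d f x) \<le> 1 * l2_norm (y - x)"
    using f x y unfolding admissible_loss_def gradient_lipschitz_on_def by blast
  then have "l2_norm (gradient d f y - gradient d f x) * l2_norm (y - x) \<le> (l2_norm (y - x))\<^sup>2"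
    unfolding power2_eq_square by (intro mult_right_mono) auto
  moreover have "(gradient d f y - gradient d f x) \<bullet> (y - x) =
      gradient d f y \<bullet> (y - x) - gradient d f x \<bullet> (y - x)"
    using c gx gy by (simp add: minus_scalar_prod_distrib[of _ d])
  ultimately show ?thesis by linarith
qed

subsection \<open>Lifted losses\<close>

lemma sum_pairs:
  fixes h :: "nat \<Rightarrow> 'b::comm_monoid_add"
  shows "(\<Sum>i<2 * d. h i) = (\<Sum>k<d. h (2 * k) + h (2 * k + 1))"
  by (induction d) (simp_all add: ac_simps)

lemma readout_carrier [simp]: "readout d j t v \<in> carrier_vec d"
  by (simp add: readout_def)

lemma readout_dim [simp]: "dim_vec (readout d j t v) = d"
  by (simp add: readout_def)

lemma readout_index:
  "k < d \<Longrightarrow> readout d j t v $ k = v $ (2 * k) + (real t - real j + 1) * v $ (2 * k + 1)"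
  by (simp add: readout_def covariate_def block_def scalar_prod_def vec_of_list_index numeral_2_eq_2)

lemma covariate_block:
  "covariate j t \<bullet> block v k = v $ (2 * k) + (real t - real j + 1) * v $ (2 * k + 1)"
  by (simp add: covariate_def block_def scalar_prod_def vec_of_list_index numeral_2_eq_2)

lemma sions_domain_iff:
  "w \<in> sions_domain d C j t \<longleftrightarrow> w \<in> carrier_vec (2 * d) \<and> readout d j t w \<in> cube d C"
  by (auto simp: sions_domain_def cube_def covariate_block readout_index abs_le_iff)

text \<open>The adjoint of the linear map \<open>readout d j t\<close>; by the chain rule it sends
  gradients of a loss to gradients of the lifted loss.\<close>

definition lift_vec :: "nat \<Rightarrow> nat \<Rightarrow> nat \<Rightarrow> real Matrix.vec \<Rightarrow> real Matrix.vec" where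
  "lift_vec d j t g = Matrix.vec (2 * d)
     (\<lambda>i. g $ (i div 2) * (if even i then 1 else real t - real j + 1))"

lemma lift_vec_carrier [simp]: "lift_vec d j t g \<in> carrier_vec (2 * d)"
  by (simp add: lift_vec_def)

lemma lift_vec_adjoint:
  assumes "v \<in> carrier_vec (2 * d)"
  shows "lift_vec d j t g \<bullet> v = g \<bullet> readout d j t v"
proof -
  have "lift_vec d j t g \<bullet> v = (\<Sum>i<2 * d. lift_vec d j t g $ i * v $ i)"
    using assms by (intro scalar_prod_eq_sum) auto
  also have "\<dots> = (\<Sum>k<d. g $ k * readout d j t v $ k)"
    unfolding sum_pairs by (intro sum.cong refl) (auto simp: lift_vec_def readout_index algebra_simps)
  also have "\<dots> = g \<bullet> readout d j t v"
    by (rule scalar_prod_eq_sum[symmetric]) (simp add: readout_def)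
  finally show ?thesis .
qed

lemma readout_diff:
  "v \<in> carrier_vec (2 * d) \<Longrightarrow> w \<in> carrier_vec (2 * d) \<Longrightarrow>
    readout d j t (v - w) = readout d j t v - readout d j t w"
  by (intro eq_vecI) (auto simp: readout_index right_diff_distrib)

lemma l2_norm_readout_le:
  assumes v: "v \<in> carrier_vec (2 * d)"
  shows "l2_norm (readout d j t v) \<le> (1 + \<bar>real t - real j + 1\<bar>) * l2_norm v"
proof -
  define \<tau> where "\<tau> = real t - real j + 1"
  have "(l2_norm (readout d j t v))\<^sup>2 = (\<Sum>k<d. (v $ (2 * k) + \<tau> * v $ (2 * k + 1))\<^sup>2)"
    unfolding l2_norm_sq by (subst scalar_prod_eq_sum[of _ d]) (auto simp: readout_index power2_eq_square \<tau>_def)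
  also have "\<dots> \<le> (\<Sum>k<d. (1 + \<tau>\<^sup>2) * ((v $ (2 * k))\<^sup>2 + (v $ (2 * k + 1))\<^sup>2))"
  proof (rule sum_mono)
    fix k
    define a where "a = v $ (2 * k)"
    define b where "b = v $ (2 * k + 1)"
    have "(1 + \<tau>\<^sup>2) * (a\<^sup>2 + b\<^sup>2) - (a + \<tau> * b)\<^sup>2 = (\<tau> * a - b)\<^sup>2"
      by (simp add: power2_eq_square algebra_simps)
    then have "(a + \<tau> * b)\<^sup>2 \<le> (1 + \<tau>\<^sup>2) * (a\<^sup>2 + b\<^sup>2)"
      using zero_le_power2[of "\<tau> * a - b"] by linarith
    then show "(v $ (2 * k) + \<tau> * v $ (2 * k + 1))\<^sup>2 \<le> (1 + \<tau>\<^sup>2) * ((v $ (2 * k))\<^sup>2 + (v $ (2 * k + 1))\<^sup>2)"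
      by (simp add: a_def b_def)
  qed
  also have "\<dots> = (1 + \<tau>\<^sup>2) * (\<Sum>i<2 * d. (v $ i)\<^sup>2)"
    unfolding sum_pairs by (simp add: sum_distrib_left)
  also have "(\<Sum>i<2 * d. (v $ i)\<^sup>2) = (l2_norm v)\<^sup>2"
    unfolding l2_norm_sq using v by (subst scalar_prod_eq_sum[of _ "2 * d"]) (auto simp: power2_eq_square)
  also have "(1 + \<tau>\<^sup>2) * (l2_norm v)\<^sup>2 \<le> (1 + \<bar>\<tau>\<bar>)\<^sup>2 * (l2_norm v)\<^sup>2"
    by (intro mult_right_mono) (auto simp: power2_eq_square algebra_simps)
  finally have "(l2_norm (readout d j t v))\<^sup>2 \<le> ((1 + \<bar>\<tau>\<bar>) * l2_norm v)\<^sup>2"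
    by (simp add: power_mult_distrib)
  then show ?thesis unfolding \<tau>_def by (rule power2_le_imp_le) simp
qed

lemma has_gradient_lifted:
  assumes g: "has_gradient d (f t) (readout d j t v) g" and v: "v \<in> carrier_vec (2 * d)"
  shows "has_gradient (2 * d) (lifted_loss d f j t) v (lift_vec d j t g)"
  unfolding has_gradient_def
proof (intro conjI allI impI)
  fix e :: real assume "e > 0"
  define c where "c = 1 + \<bar>real t - real j + 1\<bar>"
  have c: "c > 0" by (simp add: c_def)
  then obtain \<delta> where \<delta>: "\<delta> > 0" "\<And>y. y \<in> carrier_vec d \<Longrightarrow> l2_norm (y - readout d j t v) < \<delta> \<Longrightarrow>
      \<bar>f t y - f t (readout d j t v) - g \<bullet> (y - readout d j t v)\<bar> \<le> e / c * l2_norm (y - readout d j t v)"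
    using g \<open>e > 0\<close> unfolding has_gradient_def by (metis divide_pos_pos)
  show "\<exists>\<delta>>0. \<forall>y\<in>carrier_vec (2 * d). l2_norm (y - v) < \<delta> \<longrightarrow>
      \<bar>lifted_loss d f j t y - lifted_loss d f j t v - lift_vec d j t g \<bullet> (y - v)\<bar> \<le> e * l2_norm (y - v)"
  proof (intro exI[of _ "\<delta> / c"] conjI ballI impI)
    show "0 < \<delta> / c" using \<delta> c by simp
    fix y assume y: "y \<in> carrier_vec (2 * d)" and "l2_norm (y - v) < \<delta> / c"
    then have "c * l2_norm (y - v) < \<delta>" using c by (simp add: pos_less_divide_eq mult.commute)
    moreover have n: "l2_norm (readout d j t y - readout d j t v) \<le> c * l2_norm (y - v)"
      using l2_norm_readout_le[of "y - v" d j t] y v by (simp add: readout_diff c_def)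
    ultimately have "\<bar>f t (readout d j t y) - f t (readout d j t v) - g \<bullet> (readout d j t y - readout d j t v)\<bar>
        \<le> e / c * l2_norm (readout d j t y - readout d j t v)"
      by (intro \<delta>(2)) auto
    also have "\<dots> \<le> e / c * (c * l2_norm (y - v))"
      using n \<open>e > 0\<close> c by (intro mult_left_mono) auto
    finally show "\<bar>lifted_loss d f j t y - lifted_loss d f j t v - lift_vec d j t g \<bullet> (y - v)\<bar> \<le> e * l2_norm (y - v)"
      using y v c by (simp add: lifted_loss_def lift_vec_adjoint readout_diff)
  qed
qed (use v in auto)

subsection \<open>Regret of one expert\<close>

lemma arg_min_on_attained:
  fixes f :: "'a \<Rightarrow> real"
  assumes "\<exists>v\<in>S. \<forall>w\<in>S. f v \<le> f w"
  shows "arg_min_on f S \<in> S" "w \<in> S \<Longrightarrow> f (arg_min_on f S) \<le> f w"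
proof -
  have "is_arg_min f (\<lambda>x. x \<in> S) (arg_min_on f S)"
    unfolding arg_min_on_def arg_min_def using assms
    by (intro someI_ex[of "is_arg_min f (\<lambda>x. x \<in> S)"]) (auto simp: is_arg_min_linorder)
  then show "arg_min_on f S \<in> S" "w \<in> S \<Longrightarrow> f (arg_min_on f S) \<le> f w"
    by (auto simp: is_arg_min_linorder)
qed

lemma sions_domain_convex:
  assumes "x \<in> sions_domain d C j t" "y \<in> sions_domain d C j t" "0 < s" "s < 1"
  shows "x + s \<cdot>\<^sub>v (y - x) \<in> sions_domain d C j t"
proof -
  have c: "x \<in> carrier_vec (2 * d)" "y \<in> carrier_vec (2 * d)" using assms by (auto simp: sions_domain_def)
  have "\<bar>covariate j t \<bullet> block (x + s \<cdot>\<^sub>v (y - x)) k\<bar> \<le> C" if "k < d" for k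
  proof -
    have "covariate j t \<bullet> block (x + s \<cdot>\<^sub>v (y - x)) k =
        (1 - s) * (covariate j t \<bullet> block x k) + s * (covariate j t \<bullet> block y k)"
      using c that by (simp add: covariate_block algebra_simps)
    also have "\<bar>\<dots>\<bar> \<le> (1 - s) * \<bar>covariate j t \<bullet> block x k\<bar> + s * \<bar>covariate j t \<bullet> block y k\<bar>"
      using assms(3,4) by (intro order_trans[OF abs_triangle_ineq]) (simp add: abs_mult)
    also have "\<dots> \<le> (1 - s) * C + s * C"
      using assms that by (intro add_mono mult_left_mono) (auto simp: sions_domain_def)
    finally show ?thesis by (simp add: algebra_simps)
  qed
  with c show ?thesis by (simp add: sions_domain_def)
qed

lemma sions_domain_closed:
  assumes X: "\<And>n. X n \<in> sions_domain d C j t" and l: "l \<in> carrier_vec (2 * d)"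
    and lim: "\<And>i. i < 2 * d \<Longrightarrow> (\<lambda>n. X n $ i) \<longlonglongrightarrow> l $ i"
  shows "l \<in> sions_domain d C j t"
proof -
  have "\<bar>covariate j t \<bullet> block l k\<bar> \<le> C" if k: "k < d" for k
  proof (rule LIMSEQ_le_const2)
    show "(\<lambda>n. \<bar>covariate j t \<bullet> block (X n) k\<bar>) \<longlonglongrightarrow> \<bar>covariate j t \<bullet> block l k\<bar>"
      unfolding covariate_block by (intro tendsto_intros lim) (use k in auto)
    show "\<exists>N. \<forall>n\<ge>N. \<bar>covariate j t \<bullet> block (X n) k\<bar> \<le> C"
      using X k by (auto simp: sions_domain_def)
  qed
  with l show ?thesis by (simp add: sions_domain_def)
qed

lemma zero_in_sions_domain: "C \<ge> 0 \<Longrightarrow> 0\<^sub>v (2 * d) \<in> sions_domain d C j t"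
  by (auto simp: sions_domain_def covariate_block)

context
  fixes d n j :: nat and \<sigma> :: real and f :: "nat \<Rightarrow> real Matrix.vec \<Rightarrow> real"
  assumes \<sigma>: "\<sigma> > 0" and j: "1 \<le> j" and f: "\<And>t. t \<in> {1..n} \<Longrightarrow> admissible_loss d \<sigma> (f t)"
begin

abbreviation "iter \<equiv> sions_iterate d 2 \<sigma> 20 f j"

text \<open>Outside the horizon the gradients are replaced by zero, so that no junk value enters.\<close>

definition expert_gradient :: "nat \<Rightarrow> real Matrix.vec" where
  "expert_gradient s = (if j + s \<le> n \<and> iter s \<in> sions_domain d 20 j (j + s)
     then lift_vec d j (j + s) (gradient d (f (j + s)) (readout d j (j + s) (iter s))) else 0\<^sub>v (2 * d))"

lemma ons_expert: "ons (2 * d) 2 \<sigma> expert_gradient"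
  by unfold_locales (use \<sigma> in \<open>auto simp: expert_gradient_def\<close>)

lemma expert_gradient_eq:
  assumes "j + s \<le> n" "iter s \<in> sions_domain d 20 j (j + s)"
  shows "gradient (2 * d) (lifted_loss d f j (j + s)) (iter s) = expert_gradient s"
proof -
  have "has_gradient d (f (j + s)) (readout d j (j + s) (iter s))
      (gradient d (f (j + s)) (readout d j (j + s) (iter s)))"
    using f[of "j + s"] j assms by (intro admissible_has_gradient[where \<sigma> = \<sigma>]) (auto simp: sions_domain_iff)
  then have "has_gradient (2 * d) (lifted_loss d f j (j + s)) (iter s)
      (lift_vec d j (j + s) (gradient d (f (j + s)) (readout d j (j + s) (iter s))))"
    using assms by (intro has_gradient_lifted) (auto simp: sions_domain_iff)
  from gradient_eqI[OF this] show ?thesis using assms by (simp add: expert_gradient_def)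
qed

lemma expert_gradient_le:
  assumes s: "j + s \<le> n" "i < 2 * d"
  shows "\<bar>expert_gradient s $ i\<bar> \<le> real n"
proof (cases "iter s \<in> sions_domain d 20 j (j + s)")
  case True
  define g where "g = gradient d (f (j + s)) (readout d j (j + s) (iter s))"
  have x: "readout d j (j + s) (iter s) \<in> cube d 20" using True by (simp add: sions_domain_iff)
  have "has_gradient d (f (j + s)) (readout d j (j + s) (iter s)) g"
    unfolding g_def using f[of "j + s"] j s by (intro admissible_has_gradient[where \<sigma> = \<sigma>] x) auto
  from gradient_coord_le_1[OF this x] have g: "\<bar>g $ (i div 2)\<bar> \<le> 1"
    using f[of "j + s"] j s by (auto simp: admissible_loss_def)
  have "\<bar>if even i then 1 else real (j + s) - real j + 1\<bar> \<le> real n" using s j by auto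
  with g have "\<bar>g $ (i div 2)\<bar> * \<bar>if even i then 1 else real (j + s) - real j + 1\<bar> \<le> 1 * real n"
    by (intro mult_mono) auto
  then show ?thesis using True s by (simp add: expert_gradient_def lift_vec_def g_def abs_mult)
next
  case False
  then show ?thesis using s by (simp add: expert_gradient_def)
qed

interpretation ons "2 * d" 2 \<sigma> expert_gradient by (rule ons_expert)

text \<open>Gradients are only known inside the cube, so membership of all earlier iterates is what
  identifies the matrix of the algorithm with \<open>A (Suc m)\<close>. The new iterate is a true
  projection only because the minimum is attained, \<open>arg_min_on\<close> being an arbitrary
  value otherwise.\<close>

lemma iter_step:
  assumes "j + m \<le> n" and dom: "\<And>s. s \<le> m \<Longrightarrow> iter s \<in> sions_domain d 20 j (j + s)"
  shows "iter (Suc m) \<in> sions_domain d 20 j (j + Suc m)"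
    and "w \<in> sions_domain d 20 j (j + Suc m) \<Longrightarrow> form (Suc m) (iter (Suc m) - w) (iter (Suc m) - w)
      \<le> form (Suc m) (iter m - B (Suc m) *\<^sub>v expert_gradient m - w) (iter m - B (Suc m) *\<^sub>v expert_gradient m - w)"
proof -
  define u where "u = iter m - B (Suc m) *\<^sub>v expert_gradient m"
  define K where "K = sions_domain d 20 j (j + Suc m)"
  have grad: "gradient (2 * d) (lifted_loss d f j (j + s)) (iter s) = expert_gradient s" if "s \<le> m" for s
    by (rule expert_gradient_eq) (use assms that in auto)
  have "iter m \<in> carrier_vec (2 * d)" using dom[of m] by (simp add: sions_domain_iff)
  then have u: "u \<in> carrier_vec (2 * d)"
    unfolding u_def by (intro minus_carrier_vec B_carrier G)
  have K: "K \<subseteq> carrier_vec (2 * d)" by (auto simp: K_def sions_domain_iff)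
  have "2 \<cdot>\<^sub>m 1\<^sub>m (2 * d) + \<sigma> \<cdot>\<^sub>m mat (2 * d) (2 * d) (\<lambda>(a, b). \<Sum>s\<in>{..m}.
      gradient (2 * d) (lifted_loss d f j (j + s)) (iter s) $ a *
      gradient (2 * d) (lifted_loss d f j (j + s)) (iter s) $ b) = A (Suc m)"
    unfolding ons_mat_def lessThan_Suc_atMost
    by (intro arg_cong2[where f = "(+)"] arg_cong2[where f = "(\<cdot>\<^sub>m)"] refl eq_matI) (auto simp: grad)
  then have iter: "iter (Suc m) = arg_min_on (\<lambda>w. mahalanobis_norm (A (Suc m)) (w - u)) K"
    by (simp add: Let_def grad u_def B_def K_def)
  have "\<exists>v\<in>K. \<forall>w\<in>K. mahalanobis_norm (A (Suc m)) (v - u) \<le> mahalanobis_norm (A (Suc m)) (w - u)"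
  proof (rule projection_exists[OF K _ u])
    show "K \<noteq> {}" using zero_in_sions_domain[of 20 d j "j + Suc m"] by (auto simp: K_def)
  qed (unfold K_def, rule sions_domain_closed)
  note arg = arg_min_on_attained[OF this, folded iter]
  show "iter (Suc m) \<in> sions_domain d 20 j (j + Suc m)" using arg(1) by (simp only: K_def)
  show "form (Suc m) (iter (Suc m) - w) (iter (Suc m) - w)
      \<le> form (Suc m) (iter m - B (Suc m) *\<^sub>v expert_gradient m - w) (iter m - B (Suc m) *\<^sub>v expert_gradient m - w)"
    if "w \<in> sions_domain d 20 j (j + Suc m)"
    unfolding u_def[symmetric]
    by (rule projection_contracts[OF K _ arg(1) arg(2) _ u])
      (use that sions_domain_convex in \<open>auto simp: K_def\<close>)
qed

lemma iter_in_domain: "j + m \<le> Suc n \<Longrightarrow> iter m \<in> sions_domain d 20 j (j + m)"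
proof (induction m rule: less_induct)
  case (less m)
  show ?case
  proof (cases m)
    case 0
    then show ?thesis using zero_in_sions_domain[of 20 d j j] by simp
  next
    case (Suc k)
    show ?thesis unfolding Suc by (rule iter_step) (use less Suc in auto)
  qed
qed

lemma sions_prediction_in_cube:
  assumes "j \<le> t" "t \<le> n"
  shows "sions_prediction d 2 \<sigma> 20 f j t \<in> cube d 20"
  using iter_in_domain[of "t - j"] assms by (simp add: sions_prediction_def sions_domain_iff)

text \<open>The exp-concave lower bound makes each round cost at most half a summand of
  \<open>ons_regret\<close> with \<open>\<eta> = \<sigma>\<close>. Halving turns
  \<open>\<epsilon> = 2\<close> into the factor 1 of \<open>\<theta> \<bullet> \<theta>\<close> and
  \<open>2 * d\<close> into \<open>d\<close>; \<open>real n ^ 3\<close> comes from at most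
  \<open>n\<close> rounds with gradient entries at most \<open>n\<close>.\<close>

lemma expert_regret:
  assumes b: "j \<le> b" "b \<le> n" and d: "d \<ge> 1"
    and \<theta>: "\<And>t. t \<in> {j..b} \<Longrightarrow> \<theta> \<in> sions_domain d 20 j t"
  shows "(\<Sum>t=j..b. f t (sions_prediction d 2 \<sigma> 20 f j t) - f t (readout d j t \<theta>)) \<le>
    (\<theta> \<bullet> \<theta>) + real d / \<sigma> * (ln (2 * real d) + ln (2 + \<sigma> * real n ^ 3))"
proof -
  define M where "M = Suc (b - j)"
  have \<theta>c: "\<theta> \<in> carrier_vec (2 * d)" using \<theta>[of j] b by (simp add: sions_domain_iff)
  have dom: "iter s \<in> sions_domain d 20 j (j + s)" if "s < M" for s
    using iter_in_domain[of s] that b by (simp add: M_def)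
  have ic: "iter s \<in> carrier_vec (2 * d)" if "s < M" for s using dom[OF that] by (simp add: sions_domain_iff)
  have step: "f (j + s) (readout d j (j + s) (iter s)) - f (j + s) (readout d j (j + s) \<theta>) \<le>
      (2 * (expert_gradient s \<bullet> (iter s - \<theta>)) - \<sigma> * (expert_gradient s \<bullet> (iter s - \<theta>))\<^sup>2) / 2" if s: "s < M" for s
  proof -
    define t where "t = j + s"
    define x where "x = readout d j t (iter s)"
    define y where "y = readout d j t \<theta>"
    define g where "g = gradient d (f t) x"
    have t: "t \<in> {1..n}" "t \<in> {j..b}" using s b j by (auto simp: t_def M_def)
    have xy: "x \<in> cube d 20" "y \<in> cube d 20"
      using dom[OF s] \<theta>[OF t(2)] by (auto simp: sions_domain_iff x_def y_def t_def)
    have "f t y \<ge> f t x + g \<bullet> (y - x) + \<sigma> / 2 * (g \<bullet> (y - x))\<^sup>2"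
      using f[OF t(1)] xy unfolding g_def admissible_loss_def exp_concave_lower_bound_on_def by blast
    moreover have "g \<in> carrier_vec d"
      using admissible_has_gradient[OF f[OF t(1)] xy(1)] by (simp add: has_gradient_def g_def)
    have "expert_gradient s = lift_vec d j t g"
      using dom[OF s] t by (simp add: expert_gradient_def g_def x_def t_def)
    then have "expert_gradient s \<bullet> (iter s - \<theta>) = g \<bullet> (x - y)"
      using ic[OF s] \<theta>c by (simp add: lift_vec_adjoint readout_diff x_def y_def)
    moreover have "g \<bullet> (x - y) = - (g \<bullet> (y - x))"
      using \<open>g \<in> _\<close> xy by (simp add: scalar_prod_minus_distrib[of g d] cube_def)
    ultimately show ?thesis by (simp add: x_def y_def t_def)
  qed
  have "(\<Sum>t=j..b. f t (sions_prediction d 2 \<sigma> 20 f j t) - f t (readout d j t \<theta>)) =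
    (\<Sum>s<M. f (j + s) (readout d j (j + s) (iter s)) - f (j + s) (readout d j (j + s) \<theta>))"
    by (rule sum.reindex_bij_witness[where i = "\<lambda>s. j + s" and j = "\<lambda>t. t - j"])
      (use b in \<open>auto simp: M_def sions_prediction_def\<close>)
  also have "\<dots> \<le> (\<Sum>s<M. (2 * (expert_gradient s \<bullet> (iter s - \<theta>)) - \<sigma> * (expert_gradient s \<bullet> (iter s - \<theta>))\<^sup>2) / 2)"
    by (rule sum_mono) (use step in auto)
  also have "\<dots> = (\<Sum>s<M. 2 * (expert_gradient s \<bullet> (iter s - \<theta>)) - \<sigma> * (expert_gradient s \<bullet> (iter s - \<theta>))\<^sup>2) / 2"
    by (simp add: sum_divide_distrib)
  also have "\<dots> \<le> (2 * (\<theta> \<bullet> \<theta>) + ln \<bar>det (A M)\<bar> / \<sigma>) / 2"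
  proof (intro divide_right_mono ons_regret)
    fix s assume s: "Suc s < M"
    show "form (Suc s) (iter (Suc s) - \<theta>) (iter (Suc s) - \<theta>) \<le> form (Suc s)
      (iter s - B (Suc s) *\<^sub>v expert_gradient s - \<theta>) (iter s - B (Suc s) *\<^sub>v expert_gradient s - \<theta>)"
      by (rule iter_step(2)) (use s b dom \<theta>[of "j + Suc s"] in \<open>auto simp: M_def\<close>)
  qed (use ic \<theta>c in auto)
  also have "\<dots> \<le> (2 * (\<theta> \<bullet> \<theta>) + (real (2 * d) * (ln (2 * real d) + ln (2 + \<sigma> * real n ^ 3))) / \<sigma>) / 2"
  proof -
    have "ln \<bar>det (A M)\<bar> \<le> real (2 * d) * (ln (real (2 * d)) + ln (2 + \<sigma> * real M * (real n)\<^sup>2))"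
      by (rule log_det_le) (use expert_gradient_le b in \<open>auto simp: M_def\<close>)
    also have "\<dots> \<le> real (2 * d) * (ln (real (2 * d)) + ln (2 + \<sigma> * real n ^ 3))"
    proof -
      have "\<sigma> * real M * (real n)\<^sup>2 \<le> \<sigma> * real n * (real n)\<^sup>2"
        using \<sigma> b j by (intro mult_right_mono mult_left_mono) (auto simp: M_def)
      then have "2 + \<sigma> * real M * (real n)\<^sup>2 \<le> 2 + \<sigma> * real n ^ 3"
        by (simp add: power3_eq_cube power2_eq_square mult.assoc)
      then show ?thesis using \<sigma> by (intro mult_left_mono add_left_mono ln_mono) (auto intro!: add_pos_nonneg)
    qed
    finally show ?thesis using \<sigma> by (intro divide_right_mono add_left_mono) auto
  qed
  also have "\<dots> = (\<theta> \<bullet> \<theta>) + real d / \<sigma> * (ln (2 * real d) + ln (2 + \<sigma> * real n ^ 3))"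
    by (simp add: field_simps)
  finally show ?thesis .
qed

end

subsection \<open>Regret of the expert aggregation\<close>

lemma cube_convex_sum:
  assumes "finite I" "\<And>i. i \<in> I \<Longrightarrow> 0 \<le> u i" "sum u I = 1" "\<And>i. i \<in> I \<Longrightarrow> X i \<in> cube d r"
  shows "Matrix.vec d (\<lambda>k. \<Sum>i\<in>I. u i * X i $ k) \<in> cube d r"
proof -
  have "- r \<le> (\<Sum>i\<in>I. u i * X i $ k) \<and> (\<Sum>i\<in>I. u i * X i $ k) \<le> r" if "k < d" for k
  proof -
    have "(\<Sum>i\<in>I. u i * X i $ k) \<le> (\<Sum>i\<in>I. u i * r)"
      by (intro sum_mono mult_left_mono) (use assms that in \<open>auto simp: cube_def\<close>)
    moreover have "(\<Sum>i\<in>I. u i * X i $ k) \<ge> (\<Sum>i\<in>I. u i * - r)"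
      by (intro sum_mono mult_left_mono) (use assms that in \<open>auto simp: cube_def\<close>)
    moreover have "(\<Sum>i\<in>I. u i * r) = r" "(\<Sum>i\<in>I. u i * - r) = - r"
      using assms(3) by (simp_all flip: sum_distrib_right add: sum_negf)
    ultimately show ?thesis by simp
  qed
  then show ?thesis by (auto simp: cube_def)
qed

lemma exp_concave_jensen:
  assumes "finite I" "\<And>i. i \<in> I \<Longrightarrow> 0 \<le> u i" "sum u I = 1" "\<And>i. i \<in> I \<Longrightarrow> X i \<in> cube d r"
    and f: "exp_concave_on \<sigma> (cube d r) f"
  shows "(\<Sum>i\<in>I. u i * exp (- \<sigma> * f (X i))) \<le> exp (- \<sigma> * f (Matrix.vec d (\<lambda>k. \<Sum>i\<in>I. u i * X i $ k)))"
  using assms(1-4)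
proof (induction I arbitrary: u)
  case (insert i I)
  have Xi: "X i \<in> cube d r" using insert.prems by auto
  show ?case
  proof (cases "u i = 1")
    \<comment> \<open>All other weights vanish; the rescaling of the other case would divide by 0
      here.\<close>
    case True
    then have "sum u I = 0" using insert by simp
    then have z: "u k = 0" if "k \<in> I" for k
      using insert that by (simp add: sum_nonneg_eq_0_iff)
    have "Matrix.vec d (\<lambda>k. \<Sum>i\<in>insert i I. u i * X i $ k) = X i"
      using Xi insert.hyps by (intro eq_vecI) (auto simp: True z cube_def)
    then show ?thesis using insert.hyps by (simp add: True z)
  next
    case False
    define c where "c = 1 - u i"
    have c: "sum u I = c" using insert by (simp add: c_def)
    have "c \<ge> 0" unfolding c[symmetric] using insert.prems by (intro sum_nonneg) auto
    with False have "c > 0" by (simp add: c_def)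
    define v where "v k = u k / c" for k
    have v: "sum v I = 1" "\<And>k. k \<in> I \<Longrightarrow> v k \<ge> 0"
      using \<open>c > 0\<close> insert.prems by (auto simp: v_def c simp flip: sum_divide_distrib)
    have uv: "u k = c * v k" for k using \<open>c > 0\<close> by (simp add: v_def)
    define Y where "Y = Matrix.vec d (\<lambda>k. \<Sum>i\<in>I. v i * X i $ k)"
    have Y: "Y \<in> cube d r" unfolding Y_def by (rule cube_convex_sum) (use insert v in auto)
    have IH: "(\<Sum>i\<in>I. v i * exp (- \<sigma> * f (X i))) \<le> exp (- \<sigma> * f Y)"
      unfolding Y_def by (rule insert.IH) (use insert.prems v in auto)
    have "(\<Sum>k\<in>insert i I. u k * exp (- \<sigma> * f (X k))) =
        u i * exp (- \<sigma> * f (X i)) + c * (\<Sum>k\<in>I. v k * exp (- \<sigma> * f (X k)))"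
      using insert.hyps by (simp add: sum_distrib_left uv mult.assoc)
    also have "\<dots> \<le> (1 - c) * exp (- \<sigma> * f (X i)) + c * exp (- \<sigma> * f Y)"
      using IH \<open>c > 0\<close> by (simp add: c_def)
    also have "\<dots> \<le> exp (- \<sigma> * f ((1 - c) \<cdot>\<^sub>v X i + c \<cdot>\<^sub>v Y))"
    proof -
      have "c \<in> {0..1}" using \<open>c > 0\<close> insert.prems(1)[of i] by (auto simp: c_def)
      then show ?thesis using f Xi Y unfolding exp_concave_on_def by blast
    qed
    also have "(1 - c) \<cdot>\<^sub>v X i + c \<cdot>\<^sub>v Y = Matrix.vec d (\<lambda>k. \<Sum>i\<in>insert i I. u i * X i $ k)"
    proof (rule eq_vecI)
      fix k assume "k < dim_vec (Matrix.vec d (\<lambda>k. \<Sum>i\<in>insert i I. u i * X i $ k))"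
      then have k: "k < d" by simp
      then have "((1 - c) \<cdot>\<^sub>v X i + c \<cdot>\<^sub>v Y) $ k = u i * X i $ k + c * (\<Sum>i\<in>I. v i * X i $ k)"
        using Xi Y by (auto simp: cube_def c_def) (simp add: Y_def)
      also have "c * (\<Sum>i\<in>I. v i * X i $ k) = (\<Sum>i\<in>I. u i * X i $ k)"
        by (simp add: sum_distrib_left uv mult.assoc)
      finally show "((1 - c) \<cdot>\<^sub>v X i + c \<cdot>\<^sub>v Y) $ k =
          Matrix.vec d (\<lambda>k. \<Sum>i\<in>insert i I. u i * X i $ k) $ k"
        using k insert.hyps by simp
    qed (auto simp: Y_def)
    finally show ?thesis .
  qed
qed simp

lemma flh_weight_simplex:
  assumes "t \<ge> 1"
  shows "(\<forall>i\<in>{1..t}. flh_weight \<sigma> L t i > 0) \<and> (\<Sum>i=1..t. flh_weight \<sigma> L t i) = 1"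
  using assms
proof (induction t rule: nat_induct_at_least)
  case base
  then show ?case by simp
next
  case (Suc t)
  define Z where "Z = (\<Sum>j=1..t. flh_weight \<sigma> L t j * exp (- \<sigma> * L t j))"
  have Z: "Z > 0" unfolding Z_def using Suc by (intro sum_pos) auto
  have "(\<Sum>i=1..t. flh_weight \<sigma> L (Suc t) i) =
      (\<Sum>i=1..t. (1 - 1 / real (Suc t)) * (flh_weight \<sigma> L t i * exp (- \<sigma> * L t i) / Z))"
    by (rule sum.cong) (auto simp: Z_def)
  also have "\<dots> = (1 - 1 / real (Suc t)) * (Z / Z)"
    unfolding sum_distrib_left[symmetric] sum_divide_distrib[symmetric] Z_def ..
  finally have "(\<Sum>i=1..Suc t. flh_weight \<sigma> L (Suc t) i) = 1" using Z by simp
  moreover have "flh_weight \<sigma> L (Suc t) i > 0" if "i \<in> {1..Suc t}" for i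
  proof (cases "i = Suc t")
    case False
    then have "i \<in> {1..t}" using that by auto
    then have "0 < (1 - 1 / real (Suc t)) * (flh_weight \<sigma> L t i * exp (- \<sigma> * L t i) / Z)"
      using Suc Z by (intro mult_pos_pos divide_pos_pos) auto
    with False show ?thesis by (simp add: Z_def)
  qed simp
  ultimately show ?case by blast
qed

text \<open>The potential \<open>ln (W t j) + ln t\<close> absorbs the factor
  \<open>t / (t + 1)\<close> of the sharing step. It grows per round by at least
  \<open>\<sigma>\<close> times the regret, is 0 at \<open>t = j\<close> where the weight is
  \<open>1 / j\<close>, and ends at most at \<open>ln (b + 1)\<close>.\<close>

lemma flh_regret:
  fixes L :: "nat \<Rightarrow> nat \<Rightarrow> real" and q :: "nat \<Rightarrow> real"
  assumes "\<sigma> > 0" "1 \<le> j" "j \<le> b"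
    and mix: "\<And>t. t \<in> {j..b} \<Longrightarrow> (\<Sum>i=1..t. flh_weight \<sigma> L t i * exp (- \<sigma> * L t i)) \<le> exp (- \<sigma> * q t)"
  shows "(\<Sum>t=j..b. q t - L t j) \<le> ln (real (Suc b)) / \<sigma>"
proof -
  define W where "W = flh_weight \<sigma> L"
  have W: "W t i > 0" "W t i \<le> 1" if "1 \<le> i" "i \<le> t" for t i
  proof -
    have s: "(\<forall>i\<in>{1..t}. W t i > 0) \<and> (\<Sum>i=1..t. W t i) = 1"
      unfolding W_def by (rule flh_weight_simplex) (use that in auto)
    with that show "W t i > 0" by auto
    have "W t i \<le> (\<Sum>i=1..t. W t i)" by (rule member_le_sum) (use s that in \<open>auto intro: less_imp_le\<close>)
    with s show "W t i \<le> 1" by simp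
  qed
  have step: "\<sigma> * (q t - L t j) \<le> (ln (W (Suc t) j) + ln (real (Suc t))) - (ln (W t j) + ln (real t))"
    if t: "j \<le> t" "t \<le> b" for t
  proof -
    define Z where "Z = (\<Sum>i=1..t. W t i * exp (- \<sigma> * L t i))"
    have Z: "Z > 0" unfolding Z_def using W t \<open>1 \<le> j\<close> by (intro sum_pos) auto
    have "Z \<le> exp (- \<sigma> * q t)" using mix[of t] t by (simp add: Z_def W_def)
    then have "ln Z \<le> - \<sigma> * q t" using ln_mono[of Z "exp (- \<sigma> * q t)"] Z by simp
    have t0: "real t > 0" using t \<open>1 \<le> j\<close> by simp
    have "W (Suc t) j = (1 - 1 / real (Suc t)) * (W t j * exp (- \<sigma> * L t j) / Z)"
      using t by (simp add: W_def Z_def)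
    also have "1 - 1 / real (Suc t) = real t / real (Suc t)" by (simp add: field_simps)
    finally have "ln (W (Suc t) j) = ln (real t) - ln (real (Suc t)) + (ln (W t j) - \<sigma> * L t j - ln Z)"
      using W[of j t] t \<open>1 \<le> j\<close> Z t0 by (simp add: ln_mult ln_div)
    with \<open>ln Z \<le> - \<sigma> * q t\<close> show ?thesis by (simp add: algebra_simps)
  qed
  have "\<sigma> * (\<Sum>t=j..b. q t - L t j) \<le> (\<Sum>t=j..b. (ln (W (Suc t) j) + ln (real (Suc t))) - (ln (W t j) + ln (real t)))"
    unfolding sum_distrib_left by (rule sum_mono) (use step in auto)
  also have "\<dots> = (ln (W (Suc b) j) + ln (real (Suc b))) - (ln (W j j) + ln (real j))"
    using \<open>j \<le> b\<close> sum_Suc_diff[of j b "\<lambda>t. ln (W t j) + ln (real t)"] by simp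
  also have "W j j = 1 / real j" using \<open>1 \<le> j\<close> by (cases j) (auto simp: W_def)
  also have "ln (1 / real j) + ln (real j) = 0" using \<open>1 \<le> j\<close> by (simp add: ln_div)
  also have "ln (W (Suc b) j) \<le> 0" using W[of j "Suc b"] assms by simp
  finally show ?thesis using \<open>\<sigma> > 0\<close> by (simp add: pos_le_divide_eq mult.commute)
qed

lemma flh_sions_in_cube:
  assumes "\<sigma> > 0" "\<And>t. t \<in> {1..n} \<Longrightarrow> admissible_loss d \<sigma> (f t)" "t \<in> {1..n}"
  shows "flh_sions d \<sigma> 2 20 f t \<in> cube d 20"
proof -
  have "t \<ge> 1" using assms by simp
  note W = flh_weight_simplex[OF this]
  show ?thesis unfolding flh_sions_def Let_def
    by (rule cube_convex_sum) (use W assms sions_prediction_in_cube[OF assms(1) _ assms(2)] in \<open>auto intro: less_imp_le\<close>)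
qed

lemma flh_sions_interval_regret:
  assumes \<sigma>: "\<sigma> > 0" and f: "\<And>t. t \<in> {1..n} \<Longrightarrow> admissible_loss d \<sigma> (f t)"
    and b: "1 \<le> j" "j \<le> b" "b \<le> n" and "d \<ge> 1"
    and \<theta>: "\<And>t. t \<in> {j..b} \<Longrightarrow> \<theta> \<in> sions_domain d 20 j t"
  shows "(\<Sum>t=j..b. f t (flh_sions d \<sigma> 2 20 f t) - f t (readout d j t \<theta>)) \<le>
    ln (real (Suc n)) / \<sigma> + ((\<theta> \<bullet> \<theta>) + real d / \<sigma> * (ln (2 * real d) + ln (2 + \<sigma> * real n ^ 3)))"
proof -
  define E where "E = sions_prediction d 2 \<sigma> 20 f"
  define L where "L = (\<lambda>s i. f s (E i s))"
  have "(\<Sum>t=j..b. f t (flh_sions d \<sigma> 2 20 f t) - L t j) \<le> ln (real (Suc b)) / \<sigma>"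
  proof (rule flh_regret[OF \<sigma> b(1,2)])
    fix t assume t: "t \<in> {j..b}"
    then have t': "t \<in> {1..n}" "t \<ge> 1" using b by auto
    note W = flh_weight_simplex[OF t'(2), of \<sigma> L]
    have "(\<Sum>i=1..t. flh_weight \<sigma> L t i * exp (- \<sigma> * f t (E i t))) \<le>
      exp (- \<sigma> * f t (Matrix.vec d (\<lambda>k. \<Sum>i=1..t. flh_weight \<sigma> L t i * E i t $ k)))"
    proof (rule exp_concave_jensen)
      show "exp_concave_on \<sigma> (cube d 20) (f t)" using f[OF t'(1)] by (simp add: admissible_loss_def)
      show "E i t \<in> cube d 20" if "i \<in> {1..t}" for i
        unfolding E_def by (rule sions_prediction_in_cube[OF \<sigma> _ f]) (use that t' in auto)
    qed (use W in \<open>auto intro: less_imp_le\<close>)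
    then show "(\<Sum>i=1..t. flh_weight \<sigma> L t i * exp (- \<sigma> * L t i)) \<le> exp (- \<sigma> * f t (flh_sions d \<sigma> 2 20 f t))"
      by (simp add: flh_sions_def L_def E_def Let_def)
  qed
  also have "\<dots> \<le> ln (real (Suc n)) / \<sigma>"
    using b \<sigma> by (intro divide_right_mono ln_mono) auto
  finally have 1: "(\<Sum>t=j..b. f t (flh_sions d \<sigma> 2 20 f t) - L t j) \<le> ln (real (Suc n)) / \<sigma>" .
  have "(\<Sum>t=j..b. L t j - f t (readout d j t \<theta>)) \<le>
      (\<theta> \<bullet> \<theta>) + real d / \<sigma> * (ln (2 * real d) + ln (2 + \<sigma> * real n ^ 3))"
    unfolding L_def E_def by (rule expert_regret[OF \<sigma> b(1) f b(2,3) \<open>d \<ge> 1\<close> \<theta>])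
  moreover have "(\<Sum>t=j..b. f t (flh_sions d \<sigma> 2 20 f t) - f t (readout d j t \<theta>)) =
    (\<Sum>t=j..b. f t (flh_sions d \<sigma> 2 20 f t) - L t j) + (\<Sum>t=j..b. L t j - f t (readout d j t \<theta>))"
    by (simp flip: sum.distrib)
  ultimately show ?thesis using 1 by simp
qed

subsection \<open>The penalised offline problem\<close>

text \<open>The squared distance to \<open>[-2, 2]\<close> keeps minimisers bounded without an active box constraint.\<close>

definition barrier :: "real \<Rightarrow> real" where
  "barrier x = (x - max (-2) (min x 2))\<^sup>2"

definition barrier_deriv :: "real \<Rightarrow> real" where
  "barrier_deriv x = 2 * (x - max (-2) (min x 2))"

lemma barrier_nonneg [simp]: "barrier x \<ge> 0"
  by (simp add: barrier_def)

lemma barrier_eq_0: "\<bar>x\<bar> \<le> 2 \<Longrightarrow> barrier x = 0"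
  by (simp add: barrier_def)

text \<open>The projection of \<open>x\<close> onto the interval is a competitor for the distance of
  \<open>y\<close>, and the square around it expands exactly.\<close>

lemma barrier_smooth: "barrier y \<le> barrier x + barrier_deriv x * (y - x) + (y - x)\<^sup>2"
proof -
  define p where "p = max (-2) (min x 2)"
  have "barrier y \<le> (y - p)\<^sup>2"
    unfolding barrier_def by (subst abs_le_square_iff[symmetric]) (auto simp: p_def)
  also have "\<dots> = barrier x + barrier_deriv x * (y - x) + (y - x)\<^sup>2"
    by (simp add: barrier_def barrier_deriv_def p_def[symmetric] power2_eq_square algebra_simps)
  finally show ?thesis .
qed

definition clip :: "real \<Rightarrow> real" where
  "clip x = max (- (5/2)) (min x (5/2))"

text \<open>At 5/2 the barrier reaches slope 1, the Lipschitz constant of a loss in each coordinate.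
  Beyond that point clipping saves at least as much barrier as it can add loss.\<close>

lemma barrier_clip: "barrier (clip x) + \<bar>x - clip x\<bar> \<le> barrier x"
proof -
  consider "\<bar>x\<bar> \<le> 5/2" | "x > 5/2" | "x < -5/2" by linarith
  then show ?thesis
  proof cases
    case 2
    then have "barrier x - (barrier (clip x) + \<bar>x - clip x\<bar>) = (x - 5/2)\<^sup>2"
      by (simp add: barrier_def clip_def power2_eq_square algebra_simps)
    then show ?thesis using zero_le_power2[of "x - 5/2"] by linarith
  next
    case 3
    then have "barrier x - (barrier (clip x) + \<bar>x - clip x\<bar>) = (x + 5/2)\<^sup>2"
      by (simp add: barrier_def clip_def power2_eq_square algebra_simps)
    then show ?thesis using zero_le_power2[of "x + 5/2"] by linarith
  qed (simp add: clip_def)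
qed

text \<open>For steps too short to change a sign the absolute value is exactly affine, so the
  variation contributes no second order error.\<close>

lemma abs_add_abs_dir:
  assumes "0 \<le> s" "y = 0 \<or> s * \<bar>e\<bar> \<le> \<bar>y\<bar>"
  shows "\<bar>y + s * e\<bar> = \<bar>y\<bar> + s * abs_dir y e"
proof -
  have *: "\<bar>s * e\<bar> = s * \<bar>e\<bar>" using assms by (simp add: abs_mult)
  show ?thesis
  proof (cases "y = 0")
    case False
    then have "\<bar>s * e\<bar> \<le> \<bar>y\<bar>" using assms * by simp
    then show ?thesis using False
      by (cases "y > 0") (auto simp: abs_dir_def sgn_if)
  qed (use * in \<open>simp add: abs_dir_def\<close>)
qed

lemma sum_pieces_le:
  fixes q :: "nat \<Rightarrow> real"
  assumes "P \<subseteq> {1..n}" "n \<ge> 1 \<Longrightarrow> 1 \<in> P"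
    and piece: "\<And>a b. 1 \<le> a \<Longrightarrow> a \<le> b \<Longrightarrow> b \<le> n \<Longrightarrow> {a<..b} \<inter> P = {} \<Longrightarrow> (\<Sum>t=a..b. q t) \<le> c"
  shows "(\<Sum>t=1..n. q t) \<le> real (card P) * c"
  using assms
proof (induction n arbitrary: P rule: less_induct)
  case (less n)
  have "finite P" using less.prems(1) finite_subset by blast
  show ?case
  proof (cases "n = 0")
    case True
    then have "P = {}" using less.prems(1) by auto
    then show ?thesis using True by simp
  next
    case False
    then have "P \<noteq> {}" using less.prems(2) by auto
    define a where "a = Max P"
    have a: "a \<in> P" unfolding a_def by (rule Max_in) fact+
    then have a': "1 \<le> a" "a \<le> n" using less.prems(1) by auto
    have max: "t \<le> a" if "t \<in> P" for t using that \<open>finite P\<close> by (simp add: a_def)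
    have last: "(\<Sum>t=a..n. q t) \<le> c" by (rule less.prems(3)) (use a' max in fastforce)+
    have "(\<Sum>t=1..a - 1. q t) \<le> real (card (P - {a})) * c"
    proof (rule less.IH)
      show "P - {a} \<subseteq> {1..a - 1}" using less.prems(1) max by fastforce
      show "1 \<in> P - {a}" if "1 \<le> a - 1" using less.prems(2) False that by auto
      show "(\<Sum>t=i..b. q t) \<le> c" if "1 \<le> i" "i \<le> b" "b \<le> a - 1" "{i<..b} \<inter> (P - {a}) = {}" for i b
        by (rule less.prems(3)) (use that a' in fastforce)+
    qed (use a' in auto)
    moreover have "real (card P) = real (card (P - {a})) + 1"
      using a \<open>finite P\<close> by (subst card.remove[of P a]) auto
    moreover have "(\<Sum>t=1..n. q t) = (\<Sum>t=1..a - 1. q t) + (\<Sum>t=a..n. q t)"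
    proof -
      have "{1..n} = {1..a - 1} \<union> {a..n}" using a' by auto
      then show ?thesis using a' by (simp only:) (rule sum.union_disjoint, auto)
    qed
    ultimately show ?thesis using last by (simp add: algebra_simps)
  qed
qed

lemma affine_of_second_diff_0:
  assumes "a \<le> t" "t \<le> b" "\<And>t. a < t \<Longrightarrow> t < b \<Longrightarrow> second_diff x t = 0"
  shows "x t = x a + (real t - real a) * (x (Suc a) - x a)"
  using assms(1,2)
proof (induction t rule: less_induct)
  case (less t)
  consider "t = a" | "t = Suc a" | s where "t = Suc (Suc s)" "a \<le> s"
  proof -
    have "t = a \<or> t = Suc a \<or> (\<exists>s. t = Suc (Suc s) \<and> a \<le> s)" using less.prems by presburger
    then show thesis using that by blast
  qed
  then show ?case
  proof cases
    case 3
    have "second_diff x (Suc s) = 0" by (rule assms(3)) (use 3 less.prems in auto)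
    moreover have "x (Suc s) = x a + (real (Suc s) - real a) * (x (Suc a) - x a)"
      "x s = x a + (real s - real a) * (x (Suc a) - x a)"
      by (rule less.IH; use 3 less.prems in simp)+
    ultimately show ?thesis unfolding 3 by (simp add: second_diff_def algebra_simps)
  qed auto
qed

section \<open>Minimisers of the penalised problem and the comparators derived from them\<close>

locale offline_problem =
  fixes d n :: nat and \<sigma> :: real and f :: "nat \<Rightarrow> real Matrix.vec \<Rightarrow> real"
    and base :: "nat \<Rightarrow> nat \<Rightarrow> real"
  assumes \<sigma>: "\<sigma> > 0" and f: "\<And>t. t \<in> {1..n} \<Longrightarrow> admissible_loss d \<sigma> (f t)"
    and base: "\<And>k t. k < d \<Longrightarrow> t \<in> {1..n} \<Longrightarrow> \<bar>base k t\<bar> \<le> 1"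
begin

text \<open>Sequences of vectors are written coordinate first, as deviations from \<open>base\<close>.\<close>

definition point :: "(nat \<Rightarrow> nat \<Rightarrow> real) \<Rightarrow> nat \<Rightarrow> real Matrix.vec" where
  "point r t = Matrix.vec d (\<lambda>k. base k t + r k t)"

definition penalised :: "(nat \<Rightarrow> nat \<Rightarrow> real) \<Rightarrow> nat \<Rightarrow> real" where
  "penalised r t = f t (point r t) + (\<Sum>k<d. barrier (r k t))"

definition objective :: "real \<Rightarrow> (nat \<Rightarrow> nat \<Rightarrow> real) \<Rightarrow> real" where
  "objective \<mu> r = (\<Sum>t=1..n. penalised r t) + \<mu> * (\<Sum>k<d. second_var n (r k))"

text \<open>The bound 3 provides compactness and never binds: clipping moves a minimiser to within
  5/2, and the remaining room of 1/2 leaves every direction free.\<close>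

definition feasible :: "(nat \<Rightarrow> nat \<Rightarrow> real) \<Rightarrow> bool" where
  "feasible r \<longleftrightarrow> (\<forall>k t. \<bar>r k t\<bar> \<le> 3) \<and> (\<forall>k t. \<not> (k < d \<and> t \<in> {1..n}) \<longrightarrow> r k t = 0)"

lemma feasible_supported: "feasible r \<Longrightarrow> supported n (r k)"
  by (auto simp: feasible_def supported_def)

lemma point_in_cube:
  assumes "t \<in> {1..n}" "\<And>k. k < d \<Longrightarrow> \<bar>r k t\<bar> \<le> 19"
  shows "point r t \<in> cube d 20"
proof -
  have "- 20 \<le> base k t + r k t \<and> base k t + r k t \<le> 20" if "k < d" for k
    using base[OF that assms(1)] assms(2)[OF that] by linarith
  then show ?thesis by (auto simp: cube_def point_def)
qed

lemma feasible_in_cube: "feasible r \<Longrightarrow> t \<in> {1..n} \<Longrightarrow> point r t \<in> cube d 20"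
  by (rule point_in_cube) (auto simp: feasible_def intro: order_trans[of _ 3])

lemma l1_norm_point_diff: "l1_norm (point r t - point s t) = (\<Sum>k<d. \<bar>r k t - s k t\<bar>)"
  by (simp add: l1_norm_def point_def)

lemma loss_diff_le:
  assumes "t \<in> {1..n}" "x \<in> cube d 20" "y \<in> cube d 20"
  shows "\<bar>f t x - f t y\<bar> \<le> l1_norm (x - y)"
proof -
  have "\<bar>f t x - f t y\<bar> \<le> 1 * l2_norm (x - y)"
    using f[OF assms(1)] assms unfolding admissible_loss_def l2_lipschitz_on_def by blast
  then show ?thesis using l2_norm_le_l1[of "x - y"] by simp
qed

text \<open>Coordinate and time are paired into one index. Continuity and the lower bound both come
  from the Lipschitz property, each coordinate deviating by at most 3.\<close>

lemma objective_min_exists: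
  assumes "\<mu> \<ge> 0"
  shows "\<exists>r. feasible r \<and> (\<forall>s. feasible s \<longrightarrow> objective \<mu> r \<le> objective \<mu> s)"
proof -
  define S :: "(nat \<times> nat \<Rightarrow> real) set" where "S = {x. feasible (curry x)}"
  have pen: "(\<lambda>i. penalised (curry (X i)) t) \<longlonglongrightarrow> penalised (curry l) t"
    if X: "\<And>i. X i \<in> S" "l \<in> S" and lim: "\<And>p. (\<lambda>i. X i p) \<longlonglongrightarrow> l p" and t: "t \<in> {1..n}" for X l t
  proof -
    have "(\<lambda>i. \<Sum>k<d. \<bar>X i (k, t) - l (k, t)\<bar>) \<longlonglongrightarrow> (\<Sum>k<d. \<bar>l (k, t) - l (k, t)\<bar>)"
      by (intro tendsto_intros lim)
    then have z: "(\<lambda>i. \<Sum>k<d. \<bar>X i (k, t) - l (k, t)\<bar>) \<longlonglongrightarrow> 0" by simp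
    have "(\<lambda>i. f t (point (curry (X i)) t) - f t (point (curry l) t)) \<longlonglongrightarrow> 0"
    proof (rule tendsto_rabs_zero_cancel, rule tendsto_sandwich[OF _ _ tendsto_const z]; intro always_eventually allI abs_ge_zero)
      fix i
      show "\<bar>f t (point (curry (X i)) t) - f t (point (curry l) t)\<bar> \<le> (\<Sum>k<d. \<bar>X i (k, t) - l (k, t)\<bar>)"
        using loss_diff_le[OF t feasible_in_cube[of "curry (X i)" t] feasible_in_cube[of "curry l" t]] X t
        by (simp add: S_def l1_norm_point_diff)
    qed
    then have "(\<lambda>i. f t (point (curry (X i)) t)) \<longlonglongrightarrow> f t (point (curry l) t)"
      by (rule LIM_zero_cancel)
    then show ?thesis unfolding penalised_def barrier_def curry_def
      by (intro tendsto_intros lim)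
  qed
  have "\<exists>x\<in>S. \<forall>y\<in>S. objective \<mu> (curry x) \<le> objective \<mu> (curry y)"
  proof (rule attains_min_finite[where I = "{..<d} \<times> {1..n}" and z = "\<lambda>_. 0" and M = "\<lambda>_. 3"
        and b = "(\<Sum>t=1..n. f t (point (\<lambda>_ _. 0) t) - 3 * real d)"])
    show "S \<noteq> {}" by (auto simp: S_def feasible_def intro!: exI[of _ "\<lambda>_. 0"])
    show "\<bar>x p\<bar> \<le> 3" if "x \<in> S" for x p
      using that by (cases p) (auto simp: S_def feasible_def)
    show "x p = 0" if "x \<in> S" "p \<notin> {..<d} \<times> {1..n}" for x p
      using that by (cases p) (auto simp: S_def feasible_def)
    show "l \<in> S" if X: "\<And>i. X i \<in> S" and lim: "\<And>p. (\<lambda>i. X i p) \<longlonglongrightarrow> l p" for X l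
    proof -
      have "\<bar>l (k, t)\<bar> \<le> 3" for k t
        by (rule LIMSEQ_le_const2[OF tendsto_rabs[OF lim]]) (use X in \<open>auto simp: S_def feasible_def\<close>)
      moreover have "l (k, t) = 0" if "\<not> (k < d \<and> t \<in> {1..n})" for k t
      proof -
        have "X i (k, t) = 0" for i using X[of i] that by (auto simp: S_def feasible_def)
        then show ?thesis using lim[of "(k, t)"] by (simp add: LIMSEQ_const_iff)
      qed
      ultimately show ?thesis by (auto simp: S_def feasible_def)
    qed
    show "(\<lambda>i. objective \<mu> (curry (X i))) \<longlonglongrightarrow> objective \<mu> (curry l)"
      if X: "\<And>i. X i \<in> S" "l \<in> S" and lim: "\<And>p. (\<lambda>i. X i p) \<longlonglongrightarrow> l p" for X l
    proof -
      have "(\<lambda>i. \<Sum>t=1..n. penalised (curry (X i)) t) \<longlonglongrightarrow> (\<Sum>t=1..n. penalised (curry l) t)"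
        by (intro tendsto_sum pen X lim)
      moreover have "(\<lambda>i. \<Sum>k<d. second_var n (curry (X i) k)) \<longlonglongrightarrow> (\<Sum>k<d. second_var n (curry l k))"
        unfolding second_var_def second_diff_def curry_def by (intro tendsto_intros lim)
      ultimately show ?thesis unfolding objective_def by (intro tendsto_add tendsto_mult tendsto_const)
    qed
    show "(\<Sum>t=1..n. f t (point (\<lambda>_ _. 0) t) - 3 * real d) \<le> objective \<mu> (curry x)" if x: "x \<in> S" for x
    proof -
      have "(\<Sum>t=1..n. f t (point (\<lambda>_ _. 0) t) - 3 * real d) \<le> (\<Sum>t=1..n. penalised (curry x) t)"
      proof (rule sum_mono)
        fix t assume t: "t \<in> {1..n}"
        have "\<bar>f t (point (\<lambda>_ _. 0) t) - f t (point (curry x) t)\<bar> \<le> (\<Sum>k<d. \<bar>0 - curry x k t\<bar>)"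
          using loss_diff_le[OF t feasible_in_cube[of "\<lambda>_ _. 0" t] feasible_in_cube[of "curry x" t]] x t
          unfolding l1_norm_point_diff by (simp add: S_def feasible_def)
        also have "\<dots> \<le> (\<Sum>k<d. 3)" by (rule sum_mono) (use x in \<open>auto simp: S_def feasible_def\<close>)
        finally have "f t (point (\<lambda>_ _. 0) t) - 3 * real d \<le> f t (point (curry x) t)" by simp
        also have "\<dots> \<le> penalised (curry x) t" by (simp add: penalised_def sum_nonneg)
        finally show "f t (point (\<lambda>_ _. 0) t) - 3 * real d \<le> penalised (curry x) t" .
      qed
      also have "\<dots> \<le> objective \<mu> (curry x)"
        using assms by (simp add: objective_def second_var_def sum_nonneg)
      finally show ?thesis .
    qed
  qed auto
  then obtain x where x: "x \<in> S" "\<And>y. y \<in> S \<Longrightarrow> objective \<mu> (curry x) \<le> objective \<mu> (curry y)" by blast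
  have "objective \<mu> (curry x) \<le> objective \<mu> s" if "feasible s" for s
    using x(2)[of "case_prod s"] that by (simp add: S_def)
  with x(1) show ?thesis by (auto simp: S_def)
qed

lemma objective_clip:
  assumes r: "feasible r" and "\<mu> \<ge> 0"
  shows "feasible (\<lambda>k t. clip (r k t))" "objective \<mu> (\<lambda>k t. clip (r k t)) \<le> objective \<mu> r"
proof -
  have "clip 0 = 0" by (simp add: clip_def)
  moreover have "\<bar>clip x\<bar> \<le> 3" for x by (auto simp: clip_def)
  ultimately show fe: "feasible (\<lambda>k t. clip (r k t))" using r by (simp add: feasible_def)
  have "penalised (\<lambda>k t. clip (r k t)) t \<le> penalised r t" if t: "t \<in> {1..n}" for t
  proof -
    have "\<bar>f t (point (\<lambda>k t. clip (r k t)) t) - f t (point r t)\<bar> \<le> (\<Sum>k<d. \<bar>clip (r k t) - r k t\<bar>)"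
      using loss_diff_le[OF t feasible_in_cube[OF fe t] feasible_in_cube[OF r t]]
      unfolding l1_norm_point_diff .
    moreover have "(\<Sum>k<d. barrier (clip (r k t)) + \<bar>clip (r k t) - r k t\<bar>) \<le> (\<Sum>k<d. barrier (r k t))"
      by (rule sum_mono) (use barrier_clip in \<open>simp add: abs_minus_commute\<close>)
    ultimately show ?thesis by (simp add: penalised_def sum.distrib)
  qed
  then have "(\<Sum>t=1..n. penalised (\<lambda>k t. clip (r k t)) t) \<le> (\<Sum>t=1..n. penalised r t)"
    by (rule sum_mono)
  moreover have "second_var n (\<lambda>t. clip (r k t)) \<le> second_var n (r k)" for k
    unfolding clip_def by (rule second_var_clip[OF feasible_supported[OF r]]) simp
  then have "\<mu> * (\<Sum>k<d. second_var n (\<lambda>t. clip (r k t))) \<le> \<mu> * (\<Sum>k<d. second_var n (r k))"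
    using \<open>\<mu> \<ge> 0\<close> by (intro mult_left_mono sum_mono)
  ultimately show "objective \<mu> (\<lambda>k t. clip (r k t)) \<le> objective \<mu> r" by (simp add: objective_def)
qed

definition slope :: "(nat \<Rightarrow> nat \<Rightarrow> real) \<Rightarrow> nat \<Rightarrow> nat \<Rightarrow> real" where
  "slope r k t = gradient d (f t) (point r t) $ k + barrier_deriv (r k t)"

text \<open>The coefficient 2 adds 1 from \<open>admissible_smooth\<close> and 1 from
  \<open>barrier_smooth\<close>. The bound splits over coordinates, which allows them to be treated
  one at a time.\<close>

lemma penalised_smooth:
  assumes t: "t \<in> {1..n}" and r: "\<And>k. k < d \<Longrightarrow> \<bar>r k t\<bar> \<le> 19" and v: "\<And>k. k < d \<Longrightarrow> \<bar>v k t\<bar> \<le> 19"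
  shows "penalised v t \<le> penalised r t + (\<Sum>k<d. slope r k t * (v k t - r k t) + 2 * (v k t - r k t)\<^sup>2)"
proof -
  have cube: "point r t \<in> cube d 20" "point v t \<in> cube d 20"
    using t r v by (auto intro: point_in_cube)
  have diff: "dim_vec (point v t - point r t) = d" "\<And>k. k < d \<Longrightarrow> (point v t - point r t) $ k = v k t - r k t"
    by (auto simp: point_def)
  have "gradient d (f t) (point r t) \<bullet> (point v t - point r t) =
      (\<Sum>k<d. gradient d (f t) (point r t) $ k * (v k t - r k t))"
    unfolding scalar_prod_eq_sum[OF diff(1)] by (simp add: diff)
  moreover have "(l2_norm (point v t - point r t))\<^sup>2 = (\<Sum>k<d. (v k t - r k t)\<^sup>2)"
    unfolding l2_norm_sq scalar_prod_eq_sum[OF diff(1)] by (simp add: diff power2_eq_square)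
  moreover have "(\<Sum>k<d. barrier (v k t)) \<le>
      (\<Sum>k<d. barrier (r k t) + barrier_deriv (r k t) * (v k t - r k t) + (v k t - r k t)\<^sup>2)"
    by (rule sum_mono) (rule barrier_smooth)
  ultimately show ?thesis using admissible_smooth[OF f[OF t] \<sigma> cube]
    by (simp add: penalised_def slope_def sum.distrib distrib_right flip: sum_distrib_left)
qed

text \<open>Coordinate \<open>k\<close> is moved along \<open>- s * h\<close> and \<open>s\<close>
  tends to 0 from the right: the smooth part errs by \<open>s\<^sup>2 * H\<close>, while the
  variation changes by exactly \<open>s\<close> times the sum of \<open>abs_dir\<close>.\<close>

lemma minimiser_stationary:
  assumes r: "feasible r" and interior: "\<And>k t. \<bar>r k t\<bar> \<le> 5/2" and "\<mu> \<ge> 0" and k: "k < d"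
    and min: "\<And>s. feasible s \<Longrightarrow> objective \<mu> r \<le> objective \<mu> s"
  shows "stationary n \<mu> (slope r k) (r k)"
  unfolding stationary_def
proof (intro allI impI)
  fix h assume h: "supported n h"
  define y where "y = second_diff (r k)"
  define e where "e t = - second_diff h t" for t
  define D where "D = \<mu> * (\<Sum>t\<le>Suc n. abs_dir (y t) (e t))"
  define H where "H = 2 * (\<Sum>t=1..n. (h t)\<^sup>2)"
  define G where "G = (\<Sum>t=1..n. slope r k t * h t)"
  have ev: "\<forall>\<^sub>F s in at_right 0. s * \<bar>h t\<bar> \<le> 1/2" for t
  proof -
    have "((\<lambda>s. s * \<bar>h t\<bar>) \<longlongrightarrow> 0 * \<bar>h t\<bar>) (at_right 0)" by (intro tendsto_intros)
    from order_tendstoD(2)[OF this, of "1/2"] show ?thesis by (auto elim: eventually_mono)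
  qed
  have ev2: "\<forall>\<^sub>F s in at_right 0. y t = 0 \<or> s * \<bar>e t\<bar> \<le> \<bar>y t\<bar>" for t
  proof (cases "y t = 0")
    case False
    have "((\<lambda>s. s * \<bar>e t\<bar>) \<longlongrightarrow> 0 * \<bar>e t\<bar>) (at_right 0)" by (intro tendsto_intros)
    from order_tendstoD(2)[OF this, of "\<bar>y t\<bar>"] False show ?thesis by (auto elim: eventually_mono)
  qed auto
  have "\<forall>\<^sub>F s in at_right 0. (\<forall>t\<in>{1..n}. s * \<bar>h t\<bar> \<le> 1/2) \<and> (\<forall>t\<in>{..Suc n}. y t = 0 \<or> s * \<bar>e t\<bar> \<le> \<bar>y t\<bar>) \<and> s > 0"
    by (intro eventually_conj eventually_ball_finite ballI ev ev2 eventually_at_right_less) auto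
  then have "\<forall>\<^sub>F s in at_right 0. G \<le> s * H + D"
  proof (rule eventually_mono)
    fix s :: real
    assume s: "(\<forall>t\<in>{1..n}. s * \<bar>h t\<bar> \<le> 1/2) \<and> (\<forall>t\<in>{..Suc n}. y t = 0 \<or> s * \<bar>e t\<bar> \<le> \<bar>y t\<bar>) \<and> s > 0"
    define v where "v i t = (if i = k then r k t - s * h t else r i t)" for i t
    have sh: "\<bar>s * h t\<bar> \<le> 1/2" for t
      using s h by (cases "t = 0 \<or> n < t") (auto simp: abs_mult supported_def)
    have vb: "\<bar>v i t\<bar> \<le> 3" for i t
      using interior[of i t] sh[of t] by (auto simp: v_def)
    have "v i t = 0" if "\<not> (i < d \<and> t \<in> {1..n})" for i t
    proof -
      have "r i t = 0" using r that unfolding feasible_def by blast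
      moreover have "i = k \<longrightarrow> h t = 0" using that k h by (cases t) (auto simp: supported_def)
      ultimately show ?thesis by (auto simp: v_def)
    qed
    with vb have "feasible v" by (simp add: feasible_def)
    have pen: "penalised v t \<le> penalised r t + (- s * (slope r k t * h t) + 2 * s\<^sup>2 * (h t)\<^sup>2)"
      if t: "t \<in> {1..n}" for t
    proof -
      have "penalised v t \<le> penalised r t + (\<Sum>i<d. slope r i t * (v i t - r i t) + 2 * (v i t - r i t)\<^sup>2)"
        by (rule penalised_smooth[OF t]; rule order_trans[OF vb] order_trans[OF interior]; simp)
      also have "(\<Sum>i<d. slope r i t * (v i t - r i t) + 2 * (v i t - r i t)\<^sup>2) =
          (\<Sum>i<d. if i = k then - s * (slope r k t * h t) + 2 * s\<^sup>2 * (h t)\<^sup>2 else 0)"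
        by (intro sum.cong refl) (auto simp: v_def power2_eq_square)
      also have "\<dots> = - s * (slope r k t * h t) + 2 * s\<^sup>2 * (h t)\<^sup>2" using k by simp
      finally show ?thesis .
    qed
    have "(\<Sum>t=1..n. penalised v t) \<le> (\<Sum>t=1..n. penalised r t + (- s * (slope r k t * h t) + 2 * s\<^sup>2 * (h t)\<^sup>2))"
      by (rule sum_mono) (rule pen)
    also have "\<dots> = (\<Sum>t=1..n. penalised r t) - s * G + s\<^sup>2 * H"
      unfolding sum.distrib G_def H_def by (simp add: sum_distrib_left sum_negf algebra_simps)
    finally have P: "(\<Sum>t=1..n. penalised v t) \<le> (\<Sum>t=1..n. penalised r t) - s * G + s\<^sup>2 * H" .
    have "second_var n (v k) = (\<Sum>t\<le>Suc n. \<bar>y t + s * e t\<bar>)"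
      unfolding second_var_def
      by (intro sum.cong refl) (simp add: v_def y_def e_def second_diff_def algebra_simps)
    also have "\<dots> = (\<Sum>t\<le>Suc n. \<bar>y t\<bar> + s * abs_dir (y t) (e t))"
      by (intro sum.cong refl abs_add_abs_dir) (use s in auto)
    also have "\<dots> = second_var n (r k) + s * (\<Sum>t\<le>Suc n. abs_dir (y t) (e t))"
      unfolding sum.distrib second_var_def y_def sum_distrib_left ..
    finally have vk: "second_var n (v k) = second_var n (r k) + s * (\<Sum>t\<le>Suc n. abs_dir (y t) (e t))" .
    have "(\<Sum>i<d. second_var n (v i)) =
        (\<Sum>i<d. second_var n (r i) + (if i = k then s * (\<Sum>t\<le>Suc n. abs_dir (y t) (e t)) else 0))"
      by (intro sum.cong refl) (use vk in \<open>auto simp: v_def[abs_def]\<close>)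
    also have "\<dots> = (\<Sum>i<d. second_var n (r i)) + s * (\<Sum>t\<le>Suc n. abs_dir (y t) (e t))"
      using k by (simp add: sum.distrib del: sum.atMost_Suc)
    finally have "\<mu> * (\<Sum>i<d. second_var n (v i)) = \<mu> * (\<Sum>i<d. second_var n (r i)) + s * D"
      unfolding D_def by (simp add: algebra_simps del: sum.atMost_Suc)
    with P min[OF \<open>feasible v\<close>] have "s * G \<le> s\<^sup>2 * H + s * D"
      unfolding objective_def by linarith
    then have "s * G \<le> s * (s * H + D)" by (simp add: power2_eq_square algebra_simps)
    then show "G \<le> s * H + D" using s by simp
  qed
  moreover have "((\<lambda>s. s * H + D) \<longlongrightarrow> 0 * H + D) (at_right 0)" by (intro tendsto_intros)
  ultimately have "G \<le> 0 * H + D"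
    by (intro tendsto_lowerbound[of _ _ "at_right (0::real)"]) auto
  then show "(\<Sum>t=1..n. slope r k t * h t) \<le>
      \<mu> * (\<Sum>t\<le>Suc n. abs_dir (second_diff (r k) t) (- second_diff h t))"
    by (simp add: G_def D_def y_def e_def del: sum.atMost_Suc)
qed

text \<open>\<open>c\<close> is the price later paid per bin and 1 is the bin's own cost. The bins
  charged to variation cost at most \<open>(c + 1) / \<delta>\<close> times the variation of the
  minimiser, which the penalty inside \<open>objective\<close> covers by the lower bound on
  \<open>\<mu>\<close>; thus that variation disappears and any feasible \<open>r0\<close> may stand
  on the right.\<close>

lemma piecewise_comparator:
  fixes \<mu> \<beta> \<delta> c :: real
  assumes "\<mu> > 0" "\<beta> > 0" "\<delta> > 0" "\<beta> ^ 3 * \<delta>\<^sup>2 \<le> 1/9" "c \<ge> 0" "(c + 1) / \<delta> \<le> \<mu>"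
  shows "\<exists>(v :: nat \<Rightarrow> nat \<Rightarrow> real) P (N :: real). P \<subseteq> {1..n} \<and> (n \<ge> 1 \<and> d \<ge> 1 \<longrightarrow> 1 \<in> P) \<and> real (card P) \<le> 5 * N \<and>
    (\<forall>k<d. affine_off P 1 n (v k)) \<and> (\<forall>k<d. \<forall>t\<in>{1..n}. \<bar>v k t\<bar> \<le> 7/2) \<and>
    (\<forall>r0. feasible r0 \<longrightarrow> (\<Sum>t=1..n. f t (point v t)) + c * N \<le> objective \<mu> r0 +
       (c + 1) * (real d + real d * real n / \<beta>))"
proof -
  have "\<mu> \<ge> 0" using \<open>\<mu> > 0\<close> by simp
  obtain r1 where r1': "feasible r1 \<and> (\<forall>s. feasible s \<longrightarrow> objective \<mu> r1 \<le> objective \<mu> s)"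
    using objective_min_exists[OF \<open>\<mu> \<ge> 0\<close>] by (rule exE)
  then have r1: "feasible r1" "\<And>s. feasible s \<Longrightarrow> objective \<mu> r1 \<le> objective \<mu> s" by simp_all
  define r where "r k t = clip (r1 k t)" for k t
  have r: "feasible r" unfolding r_def by (rule objective_clip(1)[OF r1(1), of \<mu>]) fact
  have "objective \<mu> r \<le> objective \<mu> r1"
    unfolding r_def by (rule objective_clip(2)[OF r1(1)]) fact
  then have min: "objective \<mu> r \<le> objective \<mu> s" if "feasible s" for s
    using r1(2)[OF that] by simp
  have interior: "\<bar>r k t\<bar> \<le> 5/2" for k t by (auto simp: r_def clip_def)
  define good where "good k v P N \<longleftrightarrow> P \<subseteq> {1..n} \<and> (n \<ge> 1 \<longrightarrow> 1 \<in> P) \<and> card P \<le> 5 * N \<and> affine_off P 1 n v \<and>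
    real N \<le> 1 + real n / \<beta> + (\<Sum>t<n. \<bar>second_diff (r k) t\<bar>) / \<delta> \<and>
    (\<forall>t\<in>{1..n}. \<bar>v t - r k t\<bar> \<le> 1) \<and>
    (\<Sum>t=1..n. slope r k t * (v t - r k t) + 2 * (v t - r k t)\<^sup>2) \<le> real N" for k v P N
  have "\<exists>v P N. good k v P N" if "k < d" for k
    unfolding good_def
    by (rule piecewise_affine_comparison[OF minimiser_stationary[OF r interior \<open>\<mu> \<ge> 0\<close> that min]])
      (use assms in auto)
  then obtain v P N where good: "\<And>k. k < d \<Longrightarrow> good k (v k) (P k) (N k)" by metis
  note vPN = good[unfolded good_def]
  \<comment> \<open>An expert predicts whole vectors, so the pieces must be common to all
    coordinates; the sizes of the break sets add up.\<close>
  define Q where "Q = (\<Union>k<d. P k)"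
  define M where "M = real (\<Sum>k<d. N k)"
  have vb: "\<bar>v k t\<bar> \<le> 7/2" if "k < d" "t \<in> {1..n}" for k t
  proof -
    have "\<bar>v k t - r k t\<bar> \<le> 1" using vPN[OF that(1)] that(2) by auto
    then show ?thesis using interior[of k t] by linarith
  qed
  have "card Q \<le> (\<Sum>k<d. card (P k))" unfolding Q_def by (rule card_UN_le) simp
  also have "\<dots> \<le> (\<Sum>k<d. 5 * N k)" by (rule sum_mono) (use vPN in auto)
  finally have "card Q \<le> 5 * (\<Sum>k<d. N k)" by (simp add: sum_distrib_left)
  then have "real (card Q) \<le> real (5 * (\<Sum>k<d. N k))" by (simp only: of_nat_le_iff)
  then have "real (card Q) \<le> 5 * M" by (simp add: M_def)
  moreover have "Q \<subseteq> {1..n}" unfolding Q_def using vPN by (intro UN_least) simp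
  moreover have "1 \<in> Q" if "n \<ge> 1 \<and> d \<ge> 1"
    unfolding Q_def by (rule UN_I[of 0]) (use vPN[of 0] that in auto)
  moreover have "affine_off Q 1 n (v k)" if "k < d" for k
    using vPN[OF that] that by (auto simp: affine_off_def Q_def)
  moreover have "(\<Sum>t=1..n. f t (point v t)) + c * M \<le> objective \<mu> r0 +
       (c + 1) * (real d + real d * real n / \<beta>)" if r0: "feasible r0" for r0
  proof -
    have "(\<Sum>t=1..n. f t (point v t)) \<le> (\<Sum>t=1..n. penalised v t)"
      by (rule sum_mono) (simp add: penalised_def sum_nonneg)
    also have "\<dots> \<le> (\<Sum>t=1..n. penalised r t + (\<Sum>k<d. slope r k t * (v k t - r k t) + 2 * (v k t - r k t)\<^sup>2))"
    proof (rule sum_mono, rule penalised_smooth)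
      show "\<bar>r k t\<bar> \<le> 19" for k t by (rule order_trans[OF interior]) simp
      show "\<bar>v k t\<bar> \<le> 19" if "k < d" "t \<in> {1..n}" for k t by (rule order_trans[OF vb[OF that]]) simp
    qed
    also have "\<dots> = (\<Sum>t=1..n. penalised r t) + (\<Sum>k<d. \<Sum>t=1..n. slope r k t * (v k t - r k t) + 2 * (v k t - r k t)\<^sup>2)"
      unfolding sum.distrib[of "penalised r"] by (subst sum.swap) simp
    also have "\<dots> \<le> (\<Sum>t=1..n. penalised r t) + (\<Sum>k<d. real (N k))"
      by (intro add_left_mono sum_mono) (use vPN in auto)
    finally have 1: "(\<Sum>t=1..n. f t (point v t)) \<le> (\<Sum>t=1..n. penalised r t) + M" by (simp add: M_def)
    define V where "V = (\<Sum>k<d. second_var n (r k))"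
    have V0: "V \<ge> 0" by (simp add: V_def second_var_def sum_nonneg)
    have "M \<le> (\<Sum>k<d. 1 + real n / \<beta> + second_var n (r k) / \<delta>)"
      unfolding M_def of_nat_sum
    proof (rule sum_mono)
      fix k assume "k \<in> {..<d}"
      moreover have "(\<Sum>t<n. \<bar>second_diff (r k) t\<bar>) \<le> second_var n (r k)"
        unfolding second_var_def by (rule sum_mono2) auto
      then have "(\<Sum>t<n. \<bar>second_diff (r k) t\<bar>) / \<delta> \<le> second_var n (r k) / \<delta>"
        using \<open>\<delta> > 0\<close> by (intro divide_right_mono) auto
      ultimately show "real (N k) \<le> 1 + real n / \<beta> + second_var n (r k) / \<delta>" using vPN[of k] by auto
    qed
    also have "\<dots> = real d + real d * real n / \<beta> + V / \<delta>"
      by (simp add: sum.distrib V_def sum_divide_distrib distrib_left)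
    finally have "(c + 1) * M \<le> (c + 1) * (real d + real d * real n / \<beta> + V / \<delta>)"
      using \<open>c \<ge> 0\<close> by (intro mult_left_mono) auto
    also have "\<dots> = (c + 1) * (real d + real d * real n / \<beta>) + (c + 1) / \<delta> * V"
      by (simp add: algebra_simps)
    also have "(c + 1) / \<delta> * V \<le> \<mu> * V" using assms V0 by (intro mult_right_mono) auto
    finally have "(c + 1) * M \<le> (c + 1) * (real d + real d * real n / \<beta>) + \<mu> * V" by simp
    moreover have "(\<Sum>t=1..n. penalised r t) + \<mu> * V \<le> objective \<mu> r0"
      using min[OF r0] by (simp add: objective_def V_def)
    ultimately show ?thesis using 1 by (simp add: distrib_right)
  qed
  ultimately show ?thesis using vb
    by (intro exI[of _ v] exI[of _ Q] exI[of _ M] conjI allI impI ballI)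
qed

lemma piecewise_comparator_regret:
  assumes "n \<ge> 1" "d \<ge> 1" "\<mu> > 0" "\<beta> > 0" "\<delta> > 0" "\<beta> ^ 3 * \<delta>\<^sup>2 \<le> 1/9" and r0: "feasible r0"
    and base_affine: "\<And>k t. k < d \<Longrightarrow> 1 < t \<Longrightarrow> t < n \<Longrightarrow> second_diff (base k) t = 0"
    and c: "c = ln (real (Suc n)) / \<sigma> + (264 * real d + real d / \<sigma> * (ln (2 * real d) + ln (2 + \<sigma> * real n ^ 3)))"
    and \<mu>: "\<mu> = (5 * c + 1) / \<delta>"
  shows "(\<Sum>t=1..n. f t (flh_sions d \<sigma> 2 20 f t)) \<le> objective \<mu> r0 +
    (5 * c + 1) * (real d + real d * real n / \<beta>)"
proof -
  have "ln (2 + \<sigma> * real n ^ 3) \<ge> 0" "ln (2 * real d) \<ge> 0" "ln (real (Suc n)) \<ge> 0"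
    using \<sigma> \<open>d \<ge> 1\<close> by (auto intro!: ln_ge_zero add_increasing2)
  then have "c \<ge> 0" using \<sigma> unfolding c
    by (intro add_nonneg_nonneg mult_nonneg_nonneg divide_nonneg_nonneg) auto
  \<comment> \<open>Five pieces per bin, each with regret at most \<open>c\<close>, make
    \<open>5 * c\<close> the price of a bin.\<close>
  then have "5 * c \<ge> 0" "(5 * c + 1) / \<delta> \<le> \<mu>" using \<mu> by auto
  from piecewise_comparator[OF assms(3-6) this] obtain v P N where
    P: "P \<subseteq> {1..n}" "1 \<in> P" "real (card P) \<le> 5 * N" and v: "\<And>k. k < d \<Longrightarrow> affine_off P 1 n (v k)"
      "\<And>k t. k < d \<Longrightarrow> t \<in> {1..n} \<Longrightarrow> \<bar>v k t\<bar> \<le> 7/2"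
    and le: "(\<Sum>t=1..n. f t (point v t)) + 5 * c * N \<le> objective \<mu> r0 +
       (5 * c + 1) * (real d + real d * real n / \<beta>)"
    using assms(1,2) r0 by blast
  have "(\<Sum>t=1..n. f t (flh_sions d \<sigma> 2 20 f t) - f t (point v t)) \<le> real (card P) * c"
  proof (rule sum_pieces_le[OF P(1)])
    fix a b assume ab: "1 \<le> a" "a \<le> b" "b \<le> n" "{a<..b} \<inter> P = {}"
    define x where "x k t = base k t + v k t" for k t
    \<comment> \<open>On a one-point piece \<open>Suc a\<close> may belong to the next piece or lie
      beyond the horizon, so the slope is set to 0.\<close>
    define s where "s k = (if a < b then x k (Suc a) - x k a else 0)" for k
    \<comment> \<open>At \<open>t = a\<close> the covariate is \<open>[1, 1]\<close>, so the
      intercept is \<open>x k a - s k\<close> rather than \<open>x k a\<close>.\<close>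
    define \<theta> where "\<theta> = Matrix.vec (2 * d) (\<lambda>i. if even i then x (i div 2) a - s (i div 2) else s (i div 2))"
    have x: "x k t = x k a + (real t - real a) * s k" if "k < d" "t \<in> {a..b}" for k t
    proof (cases "a < b")
      case True
      have "x k t = x k a + (real t - real a) * (x k (Suc a) - x k a)"
      proof (rule affine_of_second_diff_0)
        fix u assume u: "a < u" "u < b"
        then have "u \<in> {a<..b}" "Suc u \<in> {a<..b}" by auto
        then have "u \<notin> P" "Suc u \<notin> P" using ab(4) by blast+
        then have "second_diff (v k) u = 0" "second_diff (base k) u = 0"
          using v(1)[OF that(1)] base_affine[OF that(1)] u ab by (auto simp: affine_off_def)
        then show "second_diff (x k) u = 0" unfolding x_def[abs_def] second_diff_add by simp
      qed (use that in auto)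
      with True show ?thesis by (simp add: s_def)
    next
      case False
      then have "t = a" using that by simp
      then show ?thesis by simp
    qed
    have xb: "\<bar>x k t\<bar> \<le> 9/2" if "k < d" "t \<in> {1..n}" for k t
      using base[OF that] v(2)[OF that] unfolding x_def by linarith
    have sb: "\<bar>s k\<bar> \<le> 9" if "k < d" for k
      using xb[OF that, of a] xb[OF that, of "Suc a"] ab by (auto simp: s_def)
    have ro: "readout d a t \<theta> = point v t" if "t \<in> {a..b}" for t
    proof (rule eq_vecI)
      fix k assume "k < dim_vec (point v t)"
      then have k: "k < d" by (simp add: point_def)
      have "readout d a t \<theta> $ k = x k a + (real t - real a) * s k"
        using k by (simp add: readout_index \<theta>_def algebra_simps)
      also have "\<dots> = x k t" using x[OF k that] by simp
      finally show "readout d a t \<theta> $ k = point v t $ k" using k by (simp add: point_def x_def)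
    qed (simp add: point_def)
    have "\<theta> \<bullet> \<theta> = (\<Sum>i<2 * d. (\<theta> $ i)\<^sup>2)"
      by (subst scalar_prod_eq_sum[of _ "2 * d"]) (auto simp: \<theta>_def power2_eq_square)
    also have "\<dots> = (\<Sum>k<d. (x k a - s k)\<^sup>2 + (s k)\<^sup>2)"
      unfolding sum_pairs by (intro sum.cong refl) (auto simp: \<theta>_def)
    \<comment> \<open>Points are bounded by 1 + 7/2 = 9/2, hence slopes by 9 and intercepts by 27/2;
      the squares add up to 263.25.\<close>
    also have "\<dots> \<le> (\<Sum>k<d. (27/2)\<^sup>2 + 9\<^sup>2)"
    proof (rule sum_mono, rule add_mono)
      fix k assume "k \<in> {..<d}"
      then have "\<bar>s k\<bar> \<le> 9" "\<bar>x k a\<bar> \<le> 9/2" using sb[of k] xb[of k a] ab by auto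
      then have "\<bar>x k a - s k\<bar> \<le> \<bar>27/2\<bar>" "\<bar>s k\<bar> \<le> \<bar>9\<bar>" by linarith+
      then show "(x k a - s k)\<^sup>2 \<le> (27/2)\<^sup>2" "(s k)\<^sup>2 \<le> 9\<^sup>2"
        by (simp_all only: abs_le_square_iff)
    qed
    also have "\<dots> \<le> 264 * real d" by (simp add: power2_eq_square)
    finally have \<theta>\<theta>: "\<theta> \<bullet> \<theta> \<le> 264 * real d" .
    have "(\<Sum>t=a..b. f t (flh_sions d \<sigma> 2 20 f t) - f t (readout d a t \<theta>)) \<le>
      ln (real (Suc n)) / \<sigma> + ((\<theta> \<bullet> \<theta>) + real d / \<sigma> * (ln (2 * real d) + ln (2 + \<sigma> * real n ^ 3)))"
    proof (rule flh_sions_interval_regret[OF \<sigma> f ab(1,2,3) \<open>d \<ge> 1\<close>])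
      fix t assume t: "t \<in> {a..b}"
      have "point v t \<in> cube d 20"
      proof (rule point_in_cube)
        show "\<bar>v k t\<bar> \<le> 19" if "k < d" for k
          by (rule order_trans[OF v(2)[OF that]]) (use t ab in auto)
      qed (use t ab in auto)
      then show "\<theta> \<in> sions_domain d 20 a t" using ro[OF t] by (simp add: sions_domain_iff \<theta>_def)
    qed
    also have "\<dots> \<le> c" using \<theta>\<theta> by (simp add: c)
    finally show "(\<Sum>t=a..b. f t (flh_sions d \<sigma> 2 20 f t) - f t (point v t)) \<le> c"
      by (simp add: ro)
  qed (use P in auto)
  also have "\<dots> \<le> 5 * N * c" using P(3) \<open>c \<ge> 0\<close> by (rule mult_right_mono)
  finally show ?thesis using le by (simp add: sum_subtractf mult.commute mult.left_commute)
qed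

end

subsection \<open>Regret against an arbitrary comparator\<close>

lemma first_diff_map:
  "first_diff (map u [a..<b]) = map (\<lambda>t. u (Suc t) - u t) [a..<b - 1]"
proof (rule nth_equalityI)
  fix i assume "i < length (first_diff (map u [a..<b]))"
  then have "Suc (a + i) < b" by (simp add: first_diff_def)
  then show "first_diff (map u [a..<b]) ! i = map (\<lambda>t. u (Suc t) - u t) [a..<b - 1] ! i"
    by (simp add: first_diff_def nth_tl less_diff_conv)
next
  show "length (first_diff (map u [a..<b])) = length (map (\<lambda>t. u (Suc t) - u t) [a..<b - 1])"
    unfolding first_diff_def length_map length_zip length_tl length_upt by simp
qed

text \<open>Only kinks strictly between 1 and \<open>n\<close> enter the path length, unlike
  \<open>second_var\<close>, whose zero extension may also have kinks at the ends.\<close>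

lemma TV1_eq:
  assumes w: "\<And>t. t \<in> {1..n} \<Longrightarrow> w t \<in> carrier_vec d"
  shows "TV1 (map w [1..<Suc n]) = real n * (\<Sum>k<d. \<Sum>t\<in>{1<..<n}. \<bar>second_diff (\<lambda>t. w t $ k) t\<bar>)"
proof -
  have "first_diff (first_diff (map w [1..<Suc n])) =
      map (\<lambda>t. (w (Suc (Suc t)) - w (Suc t)) - (w (Suc t) - w t)) [1..<n - 1]"
    unfolding first_diff_map by (simp del: upt_Suc)
  then have "seq_l1_norm (first_diff (first_diff (map w [1..<Suc n]))) =
      (\<Sum>t=1..<n - 1. l1_norm ((w (Suc (Suc t)) - w (Suc t)) - (w (Suc t) - w t)))"
    by (simp add: seq_l1_norm_def comp_def interv_sum_list_conv_sum_set_nat del: upt_Suc)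
  also have "\<dots> = (\<Sum>t=1..<n - 1. \<Sum>k<d. \<bar>second_diff (\<lambda>t. w t $ k) (Suc t)\<bar>)"
  proof (rule sum.cong[OF refl])
    fix t assume "t \<in> {1..<n - 1}"
    then have "w t \<in> carrier_vec d" "w (Suc t) \<in> carrier_vec d" "w (Suc (Suc t)) \<in> carrier_vec d"
      by (auto intro!: w)
    then show "l1_norm ((w (Suc (Suc t)) - w (Suc t)) - (w (Suc t) - w t)) =
        (\<Sum>k<d. \<bar>second_diff (\<lambda>t. w t $ k) (Suc t)\<bar>)"
      by (auto simp: l1_norm_def second_diff_def intro!: sum.cong)
  qed
  also have "\<dots> = (\<Sum>k<d. \<Sum>t=1..<n - 1. \<bar>second_diff (\<lambda>t. w t $ k) (Suc t)\<bar>)" by (rule sum.swap)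
  also have "\<dots> = (\<Sum>k<d. \<Sum>t\<in>{1<..<n}. \<bar>second_diff (\<lambda>t. w t $ k) t\<bar>)"
    by (intro sum.cong refl sum.reindex_bij_witness[where i = "\<lambda>t. t - 1" and j = Suc]) auto
  finally show ?thesis by (simp add: TV1_def)
qed

lemma abs_chord_le:
  assumes "1 \<le> t" "t \<le> n" "\<bar>x 1\<bar> \<le> c" "\<bar>x n\<bar> \<le> c"
  shows "\<bar>chord x 1 n t\<bar> \<le> c"
proof (cases "n = 1")
  case False
  define s where "s = (real t - 1) / (real n - 1)"
  have s: "0 \<le> s" "s \<le> 1" using assms False by (auto simp: s_def)
  have "chord x 1 n t = x 1 + (x n - x 1) * s" by (simp add: chord_def s_def)
  also have "\<dots> = (1 - s) * x 1 + s * x n" by (simp add: algebra_simps)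
  finally have "\<bar>chord x 1 n t\<bar> = \<bar>(1 - s) * x 1 + s * x n\<bar>" by simp
  also have "\<dots> \<le> (1 - s) * \<bar>x 1\<bar> + s * \<bar>x n\<bar>"
    using s by (intro order_trans[OF abs_triangle_ineq]) (simp add: abs_mult)
  also have "\<dots> \<le> (1 - s) * c + s * c" using s assms by (intro add_mono mult_left_mono) auto
  finally show ?thesis by (simp add: algebra_simps)
qed (use assms in \<open>simp add: chord_def\<close>)

text \<open>With the end-to-end chord as \<open>base\<close> the deviations vanish at 1 and
  \<open>n\<close>, so the zero extension costs only the factor 3; being affine, the chord does not
  disturb the pieces. Comparator and chord are bounded by 1, so deviations stay within 2, where the
  barrier is 0.\<close>

lemma flh_sions_regret:
  assumes \<sigma>: "\<sigma> > 0" and n: "n \<ge> 1" and d: "d \<ge> 1"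
    and f: "\<And>t. t \<in> {1..n} \<Longrightarrow> admissible_loss d \<sigma> (f t)"
    and w: "\<And>t. t \<in> {1..n} \<Longrightarrow> w t \<in> cube d 1"
    and \<beta>: "\<beta> > 0" "\<delta> > 0" "\<beta> ^ 3 * \<delta>\<^sup>2 \<le> 1/9"
    and c: "c = ln (real (Suc n)) / \<sigma> + (264 * real d + real d / \<sigma> * (ln (2 * real d) + ln (2 + \<sigma> * real n ^ 3)))"
    and V: "V = (\<Sum>k<d. \<Sum>t\<in>{1<..<n}. \<bar>second_diff (\<lambda>t. w t $ k) t\<bar>)"
  shows "(\<Sum>t=1..n. f t (flh_sions d \<sigma> 2 20 f t) - f t (w t)) \<le>
    (5 * c + 1) * (real d + real d * real n / \<beta> + 3 * V / \<delta>)"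
proof -
  define x where "x k t = w t $ k" for k t
  have x: "\<bar>x k t\<bar> \<le> 1" if "k < d" "t \<in> {1..n}" for k t
    using w[OF that(2)] that(1) by (auto simp: x_def cube_def abs_le_iff)
  have wc: "w t \<in> carrier_vec d" if "t \<in> {1..n}" for t using w[OF that] by (simp add: cube_def)
  define base where "base k = chord (x k) 1 n" for k
  have base: "\<bar>base k t\<bar> \<le> 1" if "k < d" "t \<in> {1..n}" for k t
    unfolding base_def by (rule abs_chord_le) (use that x n in auto)
  define r0 where "r0 k t = (if k < d then - chord_gap (x k) 1 n t else 0)" for k t
  have r0_eq: "r0 k t = x k t - base k t" if "k < d" "t \<in> {1..n}" for k t
    using that by (auto simp: r0_def chord_gap_def base_def)
  have r0_le: "\<bar>r0 k t\<bar> \<le> 2" for k t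
  proof (cases "k < d \<and> t \<in> {1..n}")
    case True
    then show ?thesis using r0_eq[of k t] x[of k t] base[of k t] by auto
  qed (auto simp: r0_def chord_gap_def)
  interpret offline_problem d n \<sigma> f base by unfold_locales (fact \<sigma> f base)+
  have fe: "feasible r0"
    unfolding feasible_def
  proof (intro conjI allI impI)
    show "\<bar>r0 k t\<bar> \<le> 3" for k t by (rule order_trans[OF r0_le]) simp
  qed (auto simp: r0_def chord_gap_def)
  define \<mu> where "\<mu> = (5 * c + 1) / \<delta>"
  have "ln (2 + \<sigma> * real n ^ 3) \<ge> 0" "ln (2 * real d) \<ge> 0" "ln (real (Suc n)) \<ge> 0"
    using \<sigma> d by (auto intro!: ln_ge_zero add_increasing2)
  then have "c \<ge> 0" using \<sigma> unfolding c
    by (intro add_nonneg_nonneg mult_nonneg_nonneg divide_nonneg_nonneg) auto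
  then have \<mu>0: "\<mu> > 0" using \<beta> by (simp add: \<mu>_def)
  have "(\<Sum>t=1..n. f t (flh_sions d \<sigma> 2 20 f t)) \<le> objective \<mu> r0 +
      (5 * c + 1) * (real d + real d * real n / \<beta>)"
    by (rule piecewise_comparator_regret[OF n d \<mu>0 \<beta> fe _ c \<mu>_def])
      (auto simp: base_def intro!: second_diff_chord)
  also have "objective \<mu> r0 \<le> (\<Sum>t=1..n. f t (w t)) + \<mu> * (3 * V)"
  proof -
    have "(\<Sum>t=1..n. penalised r0 t) = (\<Sum>t=1..n. f t (w t))"
    proof (rule sum.cong[OF refl])
      fix t assume t: "t \<in> {1..n}"
      have "point r0 t = w t"
        using wc[OF t] r0_eq[OF _ t] by (intro eq_vecI) (auto simp: point_def x_def)
      then show "penalised r0 t = f t (w t)"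
        using r0_le by (simp add: penalised_def barrier_eq_0)
    qed
    moreover have "(\<Sum>k<d. second_var n (r0 k)) \<le> (\<Sum>k<d. 3 * (\<Sum>t\<in>{1<..<n}. \<bar>second_diff (x k) t\<bar>))"
    proof (rule sum_mono)
      fix k assume "k \<in> {..<d}"
      then have "r0 k = (\<lambda>t. - chord_gap (x k) 1 n t)" by (auto simp: r0_def)
      then have "second_var n (r0 k) = second_var n (chord_gap (x k) 1 n)" by (simp add: second_var_uminus)
      then show "second_var n (r0 k) \<le> 3 * (\<Sum>t\<in>{1<..<n}. \<bar>second_diff (x k) t\<bar>)"
        using second_var_chord_gap[of 1 n n "x k"] n by simp
    qed
    then have "(\<Sum>k<d. second_var n (r0 k)) \<le> 3 * V"
      by (simp add: V x_def[abs_def] sum_distrib_left)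
    then have "\<mu> * (\<Sum>k<d. second_var n (r0 k)) \<le> \<mu> * (3 * V)"
      using \<mu>0 by (intro mult_left_mono) auto
    ultimately show ?thesis by (simp add: objective_def)
  qed
  finally show ?thesis by (simp add: sum_subtractf \<mu>_def distrib_left)
qed

text \<open>For \<open>n\<close> below \<open>d\<close> the term \<open>ln d\<close> of the expert
  regret need not be bounded in terms of \<open>ln n\<close>; there the Lipschitz bound over at most
  \<open>d\<close> rounds is already good enough.\<close>

lemma flh_sions_regret_small_horizon:
  assumes \<sigma>: "\<sigma> > 0" and "n \<le> d"
    and f: "\<And>t. t \<in> {1..n} \<Longrightarrow> admissible_loss d \<sigma> (f t)"
    and w: "\<And>t. t \<in> {1..n} \<Longrightarrow> w t \<in> cube d 1"
  shows "(\<Sum>t=1..n. f t (flh_sions d \<sigma> 2 20 f t) - f t (w t)) \<le> 21 * (real d)\<^sup>2"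
proof -
  have "(\<Sum>t=1..n. f t (flh_sions d \<sigma> 2 20 f t) - f t (w t)) \<le> (\<Sum>t=1..n. 21 * real d)"
  proof (rule sum_mono)
    fix t assume t: "t \<in> {1..n}"
    define p where "p = flh_sions d \<sigma> 2 20 f t"
    have p: "p \<in> cube d 20" unfolding p_def by (rule flh_sions_in_cube[OF \<sigma> f t])
    have w20: "w t \<in> cube d 20" using w[OF t] by (force simp: cube_def)
    have "\<bar>f t p - f t (w t)\<bar> \<le> 1 * l2_norm (p - w t)"
      using f[OF t] p w20 unfolding admissible_loss_def l2_lipschitz_on_def by blast
    also have "\<dots> \<le> l1_norm (p - w t)" using l2_norm_le_l1 by simp
    also have "\<dots> = (\<Sum>k<d. \<bar>p $ k - w t $ k\<bar>)"
      using w[OF t] by (auto simp: l1_norm_def cube_def)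
    also have "\<dots> \<le> (\<Sum>k<d. 21)"
      by (rule sum_mono) (use p w[OF t] in \<open>fastforce simp: cube_def abs_le_iff\<close>)
    finally show "f t p - f t (w t) \<le> 21 * real d" by simp
  qed
  also have "\<dots> \<le> 21 * (real d * real d)"
    using \<open>n \<le> d\<close> by (simp add: mult_right_mono)
  finally show ?thesis by (simp add: power2_eq_square)
qed

text \<open>\<open>d \<le> n\<close> replaces \<open>ln d\<close> by \<open>ln n\<close>. With
  \<open>d * (1 + ln n)\<close> factored out, the contributions are 5 * (264 + 1) + 1 = 1326 and 5 *
  (1 + 5) / \<sigma> = 30 / \<sigma>.\<close>

lemma expert_regret_constant_le:
  assumes \<sigma>: "\<sigma> > 0" and "n \<ge> 1" "d \<ge> 1" "d \<le> n"
  shows "5 * (ln (real (Suc n)) / \<sigma> + (264 * real d + real d / \<sigma> * (ln (2 * real d) + ln (2 + \<sigma> * real n ^ 3)))) + 1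
    \<le> (1326 + 30 / \<sigma>) * (real d * (1 + ln (real n)))"
proof -
  define l where "l = ln (real n)"
  have l0: "l \<ge> 0" using \<open>n \<ge> 1\<close> by (simp add: l_def)
  have "ln (2::real) \<le> 1" using ln_le_minus_one[of 2] by simp
  have "ln (real (Suc n)) \<le> ln (2 * real n)" using \<open>n \<ge> 1\<close> by (intro ln_mono) auto
  also have "\<dots> \<le> 1 + l" using \<open>n \<ge> 1\<close> \<open>ln (2::real) \<le> 1\<close> by (simp add: ln_mult l_def)
  finally have 1: "ln (real (Suc n)) \<le> 1 + l" .
  have "ln (2 * real d) \<le> ln (2 * real n)" using assms by (intro ln_mono) auto
  also have "\<dots> \<le> 1 + l" using \<open>n \<ge> 1\<close> \<open>ln (2::real) \<le> 1\<close> by (simp add: ln_mult l_def)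
  finally have 2: "ln (2 * real d) \<le> 1 + l" .
  have "1 \<le> real n ^ 3" using \<open>n \<ge> 1\<close> by (simp add: one_le_power)
  then have "2 + \<sigma> * real n ^ 3 \<le> (2 + \<sigma>) * real n ^ 3" by (simp add: distrib_right)
  then have "ln (2 + \<sigma> * real n ^ 3) \<le> ln ((2 + \<sigma>) * real n ^ 3)"
    using \<sigma> \<open>n \<ge> 1\<close> by (intro ln_mono) (auto intro!: add_pos_nonneg)
  also have "\<dots> = ln (2 + \<sigma>) + 3 * l"
    using \<sigma> \<open>n \<ge> 1\<close> by (simp add: ln_mult ln_realpow l_def)
  also have "ln (2 + \<sigma>) \<le> 1 + \<sigma>" using ln_le_minus_one[of "2 + \<sigma>"] \<sigma> by simp
  also have "1 + \<sigma> + 3 * l \<le> (4 + \<sigma>) * (1 + l)" using l0 \<sigma> by (simp add: algebra_simps)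
  finally have 3: "ln (2 + \<sigma> * real n ^ 3) \<le> (4 + \<sigma>) * (1 + l)" by simp
  have D: "1 + l \<le> real d * (1 + l)" "real d \<le> real d * (1 + l)" "1 \<le> real d * (1 + l)"
    using \<open>d \<ge> 1\<close> l0 mult_mono[of 1 "real d" 1 "1 + l"] by (auto simp: mult_le_cancel_right1)
  have p: "ln (real (Suc n)) / \<sigma> \<le> real d * (1 + l) / \<sigma>"
    using 1 D(1) \<sigma> by (intro divide_right_mono) auto
  have "real d / \<sigma> * (ln (2 * real d) + ln (2 + \<sigma> * real n ^ 3)) \<le> real d / \<sigma> * ((1 + l) + (4 + \<sigma>) * (1 + l))"
    using 2 3 \<sigma> by (intro mult_left_mono add_mono) auto
  also have "\<dots> = (5 / \<sigma> + 1) * (real d * (1 + l))"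
    using \<sigma> by (simp add: field_simps)
  finally have q: "real d / \<sigma> * (ln (2 * real d) + ln (2 + \<sigma> * real n ^ 3)) \<le> (5 / \<sigma> + 1) * (real d * (1 + l))" .
  have "5 * (ln (real (Suc n)) / \<sigma> + (264 * real d + real d / \<sigma> * (ln (2 * real d) + ln (2 + \<sigma> * real n ^ 3)))) + 1
    \<le> 5 * (real d * (1 + l) / \<sigma> + (264 * (real d * (1 + l)) + (5 / \<sigma> + 1) * (real d * (1 + l)))) + real d * (1 + l)"
    by (intro add_mono mult_left_mono p q D(2,3)) simp_all
  also have "\<dots> = (1326 + 30 / \<sigma>) * (real d * (1 + l))"
    by (simp add: algebra_simps add_divide_distrib)
  finally show ?thesis by (simp add: l_def)
qed

text \<open>\<open>\<beta>\<close> balances the number of pieces \<open>d n / \<beta>\<close> against the variation term \<open>\<beta> powr (3/2) * V\<close>.\<close>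

lemma bin_width_tradeoff:
  fixes n d :: nat and V :: real
  assumes "n \<ge> 1" "d \<ge> 1" "V \<ge> 0"
  shows "\<exists>\<beta>>0. \<exists>\<delta>>0. \<beta> ^ 3 * \<delta>\<^sup>2 \<le> 1/9 \<and> real d + real d * real n / \<beta> + 3 * V / \<delta>
    \<le> 12 * real d * max (real n powr (1/5) * (real n * V) powr (2/5)) 1"
proof -
  define m where "m = max (real n powr (1/5) * (real n * V) powr (2/5)) 1"
  have powr_sq: "(x powr (3/2))\<^sup>2 = x ^ 3" if "x > 0" for x :: real
    using that by (simp add: power2_eq_square flip: powr_add)
  show ?thesis
  proof (cases "V = 0")
    case True
    \<comment> \<open>Without variation a bin may be as wide as the horizon.\<close>
    have "real n ^ 3 * (1 / (3 * real n powr (3/2)))\<^sup>2 = 1/9"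
      using powr_sq[of "real n"] \<open>n \<ge> 1\<close> by (simp add: power_divide power_mult_distrib)
    then show ?thesis using True assms
      by (intro exI[of _ "real n"] exI[of _ "1 / (3 * real n powr (3/2))"] conjI) auto
  next
    case False
    then have "V > 0" using assms by simp
    define D where "D = real d * real n"
    have D: "D > 0" using assms by (simp add: D_def)
    \<comment> \<open>This width solves \<open>D / \<beta> = \<beta> powr (3/2) * V\<close>, so both
      terms become multiples of the same \<open>Y\<close>.\<close>
    define \<beta> where "\<beta> = (D / V) powr (2/5)"
    define \<delta> where "\<delta> = 1 / (3 * \<beta> powr (3/2))"
    have \<beta>: "\<beta> > 0" using D \<open>V > 0\<close> by (simp add: \<beta>_def)
    then have \<delta>: "\<delta> > 0" by (simp add: \<delta>_def)
    have "\<beta> ^ 3 * \<delta>\<^sup>2 = 1/9"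
      using powr_sq[OF \<beta>] \<beta> by (simp add: \<delta>_def power_divide power_mult_distrib)
    define Y where "Y = D powr (3/5) * V powr (2/5)"
    have "D / \<beta> = D powr 1 / (D powr (2/5) / V powr (2/5))"
      using D \<open>V > 0\<close> by (simp add: \<beta>_def powr_divide)
    also have "\<dots> = D powr (1 - 2/5) * V powr (2/5)"
      using D \<open>V > 0\<close> by (simp only: powr_diff) simp
    finally have Y1: "D / \<beta> = Y" by (simp add: Y_def)
    have "3 * V / \<delta> = 9 * (\<beta> powr (3/2) * V)" by (simp add: \<delta>_def)
    also have "\<beta> powr (3/2) = D powr (3/5) / V powr (3/5)"
      using D \<open>V > 0\<close> by (simp add: \<beta>_def powr_powr powr_divide)
    also have "D powr (3/5) / V powr (3/5) * V = D powr (3/5) * (V powr 1 / V powr (3/5))"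
      using \<open>V > 0\<close> by simp
    also have "V powr 1 / V powr (3/5) = V powr (1 - 3/5)" by (simp only: powr_diff)
    finally have Y2: "3 * V / \<delta> = 9 * Y" by (simp add: Y_def)
    have "Y = real d powr (3/5) * (real n powr (3/5) * V powr (2/5))"
      by (simp add: Y_def D_def powr_mult)
    \<comment> \<open>Only \<open>d powr (3/5)\<close> arises here; it is rounded up to
      \<open>d\<close>.\<close>
    also have "\<dots> \<le> real d powr 1 * (real n powr (3/5) * V powr (2/5))"
      using \<open>d \<ge> 1\<close> by (intro mult_right_mono powr_mono) auto
    also have "real n powr (3/5) * V powr (2/5) = real n powr (1/5) * (real n * V) powr (2/5)"
      using \<open>n \<ge> 1\<close> \<open>V > 0\<close> by (simp add: powr_mult flip: powr_add)
    also have "real d powr 1 * \<dots> \<le> real d * m" by (simp add: m_def mult_left_mono)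
    finally have "Y \<le> real d * m" .
    moreover have "real d * 1 \<le> real d * m" by (intro mult_left_mono) (auto simp: m_def)
    moreover have "0 \<le> real d * m" by (simp add: m_def)
    \<comment> \<open>The count is 1 + 1 + 9 = 11 copies of \<open>real d * m\<close>.\<close>
    ultimately have "real d + D / \<beta> + 3 * V / \<delta> \<le> 12 * real d * m"
      unfolding Y1 Y2 by linarith
    then show ?thesis using \<beta> \<delta> \<open>\<beta> ^ 3 * \<delta>\<^sup>2 = 1/9\<close>
      by (intro exI[of _ \<beta>] exI[of _ \<delta>] conjI) (auto simp: D_def m_def)
  qed
qed

theorem theorem3:
  fixes \<sigma> :: real
  assumes "\<sigma> > 0"
  shows "\<exists>K>0. \<forall>(n::nat) (d::nat) (f :: nat \<Rightarrow> real Matrix.vec \<Rightarrow> real) (W :: real Matrix.vec set)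
            (w :: nat \<Rightarrow> real Matrix.vec).
    n \<ge> 1 \<longrightarrow> d \<ge> 1 \<longrightarrow>
    W \<subseteq> cube d 1 \<longrightarrow>
    (\<forall>t\<in>{1..n}. admissible_loss d \<sigma> (f t)) \<longrightarrow>
    (\<forall>t\<in>{1..n}. w t \<in> W) \<longrightarrow>
    (\<Sum>t=1..n. f t (flh_sions d \<sigma> 2 20 f t) - f t (w t))
      \<le> K * (1 + ln (real n)) powr K *
         max ((real d)\<^sup>2 * real n powr (1/5) * TV1 (map w [1..<Suc n]) powr (2/5)) ((real d)\<^sup>2)"
proof -
  \<comment> \<open>12 is from \<open>bin_width_tradeoff\<close>, the bracket from
    \<open>expert_regret_constant_le\<close>. The same \<open>K\<close> is the exponent of the
    logarithm, where any value of at least 1 would do, and it covers the 21 of the small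
    horizon.\<close>
  define K where "K = 12 * (1326 + 30 / \<sigma>)"
  have K: "K \<ge> 21" using assms by (simp add: K_def add_increasing2)
  show ?thesis
  proof (intro exI[of _ K] conjI allI impI)
    show "K > 0" using K by simp
    fix n d :: nat and f :: "nat \<Rightarrow> real Matrix.vec \<Rightarrow> real" and W and w :: "nat \<Rightarrow> real Matrix.vec"
    assume n: "n \<ge> 1" and d: "d \<ge> 1" and W: "W \<subseteq> cube d 1"
      and f': "\<forall>t\<in>{1..n}. admissible_loss d \<sigma> (f t)" and w': "\<forall>t\<in>{1..n}. w t \<in> W"
    have f: "admissible_loss d \<sigma> (f t)" if "t \<in> {1..n}" for t using f' that by blast
    have w: "w t \<in> cube d 1" if "t \<in> {1..n}" for t using w' W that by blast
    define V where "V = (\<Sum>k<d. \<Sum>t\<in>{1<..<n}. \<bar>second_diff (\<lambda>t. w t $ k) t\<bar>)"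
    have TV: "TV1 (map w [1..<Suc n]) = real n * V"
      unfolding V_def by (rule TV1_eq) (use w in \<open>auto simp: cube_def\<close>)
    define m where "m = max (real n powr (1/5) * (real n * V) powr (2/5)) 1"
    define l where "l = 1 + ln (real n)"
    have l: "l \<ge> 1" using n by (simp add: l_def)
    have m: "m \<ge> 1" by (simp add: m_def)
    have max: "max ((real d)\<^sup>2 * real n powr (1/5) * (real n * V) powr (2/5)) ((real d)\<^sup>2) = (real d)\<^sup>2 * m"
      by (simp add: m_def max_mult_distrib_left mult.assoc)
    have "(\<Sum>t=1..n. f t (flh_sions d \<sigma> 2 20 f t) - f t (w t)) \<le> K * l * ((real d)\<^sup>2 * m)"
    proof (cases "n \<le> d")
      case True
      have "(\<Sum>t=1..n. f t (flh_sions d \<sigma> 2 20 f t) - f t (w t)) \<le> 21 * (real d)\<^sup>2"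
        by (rule flh_sions_regret_small_horizon[OF assms True f w])
      also have "\<dots> \<le> (K * l) * ((real d)\<^sup>2 * m)"
        using K l m mult_mono[of 21 K 1 l] mult_mono[of "(real d)\<^sup>2" "(real d)\<^sup>2" 1 m]
        by (intro mult_mono) auto
      finally show ?thesis .
    next
      case False
      define c where "c = ln (real (Suc n)) / \<sigma> + (264 * real d + real d / \<sigma> * (ln (2 * real d) + ln (2 + \<sigma> * real n ^ 3)))"
      have "V \<ge> 0" by (simp add: V_def sum_nonneg)
      from bin_width_tradeoff[OF n d this] obtain \<beta> \<delta> where \<beta>: "\<beta> > 0" "\<delta> > 0" "\<beta> ^ 3 * \<delta>\<^sup>2 \<le> 1/9"
        and le: "real d + real d * real n / \<beta> + 3 * V / \<delta> \<le> 12 * real d * m"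
        unfolding m_def by blast
      have "0 \<le> real d + real d * real n / \<beta> + 3 * V / \<delta>" using \<beta> \<open>V \<ge> 0\<close> by simp
      have "(\<Sum>t=1..n. f t (flh_sions d \<sigma> 2 20 f t) - f t (w t)) \<le>
          (5 * c + 1) * (real d + real d * real n / \<beta> + 3 * V / \<delta>)"
        by (rule flh_sions_regret[OF assms n d f w \<beta> c_def V_def])
      also have "\<dots> \<le> ((1326 + 30 / \<sigma>) * (real d * l)) * (12 * real d * m)"
      proof (rule mult_mono[OF _ le])
        show "5 * c + 1 \<le> (1326 + 30 / \<sigma>) * (real d * l)"
          unfolding c_def l_def by (rule expert_regret_constant_le) (use assms n d False in auto)
      qed (use assms l \<open>0 \<le> real d + _ + _\<close> in auto)
      also have "\<dots> = K * l * ((real d)\<^sup>2 * m)" by (simp add: K_def power2_eq_square)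
      finally show ?thesis .
    qed
    also have "\<dots> \<le> K * l powr K * ((real d)\<^sup>2 * m)"
      using K l m powr_mono[of 1 K l] by (intro mult_right_mono mult_left_mono) auto
    finally show "(\<Sum>t=1..n. f t (flh_sions d \<sigma> 2 20 f t) - f t (w t)) \<le> K * (1 + ln (real n)) powr K *
        max ((real d)\<^sup>2 * real n powr (1/5) * TV1 (map w [1..<Suc n]) powr (2/5)) ((real d)\<^sup>2)"
      unfolding TV max l_def .
  qed
qed

end
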